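(* Let $\Pi$ be a $1$-periodic domain with periodic cell $\varpi$ as in the context. The Floquet transform $\mathsf F$ maps $A^2(\Pi)$ onto $L^2(-\pi,\pi;A^2_\eta(\varpi))$. Its inverse $\mathsf F^{-1}:L^2(-\pi,\pi;A^2_\eta(\varpi))\to A^2(\Pi)$ is given by the formula $$\mathsf F^{-1}g(z)=\frac1{\sqrt{2\pi}}\int_{-\pi}^{\pi}e^{i[\mathrm{Re}\,z]\eta}\,g\big(z-[\mathrm{Re}\,z],\eta\big)\,d\eta,\qquad z\in\Pi$$ (equality in $L^2(\Pi)$). Moreover, $\mathsf F$ preserves the inner product and is thus a unitary operator from $A^2(\Pi)$ onto $L^2(-\pi,\pi;A_\eta^2(\varpi))$.
   Context: Geometry. Identify $\mathbb C\cong\mathbb R^2$. Let $M>0$, $a<b$ be real and let $\varpi\subset\,]0,1[\,\times\,]-M,M[$ be a domain (the periodic cell) whose closure meets the lines $\mathrm{Re}\,z=0$ and $\mathrm{Re}\,z=1$ exactly in $\{0\}\times[a,b]$ and $\{1\}\times[a,b]$. For $m\in\mathbb Z$ let $\varpi_m=\varpi+m$, and let the periodic domain $\Pi$ be the interior of $\bigcup_{m\in\mathbb Z}\mathrm{cl}(\varpi_m)$. It is assumed that $\varpi$ and $\Pi$ are Lipschitz domains with piecewise smooth boundaries ($\partial\varpi$ consists of finitely many curves $\gamma:[0,1]\to\mathbb C$ continuously differentiable on $[0,1]$). ($\Pi$ need not be simply connected.) $L^2(\Omega)$ is taken with respect to area measure, and $A^2(\Omega)$ is its closed subspace of analytic functions.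 $[x]$ is the largest integer $\le x$. Floquet transform: for $f\in L^2(\Pi)$, $$\mathsf Ff(z,\eta)=\frac1{\sqrt{2\pi}}\sum_{m\in\mathbb Z}e^{-i\eta m}f(z+m),\qquad z\in\varpi,\ \eta\in[-\pi,\pi],$$ the series converging in the Bochner space $L^2(-\pi,\pi;L^2(\varpi))$; it is well known that $\mathsf F$ is an isometric isomorphism of $L^2(\Pi)$ onto $L^2(-\pi,\pi;L^2(\varpi))$. Spaces: for $\eta\in[-\pi,\pi]$, $A^2_{\eta,\mathrm{ext}}(\varpi)$ is the subspace of $A^2(\varpi)$ consisting of functions $f$ which extend analytically to a neighborhood in $\Pi$ of the set $\mathrm{cl}(\varpi)\cap\Pi$ and satisfy $f(1+iy)=e^{i\eta}f(iy)$ for all $a<y<b$. $A^2_\eta(\varpi)$ is the closure of $A^2_{\eta,\mathrm{ext}}(\varpi)$ in $A^2(\varpi)$. $L^2(-\pi,\pi;A^2_\eta(\varpi))$ is the (closed) subspace of $L^2(-\pi,\pi;A^2(\varpi))$ of those $f$ with $f(\cdot,\eta)\in A^2_\eta(\varpi)$ for a.e. $\eta\in[-\pi,\pi]$. *)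

theory Defs
  imports "HOL-Analysis.Analysis"
begin

section \<open>Periodic domains\<close>

text \<open>Near each boundary point, in rotated coordinates \<open>(x, y)\<close> centred at that point, the set is
  the part of a box that lies strictly below the graph of a Lipschitz function and its boundary is
  that graph. The bound \<open>h / 2\<close> keeps the graph away from the top and bottom of the box.\<close>

definition Lipschitz_domain :: "complex set \<Rightarrow> bool" where
  "Lipschitz_domain \<Omega> \<longleftrightarrow>
     open \<Omega> \<and> connected \<Omega> \<and> \<Omega> \<noteq> {} \<and>
     (\<forall>p\<in>frontier \<Omega>. \<exists>c r h \<phi> L.
        norm (c::complex) = 1 \<and> 0 < r \<and> 0 < h \<and>
        L-lipschitz_on {-r<..<r} \<phi> \<and> (\<forall>x\<in>{-r<..<r}. \<bar>\<phi> x\<bar> \<le> h / 2) \<and>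
        (\<forall>x\<in>{-r<..<r}. \<forall>y\<in>{-h<..<h}.
           (p + c * Complex x y \<in> \<Omega> \<longleftrightarrow> y < \<phi> x) \<and>
           (p + c * Complex x y \<in> frontier \<Omega> \<longleftrightarrow> y = \<phi> x)))"

text \<open>For a bounded set, local finiteness of \<open>\<Gamma>\<close> says that \<open>\<Gamma>\<close> is finite; the weaker form is
  needed for a periodic domain, whose boundary is unbounded.\<close>

definition piecewise_smooth_boundary :: "complex set \<Rightarrow> bool" where
  "piecewise_smooth_boundary \<Omega> \<longleftrightarrow>
     (\<exists>\<Gamma>. (\<forall>\<gamma>\<in>\<Gamma>. \<gamma> C1_differentiable_on {0..1}) \<and>
          frontier \<Omega> = (\<Union>\<gamma>\<in>\<Gamma>. path_image \<gamma>) \<and>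
          (\<forall>R. finite {\<gamma>\<in>\<Gamma>. path_image \<gamma> \<inter> cball 0 R \<noteq> {}}))"

definition periodic_domain :: "complex set \<Rightarrow> complex set" where
  "periodic_domain \<omega> = interior (\<Union>m::int. closure ((\<lambda>z. z + of_int m) ` \<omega>))"

definition periodic_cell :: "real \<Rightarrow> real \<Rightarrow> real \<Rightarrow> complex set \<Rightarrow> bool" where
  "periodic_cell M a b \<omega> \<longleftrightarrow>
     0 < M \<and> a < b \<and>
     \<omega> \<subseteq> {z. 0 < Re z \<and> Re z < 1 \<and> -M < Im z \<and> Im z < M} \<and>
     closure \<omega> \<inter> {z. Re z = 0} = {z. Re z = 0 \<and> a \<le> Im z \<and> Im z \<le> b} \<and>
     closure \<omega> \<inter> {z. Re z = 1} = {z. Re z = 1 \<and> a \<le> Im z \<and> Im z \<le> b} \<and>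
     Lipschitz_domain \<omega> \<and> piecewise_smooth_boundary \<omega> \<and>
     Lipschitz_domain (periodic_domain \<omega>) \<and> piecewise_smooth_boundary (periodic_domain \<omega>)"


section \<open>Square integrable and analytic functions\<close>

text \<open>Elements of \<open>L2 \<Omega>\<close> are representatives; only their values almost everywhere on \<open>\<Omega>\<close>
  matter.\<close>

definition L2 :: "complex set \<Rightarrow> (complex \<Rightarrow> complex) set" where
  "L2 \<Omega> = {f. f \<in> borel_measurable (lebesgue_on \<Omega>) \<and>
               integrable (lebesgue_on \<Omega>) (\<lambda>z. (norm (f z))\<^sup>2)}"

definition L2_inner :: "complex set \<Rightarrow> (complex \<Rightarrow> complex) \<Rightarrow> (complex \<Rightarrow> complex) \<Rightarrow> complex" where
  "L2_inner \<Omega> f g = integral\<^sup>L (lebesgue_on \<Omega>) (\<lambda>z. f z * cnj (g z))"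

definition L2_norm :: "complex set \<Rightarrow> (complex \<Rightarrow> complex) \<Rightarrow> real" where
  "L2_norm \<Omega> f = sqrt (integral\<^sup>L (lebesgue_on \<Omega>) (\<lambda>z. (norm (f z))\<^sup>2))"

text \<open>A function on \<open>\<Omega>\<close> is encoded as its extension by zero, so that elements of \<open>A2 \<Omega>\<close> are
  equal as soon as they agree on \<open>\<Omega>\<close>.\<close>

definition A2 :: "complex set \<Rightarrow> (complex \<Rightarrow> complex) set" where
  "A2 \<Omega> = {f \<in> L2 \<Omega>. f analytic_on \<Omega> \<and> (\<forall>z. z \<notin> \<Omega> \<longrightarrow> f z = 0)}"

text \<open>In the quasi-periodicity condition the values on the vertical lines are those of the analytic
  extension \<open>h\<close>.\<close>

definition A2_ext :: "real \<Rightarrow> real \<Rightarrow> complex set \<Rightarrow> real \<Rightarrow> (complex \<Rightarrow> complex) set" where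
  "A2_ext a b \<omega> \<eta> = {f \<in> A2 \<omega>. \<exists>U h.
     open U \<and> closure \<omega> \<inter> periodic_domain \<omega> \<subseteq> U \<and> U \<subseteq> periodic_domain \<omega> \<and>
     h analytic_on U \<and> (\<forall>z\<in>\<omega>. h z = f z) \<and>
     (\<forall>y. a < y \<and> y < b \<longrightarrow> h (Complex 1 y) = exp (\<i> * of_real \<eta>) * h (Complex 0 y))}"

definition A2_eta :: "real \<Rightarrow> real \<Rightarrow> complex set \<Rightarrow> real \<Rightarrow> (complex \<Rightarrow> complex) set" where
  "A2_eta a b \<omega> \<eta> =
     {f \<in> A2 \<omega>. \<forall>\<epsilon>>0. \<exists>g\<in>A2_ext a b \<omega> \<eta>. L2_norm \<omega> (\<lambda>z. f z - g z) < \<epsilon>}"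


section \<open>Bochner spaces over the interval from \<open>-pi\<close> to \<open>pi\<close>\<close>

text \<open>\<open>X\<close> is a space of functions on \<open>\<Omega>\<close> (\<open>L2 \<Omega>\<close> or \<open>A2 \<Omega>\<close>) with the norm of \<open>L2 \<Omega>\<close>.\<close>

definition strongly_measurable ::
    "complex set \<Rightarrow> (complex \<Rightarrow> complex) set \<Rightarrow> (real \<Rightarrow> complex \<Rightarrow> complex) \<Rightarrow> bool" where
  "strongly_measurable \<Omega> X G \<longleftrightarrow>
     (\<exists>S :: nat \<Rightarrow> real \<Rightarrow> complex \<Rightarrow> complex.
        (\<forall>n. simple_function (lebesgue_on {-pi..pi}) (S n) \<and> (\<forall>\<eta>\<in>{-pi..pi}. S n \<eta> \<in> X)) \<and>
        (AE \<eta> in lebesgue_on {-pi..pi}. (\<lambda>n. L2_norm \<Omega> (\<lambda>z. S n \<eta> z - G \<eta> z)) \<longlonglongrightarrow> 0))"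

definition bochner_L2 ::
    "complex set \<Rightarrow> (complex \<Rightarrow> complex) set \<Rightarrow> (real \<Rightarrow> complex \<Rightarrow> complex) set" where
  "bochner_L2 \<Omega> X = {G. (\<forall>\<eta>\<in>{-pi..pi}. G \<eta> \<in> X) \<and> strongly_measurable \<Omega> X G \<and>
     integrable (lebesgue_on {-pi..pi}) (\<lambda>\<eta>. (L2_norm \<Omega> (G \<eta>))\<^sup>2)}"

definition bochner_inner ::
    "complex set \<Rightarrow> (real \<Rightarrow> complex \<Rightarrow> complex) \<Rightarrow> (real \<Rightarrow> complex \<Rightarrow> complex) \<Rightarrow> complex" where
  "bochner_inner \<Omega> G H = integral\<^sup>L (lebesgue_on {-pi..pi}) (\<lambda>\<eta>. L2_inner \<Omega> (G \<eta>) (H \<eta>))"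

definition bochner_norm :: "complex set \<Rightarrow> (real \<Rightarrow> complex \<Rightarrow> complex) \<Rightarrow> real" where
  "bochner_norm \<Omega> G = sqrt (integral\<^sup>L (lebesgue_on {-pi..pi}) (\<lambda>\<eta>. (L2_norm \<Omega> (G \<eta>))\<^sup>2))"

text \<open>The element of \<open>L\<^sup>2(-\<pi>, \<pi>; L\<^sup>2(\<Omega>))\<close> represented by \<open>G\<close>, as a set of representatives.\<close>

definition bochner_class ::
    "complex set \<Rightarrow> (real \<Rightarrow> complex \<Rightarrow> complex) \<Rightarrow> (real \<Rightarrow> complex \<Rightarrow> complex) set" where
  "bochner_class \<Omega> G = {H \<in> bochner_L2 \<Omega> (L2 \<Omega>).
     AE \<eta> in lebesgue_on {-pi..pi}. AE z in lebesgue_on \<Omega>. H \<eta> z = G \<eta> z}"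

text \<open>Representatives with analytic values; the corresponding subspace of
  \<open>L\<^sup>2(-\<pi>, \<pi>; L\<^sup>2(\<omega>))\<close> is the image under \<open>bochner_class \<omega>\<close>.\<close>

definition L2_A2_eta :: "real \<Rightarrow> real \<Rightarrow> complex set \<Rightarrow> (real \<Rightarrow> complex \<Rightarrow> complex) set" where
  "L2_A2_eta a b \<omega> = {G \<in> bochner_L2 \<omega> (A2 \<omega>).
     AE \<eta> in lebesgue_on {-pi..pi}. G \<eta> \<in> A2_eta a b \<omega> \<eta>}"


section \<open>The Floquet transform\<close>

definition floquet_sum :: "(complex \<Rightarrow> complex) \<Rightarrow> int set \<Rightarrow> real \<Rightarrow> complex \<Rightarrow> complex" where
  "floquet_sum f K \<eta> z =
     1 / of_real (sqrt (2 * pi)) * (\<Sum>m\<in>K. exp (- \<i> * of_real \<eta> * of_int m) * f (z + of_int m))"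

text \<open>The transform of \<open>f\<close> is a class: the set of all representatives to which the series over the
  integers converges (unconditionally) in \<open>L\<^sup>2(-\<pi>, \<pi>; L\<^sup>2(\<omega>))\<close>.\<close>

definition floquet :: "complex set \<Rightarrow> (complex \<Rightarrow> complex) \<Rightarrow> (real \<Rightarrow> complex \<Rightarrow> complex) set" where
  "floquet \<omega> f = {G \<in> bochner_L2 \<omega> (L2 \<omega>).
     ((\<lambda>K. bochner_norm \<omega> (\<lambda>\<eta> z. floquet_sum f K \<eta> z - G \<eta> z)) \<longlongrightarrow> 0)
       (finite_subsets_at_top UNIV)}"

end

theory Submission
  imports Defs "HOL-Complex_Analysis.Complex_Analysis"
begin

text \<open>Since \<open>\<omega>\<close> is a Lipschitz domain, the periodic domain meets the strip \<open>0 < Re z < 1\<close> exactly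
  in \<open>\<omega>\<close>. Up to a null set it is therefore the disjoint union of the translates of \<open>\<omega>\<close>, and the
  Floquet transform sends \<open>f\<close> to the Fourier series in \<open>\<eta>\<close> whose coefficients are the pieces
  \<open>f (\<cdot> + m)\<close> of \<open>f\<close> on \<open>\<omega>\<close>. Orthogonality of the exponentials makes it isometric, their
  completeness identifies its inverse.

  The analytic content is that every function in \<open>A2_eta a b \<omega> \<eta>\<close> extends to an analytic function on
  the whole periodic domain that is multiplied by \<open>exp (\<i> \<eta>)\<close> under the shift by \<open>1\<close>. For \<open>A2_ext\<close>
  the translates of the function are glued across the lines \<open>Re z \<in> \<int>\<close> by the identity theorem, and
  the property survives \<open>L\<^sup>2\<close> limits by Bergman's inequality. If \<open>f\<close> is in the Bergman space of the
  periodic domain, then for almost every \<open>\<eta>\<close> a subsequence of the partial sums converges in \<open>L\<^sup>2\<close> on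
  every cell, and the limit is such an extension. Conversely the inverse transform integrates the
  extensions over \<open>\<eta>\<close>, and Bergman's inequality provides the bounds for differentiating under the
  integral.\<close>

text \<open>Point values of Bergman functions are controlled by their norm, so Fourier analysis with
  values in a function space reduces to scalar Fourier analysis at each point: the inverse transform
  of \<open>G\<close> must take at the points \<open>z + of_int m\<close> the Fourier coefficients
  of \<open>\<lambda>\<eta>. G \<eta> z\<close>. Bessel's inequality, integrated over the cell,
  already shows that it is square integrable; completeness of the exponentials serves to see that
  its transform is \<open>G\<close> again.

  Partial sums of the Floquet series are not quasiperiodic. A shift by \<open>j\<close> moves the
  window of summation, which exchanges a number of terms bounded in terms of \<open>j\<close>, and
  these tend to zero because their norms are square summable. The multiplier law thus appears only
  in the limit.

  Passing to the closure in \<open>A2_eta\<close> adds nothing: a limit extends analytically with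
  the same law, and such an extension is what membership in \<open>A2_ext\<close> asks for. Nonzero
  quasiperiodic functions have infinite norm over the whole periodic domain, so all estimates for
  them use finitely many cells at a time.\<close>

abbreviation \<T> :: "real measure" where
  "\<T> \<equiv> lebesgue_on {-pi..pi}"


section \<open>Square integrable functions and Bochner norms\<close>

text \<open>The cross term is absorbed by the square of \<open>t * x - y\<close>, divided by
  \<open>t\<close>. The weight \<open>t\<close> stays free so that it can later be set to the ratio
  of two norms, where the inequality becomes sharp.\<close>

lemma square_add_le:
  fixes x y t :: real
  assumes "t > 0"
  shows "(x + y)\<^sup>2 \<le> (1 + t) * x\<^sup>2 + (1 + 1/t) * y\<^sup>2"
proof -
  have "0 \<le> (t * x - y)\<^sup>2 / t" using assms by simp
  also have "\<dots> = t * x\<^sup>2 + y\<^sup>2 / t - 2 * x * y"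
    using assms by (simp add: power2_eq_square field_simps)
  finally show ?thesis by (simp add: power2_eq_square algebra_simps)
qed

lemma integrable_square_add:
  fixes u v :: "'a \<Rightarrow> real"
  assumes "u \<in> borel_measurable M" "v \<in> borel_measurable M"
    and "integrable M (\<lambda>x. (u x)\<^sup>2)" "integrable M (\<lambda>x. (v x)\<^sup>2)"
  shows "integrable M (\<lambda>x. (u x + v x)\<^sup>2)"
proof (rule Bochner_Integration.integrable_bound)
  show "integrable M (\<lambda>x. 2 * (u x)\<^sup>2 + 2 * (v x)\<^sup>2)" using assms by auto
  show "AE x in M. norm ((u x + v x)\<^sup>2) \<le> norm (2 * (u x)\<^sup>2 + 2 * (v x)\<^sup>2)"
    using square_add_le[of 1] by auto
qed (use assms in measurable)

text \<open>Integrating the weighted inequality and optimizing the weight avoids the Cauchy-Schwarz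
  inequality. The measure is arbitrary because the result is used twice: for the area measure in
  \<open>L2_norm\<close> and for the measure in \<open>\<eta>\<close> in
  \<open>bochner_norm\<close>.\<close>

lemma Minkowski_square:
  fixes u v :: "'a \<Rightarrow> real"
  assumes "u \<in> borel_measurable M" "v \<in> borel_measurable M"
    and "integrable M (\<lambda>x. (u x)\<^sup>2)" "integrable M (\<lambda>x. (v x)\<^sup>2)"
  shows "sqrt (\<integral>x. (u x + v x)\<^sup>2 \<partial>M) \<le> sqrt (\<integral>x. (u x)\<^sup>2 \<partial>M) + sqrt (\<integral>x. (v x)\<^sup>2 \<partial>M)"
proof -
  define A where "A = sqrt (\<integral>x. (u x)\<^sup>2 \<partial>M)"
  define B where "B = sqrt (\<integral>x. (v x)\<^sup>2 \<partial>M)"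
  have A: "A \<ge> 0" "A\<^sup>2 = (\<integral>x. (u x)\<^sup>2 \<partial>M)" and B: "B \<ge> 0" "B\<^sup>2 = (\<integral>x. (v x)\<^sup>2 \<partial>M)"
    unfolding A_def B_def by (auto intro!: integral_nonneg)
  have le: "(\<integral>x. (u x + v x)\<^sup>2 \<partial>M) \<le> (1 + t) * A\<^sup>2 + (1 + 1/t) * B\<^sup>2" if "t > 0" for t
  proof -
    have "(\<integral>x. (u x + v x)\<^sup>2 \<partial>M) \<le> (\<integral>x. (1 + t) * (u x)\<^sup>2 + (1 + 1/t) * (v x)\<^sup>2 \<partial>M)"
      using assms by (intro integral_mono integrable_square_add square_add_le that) auto
    also have "\<dots> = (1 + t) * A\<^sup>2 + (1 + 1/t) * B\<^sup>2"
      using assms A B by simp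
    finally show ?thesis .
  qed
  \<comment> \<open>The optimal weight is \<open>B / A\<close>, which is meaningless if
    \<open>A = 0\<close> and not positive if \<open>B = 0\<close>. Both norms are therefore enlarged
    by \<open>e / 2\<close> before the weight is chosen.\<close>
  have "(\<integral>x. (u x + v x)\<^sup>2 \<partial>M) \<le> (A + B + e)\<^sup>2" if "e > 0" for e
  proof -
    define A' B' where "A' = A + e/2" and "B' = B + e/2"
    have p: "A' > 0" "B' > 0" "A \<le> A'" "B \<le> B'" using A B that by (auto simp: A'_def B'_def)
    have "(\<integral>x. (u x + v x)\<^sup>2 \<partial>M) \<le> (1 + B'/A') * A\<^sup>2 + (1 + 1/(B'/A')) * B\<^sup>2"
      using p by (intro le) auto
    also have "\<dots> \<le> (1 + B'/A') * A'\<^sup>2 + (1 + 1/(B'/A')) * B'\<^sup>2"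
      using p A B by (intro add_mono mult_left_mono power_mono) auto
    also have "\<dots> = (A' + B')\<^sup>2" using p by (simp add: field_simps power2_eq_square)
    finally show ?thesis by (simp add: A'_def B'_def add_ac)
  qed
  then have "sqrt (\<integral>x. (u x + v x)\<^sup>2 \<partial>M) \<le> A + B + e" if "e > 0" for e
    using that A B by (intro real_le_lsqrt) auto
  then show ?thesis unfolding A_def[symmetric] B_def[symmetric] by (rule field_le_epsilon)
qed

section \<open>Algebra of square integrable functions and their norm\<close>

lemma L2_add: "f \<in> L2 \<Omega> \<Longrightarrow> g \<in> L2 \<Omega> \<Longrightarrow> (\<lambda>z. f z + g z) \<in> L2 \<Omega>"
proof -
  assume f: "f \<in> L2 \<Omega>" and g: "g \<in> L2 \<Omega>"
  then have [measurable]: "f \<in> borel_measurable (lebesgue_on \<Omega>)" "g \<in> borel_measurable (lebesgue_on \<Omega>)"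
    by (auto simp: L2_def)
  have "integrable (lebesgue_on \<Omega>) (\<lambda>x. (norm (f x) + norm (g x))\<^sup>2)"
    using f g by (intro integrable_square_add) (auto simp: L2_def)
  then have "integrable (lebesgue_on \<Omega>) (\<lambda>z. (norm (f z + g z))\<^sup>2)"
    by (rule Bochner_Integration.integrable_bound)
       (auto intro!: AE_I2 power_mono norm_triangle_ineq)
  then show ?thesis by (simp add: L2_def)
qed

lemma L2_mult: "f \<in> L2 \<Omega> \<Longrightarrow> (\<lambda>z. c * f z) \<in> L2 \<Omega>"
  by (auto simp: L2_def norm_mult power_mult_distrib)

lemma L2_zero [simp]: "(\<lambda>z. 0) \<in> L2 \<Omega>"
  by (auto simp: L2_def)

lemma L2_diff: "f \<in> L2 \<Omega> \<Longrightarrow> g \<in> L2 \<Omega> \<Longrightarrow> (\<lambda>z. f z - g z) \<in> L2 \<Omega>"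
  using L2_add[of f \<Omega> "\<lambda>z. (-1) * g z"] L2_mult[of g \<Omega> "-1"] by simp

lemma L2_sum: "(\<And>i. i \<in> I \<Longrightarrow> f i \<in> L2 \<Omega>) \<Longrightarrow> (\<lambda>z. \<Sum>i\<in>I. f i z) \<in> L2 \<Omega>"
  by (induction I rule: infinite_finite_induct) (auto intro!: L2_add)

lemma L2_norm_nonneg [simp]: "L2_norm \<Omega> f \<ge> 0"
  by (auto simp: L2_norm_def)

lemma L2_norm_square: "(L2_norm \<Omega> f)\<^sup>2 = integral\<^sup>L (lebesgue_on \<Omega>) (\<lambda>z. (norm (f z))\<^sup>2)"
  by (simp add: L2_norm_def)

lemma L2_norm_zero [simp]: "L2_norm \<Omega> (\<lambda>z. 0) = 0"
  by (simp add: L2_norm_def)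

lemma L2_norm_mult: "L2_norm \<Omega> (\<lambda>z. c * f z) = norm c * L2_norm \<Omega> f"
  by (simp add: L2_norm_def norm_mult power_mult_distrib real_sqrt_mult)

lemma L2_norm_minus_commute: "L2_norm \<Omega> (\<lambda>z. f z - g z) = L2_norm \<Omega> (\<lambda>z. g z - f z)"
  by (simp add: L2_norm_def norm_minus_commute)

lemma L2_norm_triangle:
  assumes f: "f \<in> L2 \<Omega>" and g: "g \<in> L2 \<Omega>"
  shows "L2_norm \<Omega> (\<lambda>z. f z + g z) \<le> L2_norm \<Omega> f + L2_norm \<Omega> g"
proof -
  have "L2_norm \<Omega> (\<lambda>z. f z + g z) \<le> sqrt (\<integral>z. (norm (f z) + norm (g z))\<^sup>2 \<partial>lebesgue_on \<Omega>)"
    unfolding L2_norm_def using L2_add[OF f g] f g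
    by (auto intro!: integral_mono integrable_square_add power_mono norm_triangle_ineq simp: L2_def)
  also have "\<dots> \<le> L2_norm \<Omega> f + L2_norm \<Omega> g"
    unfolding L2_norm_def using f g by (intro Minkowski_square) (auto simp: L2_def)
  finally show ?thesis .
qed

lemma L2_norm_triangle_diff:
  assumes "f \<in> L2 \<Omega>" "g \<in> L2 \<Omega>" "h \<in> L2 \<Omega>"
  shows "L2_norm \<Omega> (\<lambda>z. f z - h z) \<le> L2_norm \<Omega> (\<lambda>z. f z - g z) + L2_norm \<Omega> (\<lambda>z. g z - h z)"
  using L2_norm_triangle[OF L2_diff[OF assms(1,2)] L2_diff[OF assms(2,3)]] by simp

lemma L2_norm_diff_le:
  assumes "f \<in> L2 \<Omega>" "g \<in> L2 \<Omega>"
  shows "\<bar>L2_norm \<Omega> f - L2_norm \<Omega> g\<bar> \<le> L2_norm \<Omega> (\<lambda>z. f z - g z)"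
  using L2_norm_triangle_diff[OF assms L2_zero] L2_norm_triangle_diff[OF assms(2,1) L2_zero]
  by (simp add: L2_norm_minus_commute[of \<Omega> g f])

lemma L2_norm_sum:
  "(\<And>i. i \<in> I \<Longrightarrow> f i \<in> L2 \<Omega>) \<Longrightarrow> L2_norm \<Omega> (\<lambda>z. \<Sum>i\<in>I. f i z) \<le> (\<Sum>i\<in>I. L2_norm \<Omega> (f i))"
proof (induction I rule: infinite_finite_induct)
  case (insert x F)
  have "L2_norm \<Omega> (\<lambda>z. f x z + (\<Sum>i\<in>F. f i z)) \<le> L2_norm \<Omega> (f x) + L2_norm \<Omega> (\<lambda>z. \<Sum>i\<in>F. f i z)"
    using insert by (intro L2_norm_triangle L2_sum) auto
  then show ?case using insert by force
qed auto

lemma L2_norm_eq_0_iff: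
  assumes "f \<in> L2 \<Omega>"
  shows "L2_norm \<Omega> f = 0 \<longleftrightarrow> (AE z in lebesgue_on \<Omega>. f z = 0)"
  using assms by (simp add: L2_norm_def L2_def integral_nonneg_eq_0_iff_AE)

section \<open>Inner products and polarization\<close>

lemma borel_measurable_cnj [measurable]: "cnj \<in> borel_measurable borel"
  by (intro borel_measurable_continuous_onI continuous_intros)

lemma integrable_L2_inner:
  assumes "f \<in> L2 \<Omega>" "g \<in> L2 \<Omega>"
  shows "integrable (lebesgue_on \<Omega>) (\<lambda>z. f z * cnj (g z))"
proof (rule Bochner_Integration.integrable_bound)
  show "integrable (lebesgue_on \<Omega>) (\<lambda>z. (norm (f z))\<^sup>2 + (norm (g z))\<^sup>2)"
    using assms by (auto simp: L2_def)
  have "norm (f z * cnj (g z)) \<le> norm ((norm (f z))\<^sup>2 + (norm (g z))\<^sup>2)" for z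
    using sum_squares_bound[of "norm (f z)" "norm (g z)"]
      mult_nonneg_nonneg[of "norm (f z)" "norm (g z)"] by (simp add: norm_mult del: mult_nonneg_nonneg)
  then show "AE z in lebesgue_on \<Omega>. norm (f z * cnj (g z)) \<le> norm ((norm (f z))\<^sup>2 + (norm (g z))\<^sup>2)"
    by auto
  have [measurable]: "f \<in> borel_measurable (lebesgue_on \<Omega>)" "g \<in> borel_measurable (lebesgue_on \<Omega>)"
    using assms by (auto simp: L2_def)
  show "(\<lambda>z. f z * cnj (g z)) \<in> borel_measurable (lebesgue_on \<Omega>)" by measurable
qed

lemma L2_norm_square_inner: "of_real ((L2_norm \<Omega> f)\<^sup>2) = L2_inner \<Omega> f f"
  by (simp only: L2_norm_square L2_inner_def flip: complex_norm_square integral_complex_of_real)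

text \<open>Expansion of the square norm by the Gram matrix. Keeping the scalars \<open>c m\<close>
  apart from the functions lets them later be exponentials in \<open>\<eta>\<close>, so that all
  dependence on \<open>\<eta>\<close> sits in the scalars.\<close>

lemma L2_norm_square_sum:
  assumes "\<And>m. m \<in> K \<Longrightarrow> f m \<in> L2 \<Omega>"
  shows "of_real ((L2_norm \<Omega> (\<lambda>z. \<Sum>m\<in>K. c m * f m z))\<^sup>2) =
    (\<Sum>m\<in>K. \<Sum>n\<in>K. c m * cnj (c n) * L2_inner \<Omega> (f m) (f n))"
proof -
  have "of_real ((L2_norm \<Omega> (\<lambda>z. \<Sum>m\<in>K. c m * f m z))\<^sup>2) =
     (\<integral>z. (\<Sum>m\<in>K. \<Sum>n\<in>K. c m * cnj (c n) * (f m z * cnj (f n z))) \<partial>lebesgue_on \<Omega>)"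
    unfolding L2_norm_square_inner L2_inner_def
    by (simp add: cnj_sum mult_ac sum_product)
  also have "\<dots> = (\<Sum>m\<in>K. \<Sum>n\<in>K. c m * cnj (c n) * L2_inner \<Omega> (f m) (f n))"
    unfolding L2_inner_def using integrable_L2_inner[OF assms assms]
    by (simp add: Bochner_Integration.integral_sum Bochner_Integration.integrable_sum)
  finally show ?thesis .
qed

lemma polarization_pointwise:
  fixes x y :: complex
  shows "4 * (x * cnj y) = of_real ((norm (1 * x + 1 * y))\<^sup>2) - of_real ((norm (1 * x + (-1) * y))\<^sup>2)
    + \<i> * of_real ((norm (1 * x + \<i> * y))\<^sup>2) - \<i> * of_real ((norm (1 * x + (-\<i>) * y))\<^sup>2)"
  unfolding complex_norm_square by (simp add: algebra_simps)

text \<open>Reduces preservation of inner products to preservation of norms. The explicit factors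
  \<open>1 *\<close>, \<open>(-1) *\<close> and so on give all four terms the shape of one linear
  combination with a varying coefficient, so that a single instance of the isometry covers
  them.\<close>

lemma L2_inner_polarization:
  assumes f: "f \<in> L2 \<Omega>" and g: "g \<in> L2 \<Omega>"
  shows "4 * L2_inner \<Omega> f g = of_real ((L2_norm \<Omega> (\<lambda>z. 1 * f z + 1 * g z))\<^sup>2)
    - of_real ((L2_norm \<Omega> (\<lambda>z. 1 * f z + (-1) * g z))\<^sup>2)
    + \<i> * of_real ((L2_norm \<Omega> (\<lambda>z. 1 * f z + \<i> * g z))\<^sup>2)
    - \<i> * of_real ((L2_norm \<Omega> (\<lambda>z. 1 * f z + (-\<i>) * g z))\<^sup>2)"
proof -
  have int: "integrable (lebesgue_on \<Omega>) (\<lambda>z. complex_of_real ((norm (1 * f z + c * g z))\<^sup>2))" for c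
  proof -
    have "(\<lambda>z. 1 * f z + c * g z) \<in> L2 \<Omega>" by (intro L2_add L2_mult f g)
    then show ?thesis unfolding L2_def by (intro integrable_of_real) auto
  qed
  have "4 * L2_inner \<Omega> f g = (\<integral>z. 4 * (f z * cnj (g z)) \<partial>lebesgue_on \<Omega>)"
    by (simp add: L2_inner_def)
  also have "\<dots> = (\<integral>z. of_real ((norm (1 * f z + 1 * g z))\<^sup>2) - of_real ((norm (1 * f z + (-1) * g z))\<^sup>2)
    + \<i> * of_real ((norm (1 * f z + \<i> * g z))\<^sup>2) - \<i> * of_real ((norm (1 * f z + (-\<i>) * g z))\<^sup>2) \<partial>lebesgue_on \<Omega>)"
    by (simp only: polarization_pointwise)
  also have "\<dots> = (\<integral>z. of_real ((norm (1 * f z + 1 * g z))\<^sup>2) \<partial>lebesgue_on \<Omega>)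
    - (\<integral>z. of_real ((norm (1 * f z + (-1) * g z))\<^sup>2) \<partial>lebesgue_on \<Omega>)
    + \<i> * (\<integral>z. of_real ((norm (1 * f z + \<i> * g z))\<^sup>2) \<partial>lebesgue_on \<Omega>)
    - \<i> * (\<integral>z. of_real ((norm (1 * f z + (-\<i>) * g z))\<^sup>2) \<partial>lebesgue_on \<Omega>)"
    using int[of 1] int[of "-1"] int[of \<i>] int[of "-\<i>"]
    by (simp only: Bochner_Integration.integral_add Bochner_Integration.integral_diff
       Bochner_Integration.integrable_add Bochner_Integration.integrable_diff
       integrable_mult_right integral_mult_right_zero)
  finally show ?thesis by (simp only: L2_norm_square integral_complex_of_real)
qed

text \<open>Completeness of Lebesgue measure makes almost everywhere convergence enough: cutting off
  an exceptional null set gives convergence everywhere, and restoring it changes the limit on a null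
  set only. Applied to a constant sequence, it transports measurability along almost everywhere
  equality.\<close>

lemma borel_measurable_lebesgue_on_AE_limit:
  fixes u :: "nat \<Rightarrow> 'a::euclidean_space \<Rightarrow> 'b::euclidean_space"
  assumes u: "\<And>n. u n \<in> borel_measurable (lebesgue_on S)" and S: "S \<in> sets lebesgue"
    and lim: "AE x in lebesgue_on S. (\<lambda>n. u n x) \<longlonglongrightarrow> v x"
  shows "v \<in> borel_measurable (lebesgue_on S)"
proof -
  obtain N where N: "{x \<in> space (lebesgue_on S). \<not> (\<lambda>n. u n x) \<longlonglongrightarrow> v x} \<subseteq> N" "N \<in> null_sets (lebesgue_on S)"
    using lim by (auto simp: eventually_ae_filter)
  have NS: "N \<in> null_sets lebesgue"
    using N(2) S by (simp add: null_sets_restrict_space)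
  define w where "w n x = indicator (S - N) x *\<^sub>R u n x" for n x
  have "w n \<in> borel_measurable lebesgue" for n
  proof -
    have "(\<lambda>x. indicator S x *\<^sub>R u n x) \<in> borel_measurable lebesgue"
      using u[of n] S by (simp add: borel_measurable_restrict_space_iff)
    moreover have "indicator (- N) \<in> borel_measurable lebesgue"
      using NS by (intro borel_measurable_indicator) (simp add: Compl_in_sets_lebesgue null_setsD2)
    ultimately have "(\<lambda>x. indicator (- N) x *\<^sub>R (indicator S x *\<^sub>R u n x)) \<in> borel_measurable lebesgue"
      by (rule borel_measurable_scaleR[rotated])
    then show ?thesis by (simp add: w_def[abs_def] indicator_inter_arith[symmetric] Diff_eq Int_commute)
  qed
  moreover have "(\<lambda>n. w n x) \<longlonglongrightarrow> indicator (S - N) x *\<^sub>R v x" for x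
    using N(1) by (cases "x \<in> S - N") (auto simp: w_def)
  ultimately have "(\<lambda>x. indicator (S - N) x *\<^sub>R v x) \<in> borel_measurable lebesgue"
    by (rule borel_measurable_LIMSEQ_metric)
  moreover have "AE x in lebesgue. indicator (S - N) x *\<^sub>R v x = indicator S x *\<^sub>R v x"
    using AE_not_in[OF NS] by eventually_elim (auto simp: indicator_def)
  ultimately have "(\<lambda>x. indicator S x *\<^sub>R v x) \<in> borel_measurable lebesgue"
    by (rule borel_measurable_AE)
  then show ?thesis using S by (simp add: borel_measurable_restrict_space_iff)
qed

section \<open>Strong measurability and Bochner norms\<close>

lemma sets_lebesgue_ivl: "{a..b::real} \<in> sets lebesgue"
  by auto

text \<open>The norm of a simple function is a real simple function, and the reverse triangle
  inequality carries the convergence of the approximants over to their norms.\<close>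

lemma strongly_measurable_L2_norm:
  assumes "strongly_measurable \<Omega> X G" "X \<subseteq> L2 \<Omega>" "\<And>\<eta>. \<eta> \<in> {-pi..pi} \<Longrightarrow> G \<eta> \<in> L2 \<Omega>"
  shows "(\<lambda>\<eta>. L2_norm \<Omega> (G \<eta>)) \<in> borel_measurable \<T>"
proof -
  obtain S :: "nat \<Rightarrow> real \<Rightarrow> complex \<Rightarrow> complex"
    where S: "\<And>n. simple_function \<T> (S n)" "\<And>n \<eta>. \<eta> \<in> {-pi..pi} \<Longrightarrow> S n \<eta> \<in> X"
    and conv: "AE \<eta> in \<T>. (\<lambda>n. L2_norm \<Omega> (\<lambda>z. S n \<eta> z - G \<eta> z)) \<longlonglongrightarrow> 0"
    using assms(1) unfolding strongly_measurable_def by blast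
  have "(\<lambda>\<eta>. L2_norm \<Omega> (S n \<eta>)) \<in> borel_measurable \<T>" for n
    using simple_function_compose[OF S(1), of "L2_norm \<Omega>"]
    by (simp add: o_def borel_measurable_simple_function)
  moreover have "AE \<eta> in \<T>. (\<lambda>n. L2_norm \<Omega> (S n \<eta>)) \<longlonglongrightarrow> L2_norm \<Omega> (G \<eta>)"
    using conv AE_space
  proof eventually_elim
    case (elim \<eta>)
    have *: "\<bar>L2_norm \<Omega> (S n \<eta>) - L2_norm \<Omega> (G \<eta>)\<bar> \<le> L2_norm \<Omega> (\<lambda>z. S n \<eta> z - G \<eta> z)" for n
      using elim(2) S(2)[of \<eta> n] assms(2,3) by (intro L2_norm_diff_le) auto
    have "(\<lambda>n. L2_norm \<Omega> (S n \<eta>) - L2_norm \<Omega> (G \<eta>)) \<longlonglongrightarrow> 0"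
      by (rule Lim_null_comparison[OF _ elim(1)]) (use * in auto)
    then show ?case by (simp add: LIM_zero_iff)
  qed
  ultimately show ?thesis
    by (rule borel_measurable_lebesgue_on_AE_limit[where u="\<lambda>n \<eta>. L2_norm \<Omega> (S n \<eta>)", OF _ sets_lebesgue_ivl])
qed

lemma strongly_measurable_lincomb:
  assumes F: "strongly_measurable \<Omega> (L2 \<Omega>) F" "\<And>\<eta>. \<eta> \<in> {-pi..pi} \<Longrightarrow> F \<eta> \<in> L2 \<Omega>"
    and G: "strongly_measurable \<Omega> (L2 \<Omega>) G" "\<And>\<eta>. \<eta> \<in> {-pi..pi} \<Longrightarrow> G \<eta> \<in> L2 \<Omega>"
  shows "strongly_measurable \<Omega> (L2 \<Omega>) (\<lambda>\<eta> z. c * F \<eta> z + d * G \<eta> z)"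
proof -
  obtain S :: "nat \<Rightarrow> real \<Rightarrow> complex \<Rightarrow> complex"
    where S: "\<And>n. simple_function \<T> (S n)" "\<And>n \<eta>. \<eta> \<in> {-pi..pi} \<Longrightarrow> S n \<eta> \<in> L2 \<Omega>"
    and convS: "AE \<eta> in \<T>. (\<lambda>n. L2_norm \<Omega> (\<lambda>z. S n \<eta> z - F \<eta> z)) \<longlonglongrightarrow> 0"
    using F(1) unfolding strongly_measurable_def by blast
  obtain T :: "nat \<Rightarrow> real \<Rightarrow> complex \<Rightarrow> complex"
    where T: "\<And>n. simple_function \<T> (T n)" "\<And>n \<eta>. \<eta> \<in> {-pi..pi} \<Longrightarrow> T n \<eta> \<in> L2 \<Omega>"
    and convT: "AE \<eta> in \<T>. (\<lambda>n. L2_norm \<Omega> (\<lambda>z. T n \<eta> z - G \<eta> z)) \<longlonglongrightarrow> 0"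
    using G(1) unfolding strongly_measurable_def by blast
  have "AE \<eta> in \<T>.
      (\<lambda>n. L2_norm \<Omega> (\<lambda>z. (c * S n \<eta> z + d * T n \<eta> z) - (c * F \<eta> z + d * G \<eta> z))) \<longlonglongrightarrow> 0"
    using convS convT AE_space
  proof eventually_elim
    case (elim \<eta>)
    have eta: "\<eta> \<in> {-pi..pi}" using elim(3) by simp
    have *: "L2_norm \<Omega> (\<lambda>z. (c * S n \<eta> z + d * T n \<eta> z) - (c * F \<eta> z + d * G \<eta> z))
      \<le> norm c * L2_norm \<Omega> (\<lambda>z. S n \<eta> z - F \<eta> z) + norm d * L2_norm \<Omega> (\<lambda>z. T n \<eta> z - G \<eta> z)" for n
    proof -
      have "(\<lambda>z. (c * S n \<eta> z + d * T n \<eta> z) - (c * F \<eta> z + d * G \<eta> z)) =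
        (\<lambda>z. c * (S n \<eta> z - F \<eta> z) + d * (T n \<eta> z - G \<eta> z))"
        by (simp add: algebra_simps)
      then show ?thesis
        using L2_norm_triangle[OF L2_mult[OF L2_diff[OF S(2)[OF eta] F(2)[OF eta]]]
            L2_mult[OF L2_diff[OF T(2)[OF eta] G(2)[OF eta]]], of c n d n]
        by (simp only: L2_norm_mult)
    qed
    have "(\<lambda>n. norm c * L2_norm \<Omega> (\<lambda>z. S n \<eta> z - F \<eta> z) + norm d * L2_norm \<Omega> (\<lambda>z. T n \<eta> z - G \<eta> z)) \<longlonglongrightarrow> 0"
      using tendsto_add[OF tendsto_mult_left[OF elim(1), of "norm c"] tendsto_mult_left[OF elim(2), of "norm d"]] by simp
    then show ?case by (rule Lim_null_comparison[rotated]) (use * in auto)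
  qed
  moreover have "simple_function \<T> (\<lambda>\<eta> z. c * S n \<eta> z + d * T n \<eta> z)" for n
    using simple_function_compose2[OF S(1)[of n] T(1)[of n], of "\<lambda>u v z. c * u z + d * v z"] .
  ultimately show ?thesis unfolding strongly_measurable_def
    using S(2) T(2)
    by (intro exI[of _ "\<lambda>n \<eta> z. c * S n \<eta> z + d * T n \<eta> z"]) (auto intro!: L2_add L2_mult)
qed

lemma bochner_L2_memD:
  assumes "G \<in> bochner_L2 \<Omega> (L2 \<Omega>)"
  shows "\<eta> \<in> {-pi..pi} \<Longrightarrow> G \<eta> \<in> L2 \<Omega>" "strongly_measurable \<Omega> (L2 \<Omega>) G"
    "integrable \<T> (\<lambda>\<eta>. (L2_norm \<Omega> (G \<eta>))\<^sup>2)"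
    "(\<lambda>\<eta>. L2_norm \<Omega> (G \<eta>)) \<in> borel_measurable \<T>"
  using assms strongly_measurable_L2_norm[of \<Omega> "L2 \<Omega>" G] by (auto simp: bochner_L2_def)

lemma bochner_L2_lincomb:
  assumes F: "F \<in> bochner_L2 \<Omega> (L2 \<Omega>)" and G: "G \<in> bochner_L2 \<Omega> (L2 \<Omega>)"
  shows "(\<lambda>\<eta> z. c * F \<eta> z + d * G \<eta> z) \<in> bochner_L2 \<Omega> (L2 \<Omega>)"
proof -
  note F' = bochner_L2_memD[OF F] and G' = bochner_L2_memD[OF G]
  have mem: "\<And>\<eta>. \<eta> \<in> {-pi..pi} \<Longrightarrow> (\<lambda>z. c * F \<eta> z + d * G \<eta> z) \<in> L2 \<Omega>"
    by (intro L2_add L2_mult F' G')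
  have sm: "strongly_measurable \<Omega> (L2 \<Omega>) (\<lambda>\<eta> z. c * F \<eta> z + d * G \<eta> z)"
    by (intro strongly_measurable_lincomb F' G')
  have "integrable \<T> (\<lambda>\<eta>. (L2_norm \<Omega> (\<lambda>z. c * F \<eta> z + d * G \<eta> z))\<^sup>2)"
  proof (rule Bochner_Integration.integrable_bound)
    show "integrable \<T>
      (\<lambda>\<eta>. (norm c * L2_norm \<Omega> (F \<eta>) + norm d * L2_norm \<Omega> (G \<eta>))\<^sup>2)"
      using F'(3,4) G'(3,4) by (intro integrable_square_add) (auto simp: power_mult_distrib)
    show "(\<lambda>\<eta>. (L2_norm \<Omega> (\<lambda>z. c * F \<eta> z + d * G \<eta> z))\<^sup>2) \<in> borel_measurable \<T>"
      using strongly_measurable_L2_norm[OF sm _ mem] by auto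
    show "AE \<eta> in \<T>. norm ((L2_norm \<Omega> (\<lambda>z. c * F \<eta> z + d * G \<eta> z))\<^sup>2)
       \<le> norm ((norm c * L2_norm \<Omega> (F \<eta>) + norm d * L2_norm \<Omega> (G \<eta>))\<^sup>2)"
    proof (rule AE_I2)
      fix \<eta> assume "\<eta> \<in> space \<T>"
      then have "\<eta> \<in> {-pi..pi}" by simp
      then have "L2_norm \<Omega> (\<lambda>z. c * F \<eta> z + d * G \<eta> z) \<le> norm c * L2_norm \<Omega> (F \<eta>) + norm d * L2_norm \<Omega> (G \<eta>)"
        using L2_norm_triangle[OF L2_mult[OF F'(1)] L2_mult[OF G'(1)], of \<eta> \<eta> c d] by (simp add: L2_norm_mult)
      then show "norm ((L2_norm \<Omega> (\<lambda>z. c * F \<eta> z + d * G \<eta> z))\<^sup>2)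
       \<le> norm ((norm c * L2_norm \<Omega> (F \<eta>) + norm d * L2_norm \<Omega> (G \<eta>))\<^sup>2)"
        by (auto intro!: power_mono)
    qed
  qed
  with mem sm show ?thesis by (auto simp: bochner_L2_def)
qed

lemma bochner_L2_diff:
  assumes F: "F \<in> bochner_L2 \<Omega> (L2 \<Omega>)" and G: "G \<in> bochner_L2 \<Omega> (L2 \<Omega>)"
  shows "(\<lambda>\<eta> z. F \<eta> z - G \<eta> z) \<in> bochner_L2 \<Omega> (L2 \<Omega>)"
  using bochner_L2_lincomb[OF F G, of 1 "-1"] by simp

lemma bochner_norm_nonneg [simp]: "bochner_norm \<Omega> F \<ge> 0"
  by (auto simp: bochner_norm_def)

lemma bochner_norm_square:
  "(bochner_norm \<Omega> F)\<^sup>2 = (\<integral>\<eta>. (L2_norm \<Omega> (F \<eta>))\<^sup>2 \<partial>\<T>)"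
  by (simp add: bochner_norm_def)

lemma bochner_norm_mult: "bochner_norm \<Omega> (\<lambda>\<eta> z. c * F \<eta> z) = norm c * bochner_norm \<Omega> F"
  by (simp add: bochner_norm_def L2_norm_mult power_mult_distrib real_sqrt_mult)

lemma bochner_norm_minus_commute:
  "bochner_norm \<Omega> (\<lambda>\<eta> z. F \<eta> z - G \<eta> z) = bochner_norm \<Omega> (\<lambda>\<eta> z. G \<eta> z - F \<eta> z)"
  unfolding bochner_norm_def by (subst L2_norm_minus_commute) simp

lemma bochner_norm_triangle:
  assumes F: "F \<in> bochner_L2 \<Omega> (L2 \<Omega>)" and G: "G \<in> bochner_L2 \<Omega> (L2 \<Omega>)"
  shows "bochner_norm \<Omega> (\<lambda>\<eta> z. F \<eta> z + G \<eta> z) \<le> bochner_norm \<Omega> F + bochner_norm \<Omega> G"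
proof -
  note F' = bochner_L2_memD[OF F] and G' = bochner_L2_memD[OF G]
  have "bochner_norm \<Omega> (\<lambda>\<eta> z. F \<eta> z + G \<eta> z)
    \<le> sqrt (\<integral>\<eta>. (L2_norm \<Omega> (F \<eta>) + L2_norm \<Omega> (G \<eta>))\<^sup>2 \<partial>\<T>)"
    unfolding bochner_norm_def using bochner_L2_memD(3)[OF bochner_L2_lincomb[OF F G, of 1 1]] F' G'
    by (auto intro!: integral_mono integrable_square_add power_mono L2_norm_triangle)
  also have "\<dots> \<le> bochner_norm \<Omega> F + bochner_norm \<Omega> G"
    unfolding bochner_norm_def using F' G' by (intro Minkowski_square) auto
  finally show ?thesis .
qed

lemma bochner_norm_triangle_diff:
  assumes "F \<in> bochner_L2 \<Omega> (L2 \<Omega>)" "G \<in> bochner_L2 \<Omega> (L2 \<Omega>)" "H \<in> bochner_L2 \<Omega> (L2 \<Omega>)"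
  shows "bochner_norm \<Omega> (\<lambda>\<eta> z. F \<eta> z - H \<eta> z)
    \<le> bochner_norm \<Omega> (\<lambda>\<eta> z. F \<eta> z - G \<eta> z) + bochner_norm \<Omega> (\<lambda>\<eta> z. G \<eta> z - H \<eta> z)"
  using bochner_norm_triangle[OF bochner_L2_diff[OF assms(1,2)] bochner_L2_diff[OF assms(2,3)]] by simp

lemma bochner_norm_eq_0_iff:
  assumes "F \<in> bochner_L2 \<Omega> (L2 \<Omega>)"
  shows "bochner_norm \<Omega> F = 0 \<longleftrightarrow>
    (AE \<eta> in \<T>. AE z in lebesgue_on \<Omega>. F \<eta> z = 0)"
proof -
  note F' = bochner_L2_memD[OF assms]
  have "bochner_norm \<Omega> F = 0 \<longleftrightarrow> (AE \<eta> in \<T>. L2_norm \<Omega> (F \<eta>) = 0)"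
    using F'(3) by (simp add: bochner_norm_def integral_nonneg_eq_0_iff_AE)
  also have "\<dots> \<longleftrightarrow> (AE \<eta> in \<T>. AE z in lebesgue_on \<Omega>. F \<eta> z = 0)"
    by (intro AE_cong) (use F'(1) in \<open>simp add: L2_norm_eq_0_iff\<close>)
  finally show ?thesis .
qed

lemma bochner_inner_polarization:
  assumes F: "F \<in> bochner_L2 \<Omega> (L2 \<Omega>)" and G: "G \<in> bochner_L2 \<Omega> (L2 \<Omega>)"
  shows "4 * bochner_inner \<Omega> F G = of_real ((bochner_norm \<Omega> (\<lambda>\<eta> z. 1 * F \<eta> z + 1 * G \<eta> z))\<^sup>2)
    - of_real ((bochner_norm \<Omega> (\<lambda>\<eta> z. 1 * F \<eta> z + (-1) * G \<eta> z))\<^sup>2)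
    + \<i> * of_real ((bochner_norm \<Omega> (\<lambda>\<eta> z. 1 * F \<eta> z + \<i> * G \<eta> z))\<^sup>2)
    - \<i> * of_real ((bochner_norm \<Omega> (\<lambda>\<eta> z. 1 * F \<eta> z + (-\<i>) * G \<eta> z))\<^sup>2)"
proof -
  note F' = bochner_L2_memD[OF F] and G' = bochner_L2_memD[OF G]
  define N where "N c \<eta> = complex_of_real ((L2_norm \<Omega> (\<lambda>z. 1 * F \<eta> z + c * G \<eta> z))\<^sup>2)" for c \<eta>
  have int: "integrable \<T> (N c)" for c
    unfolding N_def using bochner_L2_memD(3)[OF bochner_L2_lincomb[OF F G, of 1 c]] by (intro integrable_of_real) auto
  have "4 * bochner_inner \<Omega> F G = (\<integral>\<eta>. 4 * L2_inner \<Omega> (F \<eta>) (G \<eta>) \<partial>\<T>)"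
    by (simp add: bochner_inner_def)
  also have "\<dots> = (\<integral>\<eta>. N 1 \<eta> - N (-1) \<eta> + \<i> * N \<i> \<eta> - \<i> * N (-\<i>) \<eta> \<partial>\<T>)"
    unfolding N_def by (intro Bochner_Integration.integral_cong[OF refl] L2_inner_polarization F'(1) G'(1)) auto
  also have "\<dots> = (\<integral>\<eta>. N 1 \<eta> \<partial>\<T>) - (\<integral>\<eta>. N (-1) \<eta> \<partial>\<T>)
    + \<i> * (\<integral>\<eta>. N \<i> \<eta> \<partial>\<T>) - \<i> * (\<integral>\<eta>. N (-\<i>) \<eta> \<partial>\<T>)"
    using int[of 1] int[of "-1"] int[of \<i>] int[of "-\<i>"]
    by (simp only: Bochner_Integration.integral_add Bochner_Integration.integral_diff
       Bochner_Integration.integrable_add Bochner_Integration.integrable_diff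
       integrable_mult_right integral_mult_right_zero)
  finally show ?thesis unfolding N_def bochner_norm_square by (simp only: integral_complex_of_real)
qed

section \<open>Bergman's inequality\<close>

lemma Basis_complex_eq: "(Basis :: complex set) = {1, \<i>}"
  by (auto simp: Basis_complex_def)

lemma measurable_Complex_pair [measurable]:
  "(\<lambda>(x, y). Complex x y) \<in> borel_measurable (borel \<Otimes>\<^sub>M borel)"
proof -
  have "(\<lambda>p :: real \<times> real. of_real (fst p) + \<i> * of_real (snd p)) \<in> borel_measurable borel"
    by (intro borel_measurable_continuous_onI continuous_intros)
  then show ?thesis by (simp add: borel_prod case_prod_beta Complex_eq)
qed

text \<open>Both measures give a box the product of its side lengths, and this determines Lebesgue
  measure. The identification makes Fubini's theorem available for real and imaginary parts.\<close>

lemma lborel_complex: "lborel = distr (lborel \<Otimes>\<^sub>M lborel) borel (\<lambda>(x, y). Complex x y)"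
proof (rule lborel_eqI)
  fix l u :: complex assume le: "\<And>b. b \<in> Basis \<Longrightarrow> l \<bullet> b \<le> u \<bullet> b"
  have meas: "(\<lambda>(x, y). Complex x y) \<in> measurable (lborel \<Otimes>\<^sub>M lborel) borel"
    by simp
  have vim: "(\<lambda>(x, y). Complex x y) -` box l u \<inter> space (lborel \<Otimes>\<^sub>M lborel)
    = {Re l<..<Re u} \<times> {Im l<..<Im u}"
    by (auto simp: in_box_complex_iff space_pair_measure)
  have "Re l \<le> Re u" "Im l \<le> Im u"
    using le[of 1] le[of \<i>] by (auto simp: Basis_complex_eq)
  then show "emeasure (distr (lborel \<Otimes>\<^sub>M lborel) borel (\<lambda>(x, y). Complex x y)) (box l u)
     = (\<Prod>b\<in>Basis. (u - l) \<bullet> b)"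
    by (subst emeasure_distr[OF meas])
       (auto simp: vim lborel.emeasure_pair_measure_Times Basis_complex_eq ennreal_mult'')
qed simp

lemma nn_integral_lborel_complex:
  assumes [measurable]: "f \<in> borel_measurable borel"
  shows "(\<integral>\<^sup>+z. f z \<partial>lborel) = (\<integral>\<^sup>+x. \<integral>\<^sup>+y. f (Complex x y) \<partial>lborel \<partial>lborel)"
    and "(\<integral>\<^sup>+z. f z \<partial>lborel) = (\<integral>\<^sup>+y. \<integral>\<^sup>+x. f (Complex x y) \<partial>lborel \<partial>lborel)"
proof -
  have [measurable]: "(\<lambda>(x, y). f (Complex x y)) \<in> borel_measurable (lborel \<Otimes>\<^sub>M lborel)"
    using measurable_compose[OF measurable_Complex_pair assms] by (simp add: case_prod_beta)
  have "(\<integral>\<^sup>+z. f z \<partial>lborel) = (\<integral>\<^sup>+p. (\<lambda>(x, y). f (Complex x y)) p \<partial>(lborel \<Otimes>\<^sub>M lborel))"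
    by (subst lborel_complex, subst nn_integral_distr) (auto intro!: nn_integral_cong simp: split_beta)
  also have "\<dots> = (\<integral>\<^sup>+x. \<integral>\<^sup>+y. f (Complex x y) \<partial>lborel \<partial>lborel)"
    by (subst lborel.nn_integral_fst[symmetric]) auto
  finally show 1: "(\<integral>\<^sup>+z. f z \<partial>lborel) = (\<integral>\<^sup>+x. \<integral>\<^sup>+y. f (Complex x y) \<partial>lborel \<partial>lborel)" .
  then show "(\<integral>\<^sup>+z. f z \<partial>lborel) = (\<integral>\<^sup>+y. \<integral>\<^sup>+x. f (Complex x y) \<partial>lborel \<partial>lborel)"
    using lborel_pair.Fubini'[of "\<lambda>x y. f (Complex x y)"] by simp
qed

text \<open>A function cannot exceed twice its mean everywhere. The factor 2 leaves room: a weak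
  comparison of integrals already yields the contradiction \<open>2 * I \<le> I\<close>, which is
  where \<open>I > 0\<close> enters.\<close>

lemma exists_le_average:
  fixes u :: "real \<Rightarrow> ennreal"
  assumes "a < b" "I > 0" and le: "(\<integral>\<^sup>+x. indicator {a..b} x * u x \<partial>lborel) \<le> ennreal I"
  obtains x where "x \<in> {a..b}" "u x \<le> ennreal (2 * I / (b - a))"
proof (rule ccontr)
  note obt = that
  assume "\<not> thesis"
  then have gt: "u x > ennreal (2 * I / (b - a))" if "x \<in> {a..b}" for x
    using that obt by (meson not_less)
  have "ennreal (2 * I) = ennreal (2 * I / (b - a)) * emeasure lborel {a..b}"
    using assms by (simp add: ennreal_mult'[symmetric])
  also have "\<dots> = (\<integral>\<^sup>+x. indicator {a..b} x * ennreal (2 * I / (b - a)) \<partial>lborel)"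
    by (subst nn_integral_multc) (auto simp: mult.commute)
  also have "\<dots> \<le> (\<integral>\<^sup>+x. indicator {a..b} x * u x \<partial>lborel)"
    using gt by (intro nn_integral_mono) (auto simp: indicator_def less_imp_le)
  also have "\<dots> \<le> ennreal I" by (rule le)
  finally show False using \<open>I > 0\<close> by simp
qed

lemma norm_integral_divide_le:
  fixes h D :: "real \<Rightarrow> complex"
  assumes cont: "continuous_on {c..d} h" and k: "k \<ge> 0"
    and D: "\<And>y. y \<in> {c..d} \<Longrightarrow> 1 / norm (D y) \<le> k"
    and B: "(\<integral>\<^sup>+y. indicator {c..d} y * ennreal (norm (h y)) \<partial>lborel) \<le> ennreal B" "B \<ge> 0"
  shows "norm (integral {c..d} (\<lambda>y. h y / D y)) \<le> k * B"
proof (cases "(\<lambda>y. h y / D y) integrable_on {c..d}")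
  case True
  have int: "(\<lambda>y. norm (h y)) integrable_on {c..d}"
    by (intro integrable_continuous_interval continuous_intros cont)
  have "norm (integral {c..d} (\<lambda>y. h y / D y)) \<le> integral {c..d} (\<lambda>y. k * norm (h y))"
  proof (rule integral_norm_bound_integral[OF True integrable_on_mult_right[OF int]])
    fix y assume "y \<in> {c..d}"
    have "norm (h y / D y) = (1 / norm (D y)) * norm (h y)" by (simp add: norm_divide)
    also have "\<dots> \<le> k * norm (h y)" by (intro mult_right_mono D \<open>y \<in> {c..d}\<close>) auto
    finally show "norm (h y / D y) \<le> k * norm (h y)" .
  qed
  also have "\<dots> = k * integral {c..d} (\<lambda>y. norm (h y))" by simp
  also have "integral {c..d} (\<lambda>y. norm (h y)) \<le> B"
  proof -
    have "(\<integral>\<^sup>+y. indicator {c..d} y * ennreal (norm (h y)) \<partial>lborel) = ennreal (integral {c..d} (\<lambda>y. norm (h y)))"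
      using nn_integral_has_integral_lebesgue[OF _ integrable_integral[OF int]] by (simp add: mult.commute ennreal_indicator ennreal_mult'')
    then show ?thesis using B by simp
  qed
  finally show ?thesis using k by (simp add: mult_left_mono)
next
  \<comment> \<open>The integral of a non-integrable function is 0 by convention, so the bound holds
    trivially.\<close>
  case False
  then show ?thesis using k B by (simp add: not_integrable_integral)
qed

text \<open>Multiplication by \<open>\<i>\<close> turns the horizontal segment into a vertical one,
  for which the formula is known; the factor \<open>\<i>\<close> from the substitution
  cancels.\<close>

lemma contour_integral_linepath_same_Im:
  assumes "Im z = c" "Im z' = c" "Re z = a" "Re z' = b" "a < b"
  shows "contour_integral (linepath z z') f = integral {a..b} (\<lambda>x. f (Complex x c))"
proof -
  define g where "g w = f (- \<i> * w)" for w
  have g: "g (linepath (\<i> * z) (\<i> * z') x) = f (linepath z z' x)" for x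
    by (simp add: g_def linepath_def algebra_simps scaleR_conv_of_real)
  have "\<i> * contour_integral (linepath z z') f = contour_integral (linepath (\<i> * z) (\<i> * z')) g"
    by (simp add: contour_integral_integral g right_diff_distrib[symmetric] mult_ac flip: integral_mult_right)
  also have "\<dots> = \<i> * integral {a..b} (\<lambda>x. g (Complex (-c) x))"
    using assms by (intro contour_integral_linepath_same_Re) auto
  also have "(\<lambda>x. g (Complex (-c) x)) = (\<lambda>x. f (Complex x c))"
    by (auto simp: g_def complex_eq_iff intro!: arg_cong[of _ _ f])
  finally show ?thesis by simp
qed

text \<open>Fubini's theorem provides, on each of the four sides, a parallel line on which the integral of
  \<open>norm f\<close> is controlled by the area integral; Cauchy's formula is then applied on the
  rectangle bounded by these lines.\<close>

lemma Bergman_L1_bound_aux: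
  fixes f :: "complex \<Rightarrow> complex"
  assumes hol: "f holomorphic_on S" and S: "open S" "cbox (Complex (a - r) (b - r)) (Complex (a + r) (b + r)) \<subseteq> S"
    and r: "r > 0" and I: "I > 0"
    and le: "(\<integral>\<^sup>+z. indicator (cbox (Complex (a - r) (b - r)) (Complex (a + r) (b + r))) z * ennreal (norm (f z)) \<partial>lborel) \<le> ennreal I"
  shows "norm (f (Complex a b)) \<le> 6 * I / r\<^sup>2"
proof -
  define Q where "Q = cbox (Complex (a - r) (b - r)) (Complex (a + r) (b + r))"
  have Q: "Complex x y \<in> Q \<longleftrightarrow> x \<in> {a-r..a+r} \<and> y \<in> {b-r..b+r}" for x y
    by (auto simp: Q_def in_cbox_complex_iff)
  have QS: "Q \<subseteq> S" using S by (simp add: Q_def)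
  have contQ: "continuous_on Q f"
    using holomorphic_on_imp_continuous_on[OF hol] QS continuous_on_subset by blast
  have cont1: "continuous_on {c..d} (\<lambda>y. f (Complex x y))" if "x \<in> {a-r..a+r}" "{c..d} \<subseteq> {b-r..b+r}" for x c d
    unfolding Complex_eq
    by (rule continuous_on_compose2[OF contQ]) (use that Q[unfolded Complex_eq] in \<open>auto intro!: continuous_on_add continuous_on_mult continuous_on_const continuous_on_of_real continuous_on_id\<close>)
  have cont2: "continuous_on {c..d} (\<lambda>x. f (Complex x y))" if "y \<in> {b-r..b+r}" "{c..d} \<subseteq> {a-r..a+r}" for y c d
    unfolding Complex_eq
    by (rule continuous_on_compose2[OF contQ]) (use that Q[unfolded Complex_eq] in \<open>auto intro!: continuous_on_add continuous_on_mult continuous_on_const continuous_on_of_real continuous_on_id\<close>)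
  define g where "g z = indicator Q z * ennreal (norm (f z))" for z
  have g_eq: "g = (\<lambda>z. ennreal (indicator Q z *\<^sub>R norm (f z)))"
    by (auto simp: g_def indicator_def)
  have [measurable]: "g \<in> borel_measurable borel" unfolding g_eq
    by (intro measurable_compose[OF _ measurable_ennreal] borel_measurable_continuous_on_indicator)
       (auto simp: Q_def intro!: continuous_on_norm contQ[unfolded Q_def])
  have gI: "(\<integral>\<^sup>+z. g z \<partial>lborel) \<le> ennreal I" using le by (simp add: g_def Q_def)
  define u where "u x = (\<integral>\<^sup>+y. g (Complex x y) \<partial>lborel)" for x
  define v where "v y = (\<integral>\<^sup>+x. g (Complex x y) \<partial>lborel)" for y
  have uI: "(\<integral>\<^sup>+x. indicator {c..d} x * u x \<partial>lborel) \<le> ennreal I" for c d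
    using gI unfolding nn_integral_lborel_complex(1)[OF \<open>g \<in> _\<close>] u_def
    by (rule order_trans[rotated]) (auto intro!: nn_integral_mono simp: indicator_def)
  have vI: "(\<integral>\<^sup>+x. indicator {c..d} x * v x \<partial>lborel) \<le> ennreal I" for c d
    using gI unfolding nn_integral_lborel_complex(2)[OF \<open>g \<in> _\<close>] v_def
    by (rule order_trans[rotated]) (auto intro!: nn_integral_mono simp: indicator_def)
  \<comment> \<open>Each line is sought in the outer half of the square on its side. It then has
    distance at least \<open>r / 2\<close> from the centre, which bounds the Cauchy kernel by
    \<open>2 / r\<close>.\<close>
  obtain x1 where x1: "x1 \<in> {a+r/2..a+r}" "u x1 \<le> ennreal (2 * I / ((a+r) - (a+r/2)))"
    using exists_le_average[of "a+r/2" "a+r" I u, OF _ I uI] r by force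
  obtain x0 where x0: "x0 \<in> {a-r..a-r/2}" "u x0 \<le> ennreal (2 * I / ((a-r/2) - (a-r)))"
    using exists_le_average[of "a-r" "a-r/2" I u, OF _ I uI] r by force
  obtain y1 where y1: "y1 \<in> {b+r/2..b+r}" "v y1 \<le> ennreal (2 * I / ((b+r) - (b+r/2)))"
    using exists_le_average[of "b+r/2" "b+r" I v, OF _ I vI] r by force
  obtain y0 where y0: "y0 \<in> {b-r..b-r/2}" "v y0 \<le> ennreal (2 * I / ((b-r/2) - (b-r)))"
    using exists_le_average[of "b-r" "b-r/2" I v, OF _ I vI] r by force
  \<comment> \<open>Each strip has width \<open>r / 2\<close>, so twice the mean over it is
    \<open>2 * I / (r / 2)\<close>.\<close>
  define B where "B = 4 * I / r"
  have B: "B > 0" using I r by (simp add: B_def)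
  have bnd: "u x1 \<le> ennreal B" "u x0 \<le> ennreal B" "v y1 \<le> ennreal B" "v y0 \<le> ennreal B"
    using x1(2) x0(2) y1(2) y0(2) by (simp_all add: B_def mult_ac)
  define z where "z = Complex a b"
  have rng: "x0 < a" "a < x1" "y0 < b" "b < y1" "a - r \<le> x0" "x1 \<le> a + r" "b - r \<le> y0" "y1 \<le> b + r"
    using x0 x1 y0 y1 r by auto
  define h where "h w = f w / (w - z)" for w
  have vert: "norm (integral {y0..y1} (\<lambda>y. h (Complex x y))) \<le> 2 / r * B"
    if "x \<in> {x0, x1}" for x
    unfolding h_def
  proof (rule norm_integral_divide_le)
    show "continuous_on {y0..y1} (\<lambda>y. f (Complex x y))" using that rng by (intro cont1) auto
    show "1 / norm (Complex x y - z) \<le> 2 / r" if "y \<in> {y0..y1}" for y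
    proof -
      have "r / 2 \<le> \<bar>Re (Complex x y - z)\<bar>" using \<open>x \<in> {x0, x1}\<close> x0 x1 by (auto simp: z_def)
      also have "\<dots> \<le> norm (Complex x y - z)" by (rule abs_Re_le_cmod)
      finally have *: "r / 2 \<le> norm (Complex x y - z)" .
      then have "1 / norm (Complex x y - z) \<le> 1 / (r / 2)"
        using r by (intro divide_left_mono mult_pos_pos) auto
      then show ?thesis by simp
    qed
    have "(\<integral>\<^sup>+y. indicator {y0..y1} y * ennreal (norm (f (Complex x y))) \<partial>lborel) \<le> u x"
      unfolding u_def g_def using rng \<open>x \<in> {x0, x1}\<close>
      by (intro nn_integral_mono) (auto simp: indicator_def Q)
    also have "\<dots> \<le> ennreal B" using bnd that by auto
    finally show "(\<integral>\<^sup>+y. indicator {y0..y1} y * ennreal (norm (f (Complex x y))) \<partial>lborel) \<le> ennreal B" .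
  qed (use r B in auto)
  have horiz: "norm (integral {x0..x1} (\<lambda>x. h (Complex x y))) \<le> 2 / r * B"
    if "y \<in> {y0, y1}" for y
    unfolding h_def
  proof (rule norm_integral_divide_le)
    show "continuous_on {x0..x1} (\<lambda>x. f (Complex x y))" using that rng by (intro cont2) auto
    show "1 / norm (Complex x y - z) \<le> 2 / r" if "x \<in> {x0..x1}" for x
    proof -
      have "r / 2 \<le> \<bar>Im (Complex x y - z)\<bar>" using \<open>y \<in> {y0, y1}\<close> y0 y1 by (auto simp: z_def)
      also have "\<dots> \<le> norm (Complex x y - z)" by (rule abs_Im_le_cmod)
      finally have *: "r / 2 \<le> norm (Complex x y - z)" .
      then have "1 / norm (Complex x y - z) \<le> 1 / (r / 2)"
        using r by (intro divide_left_mono mult_pos_pos) auto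
      then show ?thesis by simp
    qed
    have "(\<integral>\<^sup>+x. indicator {x0..x1} x * ennreal (norm (f (Complex x y))) \<partial>lborel) \<le> v y"
      unfolding v_def g_def using rng \<open>y \<in> {y0, y1}\<close>
      by (intro nn_integral_mono) (auto simp: indicator_def Q)
    also have "\<dots> \<le> ennreal B" using bnd that by auto
    finally show "(\<integral>\<^sup>+x. indicator {x0..x1} x * ennreal (norm (f (Complex x y))) \<partial>lborel) \<le> ennreal B" .
  qed (use r B in auto)
  define a1 a2 a3 a4 where "a1 = Complex x0 y0" and "a2 = Complex x1 y0" and "a3 = Complex x1 y1" and "a4 = Complex x0 y1"
  have zbox: "z \<in> box a1 a3" using rng by (auto simp: z_def a1_def a3_def in_box_complex_iff)
  have img: "path_image (rectpath a1 a3) \<subseteq> Q - {z}"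
    using rng by (subst path_image_rectpath) (auto simp: a1_def a3_def Q_def in_cbox_complex_iff z_def)
  have "(h has_contour_integral (2*pi * \<i> * winding_number (rectpath a1 a3) z * f z)) (rectpath a1 a3)"
    unfolding h_def
  proof (rule Cauchy_integral_formula_convex_simple)
    show "convex Q" by (simp add: Q_def)
    show "f holomorphic_on Q" using hol QS holomorphic_on_subset by blast
    show "z \<in> interior Q" using r by (auto simp: Q_def interior_cbox in_box_complex_iff z_def)
  qed (use img in auto)
  then have ci: "contour_integral (rectpath a1 a3) h = 2*pi * \<i> * f z"
    using winding_number_rectpath[OF zbox] by (simp add: contour_integral_unique)
  have hcont: "continuous_on (path_image (rectpath a1 a3)) h"
    unfolding h_def using img by (intro continuous_intros continuous_on_subset[OF contQ]) auto
  have pimg: "path_image (rectpath a1 a3) = closed_segment a1 a2 \<union> closed_segment a2 a3 \<union> closed_segment a3 a4 \<union> closed_segment a4 a1"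
    by (simp add: rectpath_def Let_def path_image_join a1_def a2_def a3_def a4_def Un_assoc)
  have cint: "h contour_integrable_on linepath a1 a2" "h contour_integrable_on linepath a2 a3"
     "h contour_integrable_on linepath a3 a4" "h contour_integrable_on linepath a4 a1"
    by (intro contour_integrable_continuous_linepath continuous_on_subset[OF hcont]; auto simp: pimg)+
  have rp: "rectpath a1 a3 = linepath a1 a2 +++ (linepath a2 a3 +++ (linepath a3 a4 +++ linepath a4 a1))"
    by (simp add: rectpath_def Let_def a1_def a2_def a3_def a4_def)
  have i34: "h contour_integrable_on (linepath a3 a4 +++ linepath a4 a1)"
    by (intro contour_integrable_joinI cint) auto
  have i234: "h contour_integrable_on (linepath a2 a3 +++ (linepath a3 a4 +++ linepath a4 a1))"
    by (intro contour_integrable_joinI cint i34 valid_path_join) auto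
  have "contour_integral (rectpath a1 a3) h = contour_integral (linepath a1 a2) h + (contour_integral (linepath a2 a3) h
     + (contour_integral (linepath a3 a4) h + contour_integral (linepath a4 a1) h))"
    unfolding rp
    by (simp only: contour_integral_join[OF cint(3,4)] contour_integral_join[OF cint(2) i34]
        contour_integral_join[OF cint(1) i234] valid_path_linepath valid_path_join pathstart_join
        pathfinish_linepath pathstart_linepath)
  also have "contour_integral (linepath a3 a4) h = - contour_integral (linepath a4 a3) h"
    by (intro contour_integral_reverse_linepath continuous_on_subset[OF hcont]) (auto simp: pimg)
  also have "contour_integral (linepath a4 a1) h = - contour_integral (linepath a1 a4) h"
    by (intro contour_integral_reverse_linepath continuous_on_subset[OF hcont]) (auto simp: pimg)
  also have "contour_integral (linepath a1 a2) h = integral {x0..x1} (\<lambda>x. h (Complex x y0))"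
    using rng by (intro contour_integral_linepath_same_Im) (auto simp: a1_def a2_def)
  also have "contour_integral (linepath a4 a3) h = integral {x0..x1} (\<lambda>x. h (Complex x y1))"
    using rng by (intro contour_integral_linepath_same_Im) (auto simp: a3_def a4_def)
  also have "contour_integral (linepath a2 a3) h = \<i> * integral {y0..y1} (\<lambda>y. h (Complex x1 y))"
    using rng by (intro contour_integral_linepath_same_Re) (auto simp: a3_def a2_def)
  also have "contour_integral (linepath a1 a4) h = \<i> * integral {y0..y1} (\<lambda>y. h (Complex x0 y))"
    using rng by (intro contour_integral_linepath_same_Re) (auto simp: a1_def a4_def)
  finally have eq: "2*pi * \<i> * f z = integral {x0..x1} (\<lambda>x. h (Complex x y0)) +
    (\<i> * integral {y0..y1} (\<lambda>y. h (Complex x1 y)) + (- integral {x0..x1} (\<lambda>x. h (Complex x y1))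
     + - (\<i> * integral {y0..y1} (\<lambda>y. h (Complex x0 y)))))"
    unfolding ci .
  have tri: "norm (A + (\<i> * B' + (- C + - (\<i> * D)))) \<le> norm A + (norm B' + (norm C + norm D))" for A B' C D :: complex
    using norm_triangle_ineq[of A "\<i> * B' + (- C + - (\<i> * D))"] norm_triangle_ineq[of "\<i> * B'" "- C + - (\<i> * D)"]
      norm_triangle_ineq[of "- C" "- (\<i> * D)"] norm_minus_cancel[of "\<i> * D"] by (simp only: norm_mult norm_minus_cancel norm_ii mult_1)
  have "norm (2*pi * \<i> * f z) \<le> 2/r*B + (2/r*B + (2/r*B + 2/r*B))"
    unfolding eq using horiz vert by (intro order_trans[OF tri] add_mono) auto
  then have "2 * pi * norm (f z) \<le> 8 / r * B" by (simp add: norm_mult)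
  also have "\<dots> = 32 * I / r\<^sup>2" by (simp add: B_def power2_eq_square)
  finally have "2 * pi * norm (f z) \<le> 32 * I / r\<^sup>2" .
  \<comment> \<open>The four sides contribute \<open>2 / r * B\<close> each, in total
    \<open>32 * I / r\<^sup>2\<close>. Estimating \<open>2 * pi\<close> from below by 6 leaves the
    factor 32/6, which is rounded up to the constant 6 of the statement.\<close>
  moreover have "6 * norm (f z) \<le> 2 * pi * norm (f z)"
    using pi_gt3 by (intro mult_right_mono) auto
  ultimately have "norm (f z) \<le> 32 / 6 * (I / r\<^sup>2)" by simp
  also have "\<dots> \<le> 6 * (I / r\<^sup>2)" using I by (intro mult_right_mono) auto
  finally show ?thesis by (simp add: z_def)
qed

text \<open>The averaging argument needs a positive bound. Enlarging \<open>I\<close> by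
  \<open>e * r\<^sup>2 / 6\<close> costs exactly \<open>e\<close> in the conclusion and admits
  \<open>I = 0\<close>.\<close>

lemma Bergman_L1_bound:
  fixes f :: "complex \<Rightarrow> complex"
  assumes hol: "f holomorphic_on S" and S: "open S" "cbox (Complex (a - r) (b - r)) (Complex (a + r) (b + r)) \<subseteq> S"
    and r: "r > 0" and I: "I \<ge> 0"
    and le: "(\<integral>\<^sup>+z. indicator (cbox (Complex (a - r) (b - r)) (Complex (a + r) (b + r))) z * ennreal (norm (f z)) \<partial>lborel) \<le> ennreal I"
  shows "norm (f (Complex a b)) \<le> 6 * I / r\<^sup>2"
proof (rule field_le_epsilon)
  fix e :: real assume e: "e > 0"
  have "norm (f (Complex a b)) \<le> 6 * (I + e * r\<^sup>2 / 6) / r\<^sup>2"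
    using e r I by (intro Bergman_L1_bound_aux[OF hol S r] order_trans[OF le] ennreal_leI) (auto intro: add_nonneg_pos)
  also have "\<dots> = 6 * I / r\<^sup>2 + e" using r by (simp add: field_simps)
  finally show "norm (f (Complex a b)) \<le> 6 * I / r\<^sup>2 + e" .
qed

text \<open>The square of \<open>f\<close> is again holomorphic, so the bound by an area integral of
  the modulus, applied to it, is a bound by the square norm of \<open>f\<close>.\<close>

lemma holomorphic_norm_square_le:
  assumes hol: "f holomorphic_on S" and S: "open S" "cbox (Complex (a - r) (b - r)) (Complex (a + r) (b + r)) \<subseteq> S"
    and r: "r > 0" and I: "I \<ge> 0"
    and le: "(\<integral>\<^sup>+z. indicator S z * ennreal ((norm (f z))\<^sup>2) \<partial>lborel) \<le> ennreal I"
  shows "(norm (f (Complex a b)))\<^sup>2 \<le> 6 * I / r\<^sup>2"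
proof -
  have "norm ((f (Complex a b))\<^sup>2) \<le> 6 * I / r\<^sup>2"
  proof (rule Bergman_L1_bound[OF _ S r I, of "\<lambda>z. (f z)\<^sup>2"])
    show "(\<lambda>z. (f z)\<^sup>2) holomorphic_on S" by (intro holomorphic_intros hol)
    show "(\<integral>\<^sup>+z. indicator (cbox (Complex (a - r) (b - r)) (Complex (a + r) (b + r))) z *
       ennreal (norm ((f z)\<^sup>2)) \<partial>lborel) \<le> ennreal I"
      by (rule order_trans[OF nn_integral_mono le])
         (use S(2) in \<open>auto simp: indicator_def norm_power split: if_splits\<close>)
  qed
  then show ?thesis by (simp add: norm_power)
qed

text \<open>What matters is the uniformity: \<open>r\<close> and \<open>C\<close> are fixed before
  \<open>f\<close>, \<open>I\<close> and \<open>w\<close>. This makes norm convergence locally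
  uniform and supplies dominating functions.\<close>

lemma Bergman_bound:
  assumes S: "open S" and z: "z \<in> S"
  obtains r C where "r > 0" "C > 0" "ball z r \<subseteq> S"
    "\<And>f I w. f holomorphic_on S \<Longrightarrow> I \<ge> 0 \<Longrightarrow>
      (\<integral>\<^sup>+z. indicator S z * ennreal ((norm (f z))\<^sup>2) \<partial>lborel) \<le> ennreal I \<Longrightarrow> w \<in> ball z r \<Longrightarrow> (norm (f w))\<^sup>2 \<le> C * I"
proof -
  obtain e where e: "e > 0" "ball z e \<subseteq> S" using S z open_contains_ball by blast
  \<comment> \<open>A square of half side \<open>r\<close> around a point \<open>w\<close> of
    \<open>ball z r\<close> reaches at most distance \<open>2 * r\<close> from \<open>w\<close>,
    hence less than \<open>3 * r\<close> from \<open>z\<close>.\<close>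
  define r where "r = e / 4"
  have r: "r > 0" using e by (simp add: r_def)
  have sub: "cbox (Complex (a - r) (b - r)) (Complex (a + r) (b + r)) \<subseteq> S" if "Complex a b \<in> ball z r" for a b
  proof
    fix w assume w: "w \<in> cbox (Complex (a - r) (b - r)) (Complex (a + r) (b + r))"
    have "norm (w - Complex a b) \<le> \<bar>Re (w - Complex a b)\<bar> + \<bar>Im (w - Complex a b)\<bar>"
      by (rule cmod_le)
    also have "\<dots> \<le> 2 * r" using w by (auto simp: in_cbox_complex_iff abs_le_iff)
    finally have "dist w (Complex a b) \<le> 2 * r" by (simp add: dist_norm)
    moreover have "dist z w \<le> dist z (Complex a b) + dist w (Complex a b)"
      by (metis dist_commute dist_triangle)
    ultimately have "dist z w < e" using that r by (simp add: r_def)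
    then show "w \<in> S" using e by auto
  qed
  show thesis
  proof (rule that[of r "6 / r\<^sup>2"])
    show "r > 0" "6 / r\<^sup>2 > 0" using r by auto
    show "ball z r \<subseteq> S" using e r by (auto simp: r_def)
    fix f :: "complex \<Rightarrow> complex" and I w assume a: "f holomorphic_on S" "I \<ge> 0"
      "(\<integral>\<^sup>+z. indicator S z * ennreal ((norm (f z))\<^sup>2) \<partial>lborel) \<le> ennreal I" "w \<in> ball z r"
    show "(norm (f w))\<^sup>2 \<le> 6 / r\<^sup>2 * I"
      using holomorphic_norm_square_le[OF a(1) S sub r a(2,3), of "Re w" "Im w"] a(4) by simp
  qed
qed

text \<open>Cauchy's estimate on circles of radius \<open>r / 4\<close> around the points of the
  smaller ball bounds the derivative by \<open>4 * B / r\<close>; the mean value inequality does the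
  rest. A bound on the values thereby dominates all difference quotients at
  \<open>z\<close>.\<close>

lemma holomorphic_difference_quotient_bound:
  assumes hol: "f holomorphic_on ball z r" and r: "r > 0" and B: "\<And>w. w \<in> ball z r \<Longrightarrow> norm (f w) \<le> B"
    and w: "w \<in> ball z (r/4)"
  shows "norm (f w - f z) \<le> (4 * B / r) * norm (w - z)"
proof -
  have "norm (deriv f u) \<le> 4 * B / r" if u: "u \<in> ball z (r/4)" for u
  proof -
    have sub: "cball u (r/4) \<subseteq> ball z r"
    proof
      fix v assume "v \<in> cball u (r/4)"
      then show "v \<in> ball z r" using u dist_triangle[of z v u] r by (auto simp: dist_commute)
    qed
    have "norm ((deriv ^^ 1) f u) \<le> fact 1 * B / (r/4) ^ 1"
    proof (rule Cauchy_inequality)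
      show "f holomorphic_on ball u (r/4)" using hol sub ball_subset_cball holomorphic_on_subset by blast
      show "continuous_on (cball u (r/4)) f"
        using holomorphic_on_imp_continuous_on[OF hol] sub continuous_on_subset by blast
      show "norm (f x) \<le> B" if "norm (u - x) = r/4" for x
        using sub that by (intro B) (auto simp: dist_norm)
    qed (use r in auto)
    then show ?thesis by (simp add: mult.commute)
  qed
  moreover have "(f has_field_derivative deriv f u) (at u within ball z (r/4))" if "u \<in> ball z (r/4)" for u
    by (rule has_field_derivative_at_within, rule holomorphic_derivI[of f "ball z r"]) (use that hol r in auto)
  ultimately show ?thesis
    using field_differentiable_bound[of "ball z (r/4)" f "deriv f" "4 * B / r" w z] w r by auto
qed

text \<open>Only the values of \<open>h x\<close> are assumed to be dominated locally; Cauchy's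
  estimate passes the domination on to difference quotients, and dominated convergence along
  sequences gives the complex derivative.\<close>

lemma holomorphic_on_parameter_integral:
  fixes h :: "'a \<Rightarrow> complex \<Rightarrow> complex"
  assumes S: "open S" and hol: "AE x in M. h x holomorphic_on S"
    and meas: "\<And>z. z \<in> S \<Longrightarrow> (\<lambda>x. h x z) \<in> borel_measurable M"
    and dom: "\<And>z. z \<in> S \<Longrightarrow> \<exists>r>0. \<exists>B. ball z r \<subseteq> S \<and> integrable M B \<and> (AE x in M. \<forall>w\<in>ball z r. norm (h x w) \<le> B x)"
  shows "(\<lambda>z. \<integral>x. h x z \<partial>M) holomorphic_on S" and "\<And>z. z \<in> S \<Longrightarrow> integrable M (\<lambda>x. h x z)"
proof -
  show int: "integrable M (\<lambda>x. h x z)" if z: "z \<in> S" for z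
  proof -
    obtain r B where rB: "r > 0" "integrable M B" "AE x in M. \<forall>w\<in>ball z r. norm (h x w) \<le> B x"
      using dom[OF z] by blast
    show ?thesis
    proof (rule Bochner_Integration.integrable_bound[OF rB(2) meas[OF z]])
      show "AE x in M. norm (h x z) \<le> norm (B x)"
        using rB(3) 
      proof eventually_elim
        case (elim x)
        then have "norm (h x z) \<le> B x" using rB(1) by simp
        then show ?case by simp
      qed
    qed
  qed
  define F where "F z = (\<integral>x. h x z \<partial>M)" for z
  have "\<exists>D. (F has_field_derivative D) (at z)" if z: "z \<in> S" for z
  proof -
    obtain r B where rB: "r > 0" "ball z r \<subseteq> S" "integrable M B" "AE x in M. \<forall>w\<in>ball z r. norm (h x w) \<le> B x"
      using dom[OF z] by blast
    have lim: "AE x in M. (\<lambda>n. (h x (Y n) - h x z) / (Y n - z)) \<longlonglongrightarrow> deriv (h x) z"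
      if Y: "\<And>n. Y n \<noteq> z" "Y \<longlonglongrightarrow> z" for Y :: "nat \<Rightarrow> complex"
      using hol
    proof eventually_elim
      case (elim x)
      have "(h x has_field_derivative deriv (h x) z) (at z)"
        using elim S z by (rule holomorphic_derivI)
      then have "((\<lambda>w. (h x w - h x z) / (w - z)) \<longlongrightarrow> deriv (h x) z) (at z)"
        by (simp add: has_field_derivative_iff)
      then show ?case unfolding tendsto_at_iff_sequentially
        using Y by (auto simp: o_def)
    qed
    \<comment> \<open>One fixed sequence tending to \<open>z\<close> inside the ball, used solely to
      produce a measurable version of the derivative.\<close>
    define Y0 where "Y0 n = z + of_real (r / 2 * inverse (of_nat (Suc n)))" for n
    have Y0: "Y0 n \<in> S" "Y0 n \<noteq> z" for n
    proof -
      have "r / 2 * inverse (of_nat (Suc n)) \<le> r / 2" using rB(1) by (simp add: field_simps)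
      moreover have "r / 2 * inverse (of_nat (Suc n)) > 0" using rB(1) by simp
      ultimately have "norm (complex_of_real (r / 2 * inverse (of_nat (Suc n)))) < r"
        using rB(1) unfolding norm_of_real by linarith
      then have "Y0 n \<in> ball z r" unfolding Y0_def mem_ball dist_norm by (subst norm_minus_commute) (simp only: add_diff_cancel_left')
      then show "Y0 n \<in> S" using rB(2) by auto
      show "Y0 n \<noteq> z" using rB(1) by (simp add: Y0_def del: of_nat_Suc)
    qed
    have "Y0 \<longlonglongrightarrow> z + of_real (r / 2 * 0)"
      unfolding Y0_def by (intro tendsto_intros LIMSEQ_inverse_real_of_nat)
    then have Y0_lim: "Y0 \<longlonglongrightarrow> z" by simp
    \<comment> \<open>Measurability of \<open>deriv (h x) z\<close> in \<open>x\<close> is not known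
      directly. The limit of measurable quotients is measurable, and it equals the derivative for
      almost every \<open>x\<close>.\<close>
    define u where "u x = lim (\<lambda>n. (h x (Y0 n) - h x z) / (Y0 n - z))" for x
    have u_meas: "u \<in> borel_measurable M" unfolding u_def
      using meas[OF Y0(1)] meas[OF z] by (intro borel_measurable_lim_metric) auto
    have u_eq: "AE x in M. u x = deriv (h x) z"
      using lim[OF Y0(2) Y0_lim] unfolding u_def by eventually_elim (rule limI)
    have "((\<lambda>w. (F w - F z) / (w - z)) \<longlongrightarrow> (\<integral>x. u x \<partial>M)) (at z)"
      unfolding tendsto_at_iff_sequentially
    proof (intro allI impI)
      fix X :: "nat \<Rightarrow> complex" assume X: "\<forall>i. X i \<in> UNIV - {z}" "X \<longlonglongrightarrow> z"
      obtain N where N: "\<And>n. n \<ge> N \<Longrightarrow> X n \<in> ball z (r/4)"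
        using tendstoD[OF X(2), of "r/4"] rB(1) by (auto simp: eventually_sequentially dist_commute)
      define Y where "Y n = X (n + N)" for n
      have Y: "Y n \<in> ball z (r/4)" "Y n \<noteq> z" for n using N X(1) by (auto simp: Y_def)
      have YS: "Y n \<in> S" for n using Y(1)[of n] rB(1,2) by (auto simp: subset_iff)
      have Ylim: "Y \<longlonglongrightarrow> z" unfolding Y_def using X(2) by (rule LIMSEQ_ignore_initial_segment)
      have "(\<lambda>n. \<integral>x. (h x (Y n) - h x z) / (Y n - z) \<partial>M) \<longlonglongrightarrow> (\<integral>x. u x \<partial>M)"
      proof (rule integral_dominated_convergence[where w = "\<lambda>x. 4 * B x / r"])
        show "AE x in M. (\<lambda>n. (h x (Y n) - h x z) / (Y n - z)) \<longlonglongrightarrow> u x"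
          using lim[OF Y(2) Ylim] u_eq by eventually_elim simp
        show "(\<lambda>x. (h x (Y n) - h x z) / (Y n - z)) \<in> borel_measurable M" for n
          using meas[OF YS[of n]] meas[OF z] by auto
        show "integrable M (\<lambda>x. 4 * B x / r)" using rB(3) by auto
        show "AE x in M. norm ((h x (Y n) - h x z) / (Y n - z)) \<le> 4 * B x / r" for n
          using hol rB(4)
        proof eventually_elim
          case (elim x)
          have "norm (h x (Y n) - h x z) \<le> (4 * B x / r) * norm (Y n - z)"
            using elim(2) rB(1) Y(1)
            by (intro holomorphic_difference_quotient_bound[OF holomorphic_on_subset[OF elim(1) rB(2)]]) auto
          then show ?case using Y(2)[of n] by (simp add: norm_divide pos_divide_le_eq)
        qed
        show "u \<in> borel_measurable M" by (rule u_meas)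
      qed
      also have "(\<lambda>n. \<integral>x. (h x (Y n) - h x z) / (Y n - z) \<partial>M) = (\<lambda>n. (F (Y n) - F z) / (Y n - z))"
        using int[OF YS] int[OF z] by (simp add: F_def)
      finally have "(\<lambda>n. (F (Y n) - F z) / (Y n - z)) \<longlonglongrightarrow> (\<integral>x. u x \<partial>M)" .
      then show "((\<lambda>w. (F w - F z) / (w - z)) \<circ> X) \<longlonglongrightarrow> (\<integral>x. u x \<partial>M)"
        unfolding Y_def o_def by (rule LIMSEQ_offset)
    qed
    then show ?thesis unfolding has_field_derivative_iff by blast
  qed
  then show "(\<lambda>z. \<integral>x. h x z \<partial>M) holomorphic_on S"
    unfolding F_def[symmetric] by (simp add: holomorphic_on_open[OF S])
qed

text \<open>All local limits are restrictions of one function, the pointwise \<open>lim\<close>, so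
  they fit together without further argument and Weierstrass's theorem applies.\<close>

lemma locally_uniformly_Cauchy_holomorphic_limit:
  fixes h :: "nat \<Rightarrow> complex \<Rightarrow> complex"
  assumes S: "open S" and hol: "\<And>n. h n holomorphic_on S"
    and C: "\<And>z. z \<in> S \<Longrightarrow> \<exists>r>0. uniformly_Cauchy_on (ball z r) h"
  obtains g where "g holomorphic_on S" "\<And>z. z \<in> S \<Longrightarrow> (\<lambda>n. h n z) \<longlonglongrightarrow> g z"
proof -
  define g where "g z = lim (\<lambda>n. h n z)" for z
  have "\<exists>d>0. cball z d \<subseteq> S \<and> uniform_limit (cball z d) h g sequentially" if z: "z \<in> S" for z
  proof -
    obtain r where r: "r > 0" "uniformly_Cauchy_on (ball z r) h" using C[OF z] by blast
    obtain e where e: "e > 0" "cball z e \<subseteq> S" using S z open_contains_cball by blast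
    define d where "d = min e (r/2)"
    have d: "d > 0" "cball z d \<subseteq> S" "cball z d \<subseteq> ball z r" using r e by (auto simp: d_def)
    have "uniformly_convergent_on (ball z r) h"
      using r(2) by (rule Cauchy_uniformly_convergent)
    then have "uniform_limit (ball z r) h g sequentially"
      unfolding g_def by (simp add: uniformly_convergent_uniform_limit_iff)
    then show ?thesis using d uniform_limit_on_subset by blast
  qed
  note ul = this
  show thesis
  proof (rule that[of g])
    show "g holomorphic_on S"
    proof (rule holomorphic_uniform_sequence[OF S])
      show "h n holomorphic_on S" for n by (rule hol)
    qed (rule ul)
    show "(\<lambda>n. h n z) \<longlonglongrightarrow> g z" if zS: "z \<in> S" for z
    proof -
      obtain d where "d > 0" "uniform_limit (cball z d) h g sequentially" using ul[OF zS] by blast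
      then show ?thesis by (intro tendsto_uniform_limitI[where S="cball z d"]) auto
    qed
  qed
qed

section \<open>Cells of a periodic domain\<close>

text \<open>Unordered sums are rewritten as integrals against counting measure, where sums over
  cells can be exchanged with area integrals by Tonelli's theorem and finiteness needs no separate
  bookkeeping.\<close>

lemma nn_integral_count_space_summable:
  fixes u :: "'a \<Rightarrow> real"
  assumes nonneg: "\<And>i. u i \<ge> 0"
  shows "u summable_on UNIV \<longleftrightarrow> (\<integral>\<^sup>+i. ennreal (u i) \<partial>count_space UNIV) < \<infinity>"
    and "u summable_on UNIV \<Longrightarrow> (\<integral>\<^sup>+i. ennreal (u i) \<partial>count_space UNIV) = ennreal (infsum u UNIV)"
proof -
  have 1: "u summable_on UNIV \<longleftrightarrow> integrable (count_space UNIV) u"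
    using abs_summable_equivalent[of u UNIV] nonneg
    by (simp add: Infinite_Set_Sum.abs_summable_on_def)
  then show "u summable_on UNIV \<longleftrightarrow> (\<integral>\<^sup>+i. ennreal (u i) \<partial>count_space UNIV) < \<infinity>"
    using nonneg by (simp add: integrable_iff_bounded)
  assume "u summable_on UNIV"
  with 1 have int: "integrable (count_space UNIV) u" by simp
  then have "infsum u UNIV = lebesgue_integral (count_space UNIV) u"
    using infsetsum_infsum[of u UNIV] by (simp add: Infinite_Set_Sum.abs_summable_on_def infsetsum_def)
  then show "(\<integral>\<^sup>+i. ennreal (u i) \<partial>count_space UNIV) = ennreal (infsum u UNIV)"
    using nn_integral_eq_integral[OF int] nonneg by simp
qed

text \<open>Moves norms from \<open>lebesgue_on S\<close> to nonnegative integrals over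
  \<open>lborel\<close> with an indicator. In this form translation invariance, Tonelli's theorem
  and Fatou's lemma apply directly.\<close>

lemma L2_iff_nn_integral:
  assumes S: "S \<in> sets lebesgue" and f: "f \<in> borel_measurable (lebesgue_on S)"
  shows "f \<in> L2 S \<longleftrightarrow> (\<integral>\<^sup>+z. indicator S z * ennreal ((norm (f z))\<^sup>2) \<partial>lborel) < \<infinity>"
    and "f \<in> L2 S \<Longrightarrow> ennreal ((L2_norm S f)\<^sup>2) = (\<integral>\<^sup>+z. indicator S z * ennreal ((norm (f z))\<^sup>2) \<partial>lborel)"
proof -
  have eq: "(\<integral>\<^sup>+z. ennreal ((norm (f z))\<^sup>2) \<partial>lebesgue_on S) = (\<integral>\<^sup>+z. indicator S z * ennreal ((norm (f z))\<^sup>2) \<partial>lborel)"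
    using S by (subst nn_integral_restrict_space) (auto simp: nn_integral_completion mult.commute)
  show "f \<in> L2 S \<longleftrightarrow> (\<integral>\<^sup>+z. indicator S z * ennreal ((norm (f z))\<^sup>2) \<partial>lborel) < \<infinity>"
    using f by (simp add: L2_def integrable_iff_bounded eq)
  assume "f \<in> L2 S"
  then have "integrable (lebesgue_on S) (\<lambda>z. (norm (f z))\<^sup>2)" by (simp add: L2_def)
  from nn_integral_eq_integral[OF this] show "ennreal ((L2_norm S f)\<^sup>2) = (\<integral>\<^sup>+z. indicator S z * ennreal ((norm (f z))\<^sup>2) \<partial>lborel)"
    by (simp add: L2_norm_square eq)
qed

section \<open>Measurability and translations in the plane\<close>

lemma borel_measurable_lebesgue_on_continuous:
  fixes f :: "complex \<Rightarrow> complex"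
  assumes "open S" "continuous_on S f"
  shows "f \<in> borel_measurable (lebesgue_on S)"
  using assms by (intro continuous_imp_measurable_on_sets_lebesgue) auto

lemma borel_measurable_indicator_norm_square:
  fixes f :: "complex \<Rightarrow> complex"
  assumes "open S" "continuous_on S f"
  shows "(\<lambda>z. indicator S z * ennreal ((norm (f z))\<^sup>2)) \<in> borel_measurable borel"
proof -
  have "(\<lambda>z. indicator S z *\<^sub>R f z) \<in> borel_measurable borel"
    using assms by (intro borel_measurable_continuous_on_indicator) auto
  then have "(\<lambda>z. ennreal ((norm (indicator S z *\<^sub>R f z))\<^sup>2)) \<in> borel_measurable borel"
    by measurable
  moreover have "(\<lambda>z. ennreal ((norm (indicator S z *\<^sub>R f z))\<^sup>2)) = (\<lambda>z. indicator S z * ennreal ((norm (f z))\<^sup>2))"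
    by (auto simp: indicator_def)
  ultimately show ?thesis by (simp only:)
qed

lemma nn_integral_lborel_shift:
  fixes c :: complex
  assumes "g \<in> borel_measurable borel"
  shows "(\<integral>\<^sup>+z. g (z + c) \<partial>lborel) = (\<integral>\<^sup>+z. g z \<partial>lborel)"
proof -
  have "(\<integral>\<^sup>+z. g z \<partial>lborel) = (\<integral>\<^sup>+z. g z \<partial>distr lborel borel ((+) c))"
    by (simp add: lborel_distr_plus)
  also have "\<dots> = (\<integral>\<^sup>+z. g (c + z) \<partial>lborel)"
    using assms by (subst nn_integral_distr) auto
  finally show ?thesis by (simp add: add.commute)
qed

lemma AE_lborel_Re_not_Ints: "AE z in lborel. Re z \<notin> \<int>"
proof -
  have "{z. Re z = of_int m} \<in> null_sets lborel" for m :: int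
  proof -
    have "negligible {z :: complex. z \<bullet> 1 = of_int m}"
      by (intro negligible_standard_hyperplane) (auto simp: Basis_complex_eq)
    then have "{z. Re z = of_int m} \<in> null_sets lebesgue"
      by (simp add: negligible_iff_null_sets)
    moreover have "closed {z. Re z = of_int m}"
      by (intro closed_Collect_eq continuous_intros)
    ultimately show ?thesis by (subst (asm) null_sets_completion_iff) auto
  qed
  then have "(\<Union>m::int. {z. Re z = of_int m}) \<in> null_sets lborel"
    by (intro null_sets_UN') auto
  from AE_not_in[OF this] show ?thesis
    by eventually_elim (auto simp: Ints_def)
qed

lemma A2_holomorphic: "f \<in> A2 S \<Longrightarrow> open S \<Longrightarrow> f holomorphic_on S"
  by (simp add: A2_def analytic_imp_holomorphic)

section \<open>Geometry of the cell and its translates\<close>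

locale floquet_cell =
  fixes M a b :: real and \<omega> :: "complex set"
  assumes cell: "periodic_cell M a b \<omega>"
begin

abbreviation \<Omega> :: "complex set" where "\<Omega> \<equiv> periodic_domain \<omega>"

lemma open_cell: "open \<omega>"
  using cell by (simp add: periodic_cell_def Lipschitz_domain_def)

lemma open_Omega: "open \<Omega>"
  by (simp add: periodic_domain_def)

lemma cell_bounds: "z \<in> \<omega> \<Longrightarrow> 0 < Re z" "z \<in> \<omega> \<Longrightarrow> Re z < 1" "z \<in> \<omega> \<Longrightarrow> \<bar>Im z\<bar> < M"
  using cell by (auto simp: periodic_cell_def)

lemma sets_cell: "\<omega> \<in> sets lebesgue"
  using open_cell by auto

lemma sets_Omega: "\<Omega> \<in> sets lebesgue"
  using open_Omega by auto

lemma closure_cell_bounds: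
  assumes "z \<in> closure \<omega>"
  shows "0 \<le> Re z" "Re z \<le> 1"
proof -
  have "closed ({z. 0 \<le> Re z} \<inter> {z. Re z \<le> 1})"
    by (intro closed_Int closed_halfspace_Re_ge closed_halfspace_Re_le)
  then have "closed {z. 0 \<le> Re z \<and> Re z \<le> 1}" by (simp add: Collect_conj_eq)
  moreover have "\<omega> \<subseteq> {z. 0 \<le> Re z \<and> Re z \<le> 1}"
    using cell_bounds by (auto intro: less_imp_le)
  ultimately have "closure \<omega> \<subseteq> {z. 0 \<le> Re z \<and> Re z \<le> 1}"
    by (intro closure_minimal)
  with assms show "0 \<le> Re z" "Re z \<le> 1" by auto
qed

lemma closure_left: "Re z = 0 \<Longrightarrow> z \<in> closure \<omega> \<longleftrightarrow> a \<le> Im z \<and> Im z \<le> b"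
  using cell by (auto simp: periodic_cell_def)

lemma closure_right: "Re z = 1 \<Longrightarrow> z \<in> closure \<omega> \<longleftrightarrow> a \<le> Im z \<and> Im z \<le> b"
  using cell by (auto simp: periodic_cell_def)

text \<open>The set whose interior is the periodic domain. Unlike the interior, it can be examined
  one translate at a time.\<close>

definition closed_strip :: "complex set" where
  "closed_strip = (\<Union>m::int. closure ((\<lambda>z. z + of_int m) ` \<omega>))"

lemma mem_closed_strip: "z \<in> closed_strip \<longleftrightarrow> (\<exists>m::int. z - of_int m \<in> closure \<omega>)"
proof -
  have "closure ((\<lambda>z. z + of_int m) ` \<omega>) = (\<lambda>z. z + of_int m) ` closure \<omega>" for m :: int
    using closure_translation[of "of_int m" \<omega>] by (simp add: add.commute)
  moreover have "z \<in> (\<lambda>z. z + of_int m) ` closure \<omega> \<longleftrightarrow> z - of_int m \<in> closure \<omega>" for m :: int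
    by (force simp: image_iff)
  ultimately show ?thesis unfolding closed_strip_def by simp
qed

lemma closed_strip_shift:
  assumes "z \<in> closed_strip" shows "z + of_int m \<in> closed_strip"
proof -
  obtain k :: int where "z - of_int k \<in> closure \<omega>" using assms mem_closed_strip by blast
  then have "(z + of_int m) - of_int (k + m) \<in> closure \<omega>" by (simp add: algebra_simps)
  then show ?thesis using mem_closed_strip by blast
qed

lemma mem_Omega: "z \<in> \<Omega> \<longleftrightarrow> (\<exists>e>0. ball z e \<subseteq> closed_strip)"
  by (simp add: periodic_domain_def closed_strip_def mem_interior)

lemma Omega_subset: "\<Omega> \<subseteq> closed_strip"
  unfolding periodic_domain_def closed_strip_def by (rule interior_subset)

lemma Omega_shift_aux:
  assumes "z \<in> \<Omega>" shows "z + of_int m \<in> \<Omega>"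
proof -
  obtain e where e: "e > 0" "ball z e \<subseteq> closed_strip" using assms mem_Omega by blast
  have "ball (z + of_int m) e \<subseteq> closed_strip"
  proof
    fix w assume "w \<in> ball (z + of_int m) e"
    then have "w - of_int m \<in> ball z e" by (simp add: dist_norm algebra_simps)
    then have "w - of_int m + of_int m \<in> closed_strip" using e closed_strip_shift by blast
    then show "w \<in> closed_strip" by simp
  qed
  then show ?thesis using e mem_Omega by blast
qed

lemma Omega_shift [simp]: "z + of_int m \<in> \<Omega> \<longleftrightarrow> z \<in> \<Omega>"
  using Omega_shift_aux[of z m] Omega_shift_aux[of "z + of_int m" "- m"] by auto

lemma Omega_shift_diff [simp]: "z - of_int m \<in> \<Omega> \<longleftrightarrow> z \<in> \<Omega>"
  using Omega_shift[of z "-m"] by simp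

lemma cell_subset: "\<omega> \<subseteq> \<Omega>"
  unfolding periodic_domain_def
proof (rule interior_maximal[OF _ open_cell])
  have "\<omega> \<subseteq> closed_strip"
    using mem_closed_strip closure_subset by (metis diff_zero of_int_0 subset_iff)
  then show "\<omega> \<subseteq> (\<Union>m::int. closure ((\<lambda>z. z + of_int m) ` \<omega>))" by (simp add: closed_strip_def)
qed

lemma cell_shift: "z \<in> \<omega> \<Longrightarrow> z + of_int m \<in> \<Omega>"
  using cell_subset by auto

lemma floor_cell: "z \<in> \<omega> \<Longrightarrow> \<lfloor>Re (z + of_int m)\<rfloor> = m"
  using cell_bounds[of z] by (simp add: floor_eq_iff)

lemma closed_strip_inner:
  assumes "z \<in> closed_strip" "0 < Re z" "Re z < 1"
  shows "z \<in> closure \<omega>"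
proof -
  obtain m :: int where m: "z - of_int m \<in> closure \<omega>" using assms(1) mem_closed_strip by blast
  have "-1 < (of_int m :: real)" "(of_int m :: real) < 1"
    using closure_cell_bounds[OF m] assms by auto
  then have "m = 0" by linarith
  with m show ?thesis by simp
qed

text \<open>The Lipschitz condition excludes slits: beyond a boundary point there are exterior points.\<close>

lemma Omega_inner:
  assumes z: "z \<in> \<Omega>" and re: "0 < Re z" "Re z < 1"
  shows "z \<in> \<omega>"
proof (rule ccontr)
  assume "z \<notin> \<omega>"
  moreover have "z \<in> closure \<omega>" using closed_strip_inner z re Omega_subset by blast
  ultimately have fr: "z \<in> frontier \<omega>" using open_cell by (simp add: frontier_def interior_open)
  have lip: "Lipschitz_domain \<omega>" using cell by (simp add: periodic_cell_def)
  obtain c r h \<phi> where c: "norm (c::complex) = 1" and rh: "0 < r" "0 < h"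
    and chart: "\<forall>x\<in>{-r<..<r}. \<forall>y\<in>{-h<..<h}.
           (z + c * Complex x y \<in> \<omega> \<longleftrightarrow> y < \<phi> x) \<and> (z + c * Complex x y \<in> frontier \<omega> \<longleftrightarrow> y = \<phi> x)"
    using bspec[OF lip[unfolded Lipschitz_domain_def, THEN conjunct2, THEN conjunct2, THEN conjunct2] fr]
    by (elim exE conjE) (rule that, assumption+)
  \<comment> \<open>The chart is centred at \<open>z\<close>, which is itself a boundary point, so
    its graph passes through the origin.\<close>
  have "z + c * Complex 0 0 \<in> frontier \<omega> \<longleftrightarrow> 0 = \<phi> 0" using chart rh by auto
  then have phi: "\<phi> 0 = 0" using fr by (simp add: Complex_eq)
  obtain e where e: "e > 0" "ball z e \<subseteq> closed_strip" using z mem_Omega by blast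
  \<comment> \<open>A step of length \<open>t\<close> straight up in the chart leads above the
    graph, hence out of \<open>\<omega>\<close> and its frontier. The four bounds keep it inside the
    ball, the chart and the open strip between the lines, where the closed strip coincides with the
    closure of the cell.\<close>
  define t where "t = Min {e, h, Re z, 1 - Re z} / 2"
  have t: "0 < t" "t < e" "t < h" "t < Re z" "t < 1 - Re z" using e rh re by (auto simp: t_def)
  define w where "w = z + c * Complex 0 t"
  have "norm (Complex 0 t) = t" using t by (simp add: complex_norm)
  then have nt: "norm (c * Complex 0 t) = t" using c by (simp add: norm_mult)
  then have "w \<in> ball z e" using t by (simp add: w_def dist_norm)
  moreover have "\<bar>Re (c * Complex 0 t)\<bar> \<le> t" using abs_Re_le_cmod[of "c * Complex 0 t"] nt by simp
  then have "0 < Re w" "Re w < 1" unfolding w_def plus_complex.sel using t by linarith+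
  ultimately have "w \<in> closure \<omega>" using closed_strip_inner e by blast
  moreover have "w \<notin> \<omega>" "w \<notin> frontier \<omega>" using chart rh t phi by (auto simp: w_def)
  ultimately show False using open_cell by (simp add: frontier_def interior_open)
qed

lemma Omega_floor:
  assumes z: "z \<in> \<Omega>" and re: "Re z \<notin> \<int>"
  shows "z - of_int \<lfloor>Re z\<rfloor> \<in> \<omega>"
proof (rule Omega_inner)
  have "Re z \<noteq> of_int \<lfloor>Re z\<rfloor>" using re by (metis Ints_of_int)
  then show "0 < Re (z - of_int \<lfloor>Re z\<rfloor>)" "Re (z - of_int \<lfloor>Re z\<rfloor>) < 1"
    using of_int_floor_le[of "Re z"] real_of_int_floor_add_one_gt[of "Re z"]
    unfolding minus_complex.sel complex_Re_of_int by linarith+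
qed (use z in auto)

lemma closed_strip_line:
  assumes "z \<in> closed_strip" "Re z = 0"
  shows "a \<le> Im z" "Im z \<le> b"
proof -
  obtain m :: int where m: "z - of_int m \<in> closure \<omega>" using assms(1) mem_closed_strip by blast
  have "-1 \<le> (of_int m :: real)" "(of_int m :: real) \<le> 0"
    using closure_cell_bounds[OF m] assms by auto
  then have "m = 0 \<or> m = -1" by linarith
  then show "a \<le> Im z" "Im z \<le> b"
    using m assms closure_left[of z] closure_right[of "z + 1"] by auto
qed

text \<open>Small vertical steps up and down stay in the closed strip, which makes the bounds on
  \<open>Im z\<close> strict. Points of the periodic domain on the line thus fall in the range where
  \<open>A2_ext\<close> relates the two sides.\<close>

lemma Omega_line:
  assumes z: "z \<in> \<Omega>" and re: "Re z = 0"
  shows "z \<in> closure \<omega>" "z + 1 \<in> closure \<omega>" "a < Im z" "Im z < b"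
proof -
  obtain e where e: "e > 0" "ball z e \<subseteq> closed_strip" using z mem_Omega by blast
  have "z + Complex 0 (e/2) \<in> closed_strip" "z + Complex 0 (-e/2) \<in> closed_strip"
    using e by (auto intro!: subsetD[OF e(2)] simp: dist_norm cmod_def)
  from closed_strip_line[OF this(1)] closed_strip_line[OF this(2)]
  show im: "a < Im z" "Im z < b" using e re by auto
  show "z \<in> closure \<omega>" "z + 1 \<in> closure \<omega>"
    using im re closure_left[of z] closure_right[of "z + 1"] by auto
qed

text \<open>Off the vertical lines exactly one translate can contain \<open>z\<close>, namely the
  one selected by the floor of its real part.\<close>

lemma indicator_Omega_sum:
  fixes g :: "complex \<Rightarrow> ennreal"
  assumes "Re z \<notin> \<int>"
  shows "indicator \<Omega> z * g z = (\<integral>\<^sup>+m. indicator \<omega> (z - of_int m) * g z \<partial>count_space (UNIV::int set))"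
proof -
  have "(\<integral>\<^sup>+m. indicator \<omega> (z - of_int m) * g z \<partial>count_space (UNIV::int set)) =
    (\<Sum>m\<in>{\<lfloor>Re z\<rfloor>}. indicator \<omega> (z - of_int m) * g z)"
  proof (rule nn_integral_count_space')
    fix m :: int assume "m \<notin> {\<lfloor>Re z\<rfloor>}"
    then have "z - of_int m \<notin> \<omega>" using floor_cell[of "z - of_int m" m] by auto
    then show "indicator \<omega> (z - of_int m) * g z = 0" by simp
  qed auto
  also have "\<dots> = indicator \<Omega> z * g z"
    using Omega_floor[OF _ assms] subsetD[OF cell_subset, of "z - of_int \<lfloor>Re z\<rfloor>"]
    by (auto simp: indicator_def)
  finally show ?thesis by simp
qed

section \<open>Integrals over the periodic domain as sums over cells\<close>

lemma borel_cell: "\<omega> \<in> sets borel"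
  using open_cell by auto

lemma nn_integral_cell_shift:
  assumes [measurable]: "g \<in> borel_measurable borel"
  shows "(\<integral>\<^sup>+z. indicator \<omega> (z - of_int m) * g z \<partial>lborel) = (\<integral>\<^sup>+z. indicator \<omega> z * g (z + of_int m) \<partial>lborel)"
proof -
  note borel_cell[measurable]
  have "(\<lambda>z. indicator \<omega> (z - of_int m) * g z) \<in> borel_measurable borel" by measurable
  from nn_integral_lborel_shift[OF this, of "of_int m"] show ?thesis by simp
qed

lemma nn_integral_Omega:
  assumes [measurable]: "g \<in> borel_measurable borel"
  shows "(\<integral>\<^sup>+z. indicator \<Omega> z * g z \<partial>lborel) =
    (\<integral>\<^sup>+m. (\<integral>\<^sup>+z. indicator \<omega> z * g (z + of_int m) \<partial>lborel) \<partial>count_space (UNIV::int set))"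
proof -
  note borel_cell[measurable]
  have "(\<integral>\<^sup>+z. indicator \<Omega> z * g z \<partial>lborel) =
    (\<integral>\<^sup>+z. (\<integral>\<^sup>+m. indicator \<omega> (z - of_int m) * g z \<partial>count_space (UNIV::int set)) \<partial>lborel)"
    by (intro nn_integral_cong_AE, use AE_lborel_Re_not_Ints in eventually_elim) (rule indicator_Omega_sum)
  also have "\<dots> = (\<integral>\<^sup>+m. (\<integral>\<^sup>+z. indicator \<omega> (z - of_int m) * g z \<partial>lborel) \<partial>count_space (UNIV::int set))"
    by (rule nn_integral_count_space_nn_integral) auto
  also have "(\<lambda>m::int. \<integral>\<^sup>+z. indicator \<omega> (z - of_int m) * g z \<partial>lborel)
     = (\<lambda>m. \<integral>\<^sup>+z. indicator \<omega> z * g (z + of_int m) \<partial>lborel)"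
    using nn_integral_cell_shift[OF assms] by simp
  finally show ?thesis .
qed

text \<open>The local version of the decomposition, for functions that are square integrable on each
  cell but not over the whole domain. An upper bound suffices, so the window may be symmetric
  although the floors occurring are only \<open>-N\<close> to \<open>N - 1\<close>.\<close>

lemma nn_integral_strip_le:
  fixes N :: nat
  assumes [measurable]: "g \<in> borel_measurable borel"
  shows "(\<integral>\<^sup>+z. indicator (\<Omega> \<inter> {z. \<bar>Re z\<bar> < real N}) z * g z \<partial>lborel) \<le>
    (\<Sum>m\<in>{-int N..int N}. (\<integral>\<^sup>+z. indicator \<omega> z * g (z + of_int m) \<partial>lborel))"
proof -
  note borel_cell[measurable]
  have "(\<integral>\<^sup>+z. indicator (\<Omega> \<inter> {z. \<bar>Re z\<bar> < real N}) z * g z \<partial>lborel) \<le>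
    (\<integral>\<^sup>+z. (\<Sum>m\<in>{-int N..int N}. indicator \<omega> (z - of_int m) * g z) \<partial>lborel)"
  proof (rule nn_integral_mono_AE)
    show "AE z in lborel. indicator (\<Omega> \<inter> {z. \<bar>Re z\<bar> < real N}) z * g z
        \<le> (\<Sum>m\<in>{-int N..int N}. indicator \<omega> (z - of_int m) * g z)"
      using AE_lborel_Re_not_Ints
    proof eventually_elim
      case (elim z)
      show ?case
      proof (cases "z \<in> \<Omega> \<and> \<bar>Re z\<bar> < real N")
        case True
        then have *: "z - of_int \<lfloor>Re z\<rfloor> \<in> \<omega>" "\<lfloor>Re z\<rfloor> \<in> {-int N..int N}"
          using Omega_floor elim by (auto simp: le_floor_iff floor_le_iff)
        have "indicator (\<Omega> \<inter> {z. \<bar>Re z\<bar> < real N}) z * g z = indicator \<omega> (z - of_int \<lfloor>Re z\<rfloor>) * g z"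
          using True * by simp
        also have "\<dots> \<le> (\<Sum>m\<in>{-int N..int N}. indicator \<omega> (z - of_int m) * g z)"
          by (rule member_le_sum[OF *(2)]) auto
        finally show ?thesis .
      qed (auto simp: indicator_def)
    qed
  qed
  also have "\<dots> = (\<Sum>m\<in>{-int N..int N}. (\<integral>\<^sup>+z. indicator \<omega> (z - of_int m) * g z \<partial>lborel))"
    by (rule nn_integral_sum) auto
  also have "\<dots> = (\<Sum>m\<in>{-int N..int N}. (\<integral>\<^sup>+z. indicator \<omega> z * g (z + of_int m) \<partial>lborel))"
    using nn_integral_cell_shift[OF assms] by simp
  finally show ?thesis .
qed

lemma continuous_on_cell_shift:
  assumes "continuous_on \<Omega> f"
  shows "continuous_on \<omega> (\<lambda>z. f (z + of_int m))"
  by (rule continuous_on_compose2[OF assms]) (auto intro!: continuous_intros cell_shift)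

lemma holomorphic_on_cell_shift:
  assumes "f holomorphic_on \<Omega>"
  shows "(\<lambda>z. f (z + of_int m)) holomorphic_on \<omega>"
proof -
  have "(\<lambda>z. z + of_int m) holomorphic_on \<omega>" by (intro holomorphic_intros)
  moreover have "(\<lambda>z. z + of_int m) ` \<omega> \<subseteq> \<Omega>" using cell_shift by blast
  ultimately show ?thesis using holomorphic_on_compose_gen[OF _ assms] by (simp add: o_def)
qed

lemma measurable_cell_shift:
  assumes "f holomorphic_on \<Omega>"
  shows "(\<lambda>z. f (z + of_int m)) \<in> borel_measurable (lebesgue_on \<omega>)"
  by (intro borel_measurable_lebesgue_on_continuous open_cell continuous_on_cell_shift
      holomorphic_on_imp_continuous_on assms)

text \<open>Holomorphy says nothing about \<open>f\<close> outside \<open>\<Omega>\<close>. A second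
  copy of the indicator is inserted to obtain an integrand that is Borel on the whole plane; it
  disappears again on the translates of the cell.\<close>

lemma nn_integral_Omega_norm_square:
  assumes "f holomorphic_on \<Omega>"
  shows "(\<integral>\<^sup>+z. indicator \<Omega> z * ennreal ((norm (f z))\<^sup>2) \<partial>lborel) =
    (\<integral>\<^sup>+m. (\<integral>\<^sup>+z. indicator \<omega> z * ennreal ((norm (f (z + of_int m)))\<^sup>2) \<partial>lborel) \<partial>count_space (UNIV::int set))"
proof -
  have "(\<integral>\<^sup>+z. indicator \<Omega> z * ennreal ((norm (f z))\<^sup>2) \<partial>lborel) =
    (\<integral>\<^sup>+z. indicator \<Omega> z * (indicator \<Omega> z * ennreal ((norm (f z))\<^sup>2)) \<partial>lborel)"
    by (intro nn_integral_cong) (auto simp: indicator_def)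
  also have "\<dots> = (\<integral>\<^sup>+m. (\<integral>\<^sup>+z. indicator \<omega> z * (indicator \<Omega> (z + of_int m) *
      ennreal ((norm (f (z + of_int m)))\<^sup>2)) \<partial>lborel) \<partial>count_space (UNIV::int set))"
    by (intro nn_integral_Omega borel_measurable_indicator_norm_square open_Omega
        holomorphic_on_imp_continuous_on assms)
  also have "\<dots> = (\<integral>\<^sup>+m. (\<integral>\<^sup>+z. indicator \<omega> z * ennreal ((norm (f (z + of_int m)))\<^sup>2) \<partial>lborel) \<partial>count_space (UNIV::int set))"
    by (intro nn_integral_cong) (use cell_subset in \<open>auto simp: indicator_def\<close>)
  finally show ?thesis .
qed

lemma nn_integral_strip_norm_square:
  fixes N :: nat
  assumes hol: "f holomorphic_on \<Omega>" and L2: "\<And>m. (\<lambda>z. f (z + of_int m)) \<in> L2 \<omega>"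
  shows "(\<integral>\<^sup>+z. indicator (\<Omega> \<inter> {z. \<bar>Re z\<bar> < real N}) z * ennreal ((norm (f z))\<^sup>2) \<partial>lborel) \<le>
    ennreal (\<Sum>m\<in>{-int N..int N}. (L2_norm \<omega> (\<lambda>z. f (z + of_int m)))\<^sup>2)"
proof -
  have "(\<integral>\<^sup>+z. indicator (\<Omega> \<inter> {z. \<bar>Re z\<bar> < real N}) z * ennreal ((norm (f z))\<^sup>2) \<partial>lborel) =
    (\<integral>\<^sup>+z. indicator (\<Omega> \<inter> {z. \<bar>Re z\<bar> < real N}) z * (indicator \<Omega> z * ennreal ((norm (f z))\<^sup>2)) \<partial>lborel)"
    by (intro nn_integral_cong) (auto simp: indicator_def)
  also have "\<dots> \<le> (\<Sum>m\<in>{-int N..int N}. (\<integral>\<^sup>+z. indicator \<omega> z * (indicator \<Omega> (z + of_int m) * ennreal ((norm (f (z + of_int m)))\<^sup>2)) \<partial>lborel))"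
    by (intro nn_integral_strip_le borel_measurable_indicator_norm_square open_Omega
        holomorphic_on_imp_continuous_on hol)
  also have "\<dots> = (\<Sum>m\<in>{-int N..int N}. (\<integral>\<^sup>+z. indicator \<omega> z * ennreal ((norm (f (z + of_int m)))\<^sup>2) \<partial>lborel))"
    by (intro sum.cong refl nn_integral_cong) (use cell_subset in \<open>auto simp: indicator_def\<close>)
  also have "\<dots> = (\<Sum>m\<in>{-int N..int N}. ennreal ((L2_norm \<omega> (\<lambda>z. f (z + of_int m)))\<^sup>2))"
    by (intro sum.cong refl L2_iff_nn_integral(2)[OF sets_cell, symmetric] L2 measurable_cell_shift hol)
  also have "\<dots> = ennreal (\<Sum>m\<in>{-int N..int N}. (L2_norm \<omega> (\<lambda>z. f (z + of_int m)))\<^sup>2)"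
    by (rule sum_ennreal) auto
  finally show ?thesis .
qed

text \<open>The total integral is a sum of nonnegative contributions of the cells. Its finiteness
  makes each piece square integrable, and the same identity is then Pythagoras' theorem for the
  pieces.\<close>

lemma A2_Omega_shift:
  assumes f: "f \<in> A2 \<Omega>"
  shows "(\<lambda>z. f (z + of_int m)) \<in> L2 \<omega>"
    and "((\<lambda>m. (L2_norm \<omega> (\<lambda>z. f (z + of_int m)))\<^sup>2) has_sum (L2_norm \<Omega> f)\<^sup>2) (UNIV::int set)"
proof -
  have hol: "f holomorphic_on \<Omega>" using f A2_holomorphic open_Omega by blast
  have fm: "f \<in> borel_measurable (lebesgue_on \<Omega>)" and fL2: "f \<in> L2 \<Omega>" using f by (auto simp: A2_def L2_def)
  have tot: "ennreal ((L2_norm \<Omega> f)\<^sup>2) = (\<integral>\<^sup>+m. (\<integral>\<^sup>+z. indicator \<omega> z * ennreal ((norm (f (z + of_int m)))\<^sup>2) \<partial>lborel) \<partial>count_space (UNIV::int set))"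
    using L2_iff_nn_integral(2)[OF sets_Omega fm fL2] nn_integral_Omega_norm_square[OF hol] by simp
  show L2: "(\<lambda>z. f (z + of_int m)) \<in> L2 \<omega>" for m
  proof -
    have "(\<integral>\<^sup>+z. indicator \<omega> z * ennreal ((norm (f (z + of_int m)))\<^sup>2) \<partial>lborel) \<le> ennreal ((L2_norm \<Omega> f)\<^sup>2)"
      unfolding tot by (rule nn_integral_ge_point[where p="\<lambda>m::int. \<integral>\<^sup>+z. indicator \<omega> z * ennreal ((norm (f (z + of_int m)))\<^sup>2) \<partial>lborel"]) simp
    also have "\<dots> < \<infinity>" by simp
    finally show ?thesis
      by (simp only: L2_iff_nn_integral(1)[OF sets_cell measurable_cell_shift[OF hol]])
  qed
  have eq: "ennreal ((L2_norm \<Omega> f)\<^sup>2) = (\<integral>\<^sup>+m. ennreal ((L2_norm \<omega> (\<lambda>z. f (z + of_int m)))\<^sup>2) \<partial>count_space (UNIV::int set))"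
    unfolding tot by (intro nn_integral_cong L2_iff_nn_integral(2)[OF sets_cell, symmetric] L2 measurable_cell_shift hol)
  then have sum: "(\<lambda>m. (L2_norm \<omega> (\<lambda>z. f (z + of_int m)))\<^sup>2) summable_on (UNIV::int set)"
    by (subst nn_integral_count_space_summable(1)) (simp, simp only: eq[symmetric], simp)
  from nn_integral_count_space_summable(2)[OF _ this] eq
  have "ennreal ((L2_norm \<Omega> f)\<^sup>2) = ennreal (infsum (\<lambda>m. (L2_norm \<omega> (\<lambda>z. f (z + of_int m)))\<^sup>2) (UNIV::int set))"
    by simp
  then have "(L2_norm \<Omega> f)\<^sup>2 = infsum (\<lambda>m. (L2_norm \<omega> (\<lambda>z. f (z + of_int m)))\<^sup>2) (UNIV::int set)"
    by (intro ennreal_inj[THEN iffD1] infsum_nonneg) auto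
  then show "((\<lambda>m. (L2_norm \<omega> (\<lambda>z. f (z + of_int m)))\<^sup>2) has_sum (L2_norm \<Omega> f)\<^sup>2) (UNIV::int set)"
    using sum by simp
qed

lemma A2_Omega_I:
  assumes hol: "f holomorphic_on \<Omega>" and zero: "\<And>z. z \<notin> \<Omega> \<Longrightarrow> f z = 0"
    and L2: "\<And>m::int. (\<lambda>z. f (z + of_int m)) \<in> L2 \<omega>"
    and sum: "(\<lambda>m. (L2_norm \<omega> (\<lambda>z. f (z + of_int m)))\<^sup>2) summable_on (UNIV::int set)"
  shows "f \<in> A2 \<Omega>"
proof -
  have fm: "f \<in> borel_measurable (lebesgue_on \<Omega>)"
    by (intro borel_measurable_lebesgue_on_continuous open_Omega holomorphic_on_imp_continuous_on hol)
  have "(\<integral>\<^sup>+z. indicator \<Omega> z * ennreal ((norm (f z))\<^sup>2) \<partial>lborel) =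
    (\<integral>\<^sup>+m. ennreal ((L2_norm \<omega> (\<lambda>z. f (z + of_int m)))\<^sup>2) \<partial>count_space (UNIV::int set))"
    unfolding nn_integral_Omega_norm_square[OF hol]
    by (intro nn_integral_cong L2_iff_nn_integral(2)[OF sets_cell, symmetric] L2 measurable_cell_shift hol)
  also have "\<dots> < \<infinity>" using sum by (subst (asm) nn_integral_count_space_summable(1)) auto
  finally have "f \<in> L2 \<Omega>" using L2_iff_nn_integral(1)[OF sets_Omega fm] by simp
  then show ?thesis using hol zero open_Omega by (simp add: A2_def analytic_on_open)
qed

lemma Bergman_cell:
  assumes "z \<in> \<omega>"
  obtains r C where "r > 0" "C > 0" "ball z r \<subseteq> \<omega>"
    "\<And>f w. f holomorphic_on \<omega> \<Longrightarrow> f \<in> L2 \<omega> \<Longrightarrow> w \<in> ball z r \<Longrightarrow> (norm (f w))\<^sup>2 \<le> C * (L2_norm \<omega> f)\<^sup>2"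
proof (rule Bergman_bound[OF open_cell assms])
  fix r C :: real
  assume *: "r > 0" "C > 0" "ball z r \<subseteq> \<omega>"
    "\<And>f I w. f holomorphic_on \<omega> \<Longrightarrow> I \<ge> 0 \<Longrightarrow>
      (\<integral>\<^sup>+z. indicator \<omega> z * ennreal ((norm (f z))\<^sup>2) \<partial>lborel) \<le> ennreal I \<Longrightarrow> w \<in> ball z r \<Longrightarrow> (norm (f w))\<^sup>2 \<le> C * I"
  show thesis
  proof (rule that[OF *(1-3)])
    fix f w assume f: "f holomorphic_on \<omega>" "f \<in> L2 \<omega>" "w \<in> ball z r"
    have "f \<in> borel_measurable (lebesgue_on \<omega>)" using f by (simp add: L2_def)
    from L2_iff_nn_integral(2)[OF sets_cell this f(2)]
    show "(norm (f w))\<^sup>2 \<le> C * (L2_norm \<omega> f)\<^sup>2"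
      using f by (intro *(4)) auto
  qed
qed

text \<open>The number \<open>N\<close> of cells depends on \<open>z\<close> alone, so the estimate
  also serves functions that do not decay at infinity, in particular quasiperiodic ones.\<close>

lemma Bergman_Omega:
  assumes "z \<in> \<Omega>"
  obtains r C and N :: nat where "r > 0" "C > 0" "ball z r \<subseteq> \<Omega>"
    "\<And>f w. f holomorphic_on \<Omega> \<Longrightarrow> (\<And>m::int. (\<lambda>z. f (z + of_int m)) \<in> L2 \<omega>) \<Longrightarrow> w \<in> ball z r \<Longrightarrow>
      (norm (f w))\<^sup>2 \<le> C * (\<Sum>m\<in>{-int N..int N}. (L2_norm \<omega> (\<lambda>z. f (z + of_int m)))\<^sup>2)"
proof -
  obtain N :: nat where N: "\<bar>Re z\<bar> < real N" using reals_Archimedean2 by blast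
  define S where "S = \<Omega> \<inter> {z. \<bar>Re z\<bar> < real N}"
  have S: "open S" "z \<in> S" using N assms unfolding S_def
    by (auto intro!: open_Int open_Omega open_Collect_less continuous_intros)
  show thesis
  proof (rule Bergman_bound[OF S])
    fix r C :: real
    assume *: "r > 0" "C > 0" "ball z r \<subseteq> S"
      "\<And>f I w. f holomorphic_on S \<Longrightarrow> I \<ge> 0 \<Longrightarrow>
        (\<integral>\<^sup>+z. indicator S z * ennreal ((norm (f z))\<^sup>2) \<partial>lborel) \<le> ennreal I \<Longrightarrow> w \<in> ball z r \<Longrightarrow> (norm (f w))\<^sup>2 \<le> C * I"
    show thesis
    proof (rule that[OF *(1,2), of N])
      show "ball z r \<subseteq> \<Omega>" using *(3) by (auto simp: S_def)
      fix f w assume f: "f holomorphic_on \<Omega>" "\<And>m::int. (\<lambda>z. f (z + of_int m)) \<in> L2 \<omega>" "w \<in> ball z r"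
      show "(norm (f w))\<^sup>2 \<le> C * (\<Sum>m\<in>{-int N..int N}. (L2_norm \<omega> (\<lambda>z. f (z + of_int m)))\<^sup>2)"
      proof (rule *(4)[OF _ _ _ f(3)])
        show "f holomorphic_on S" using f(1) by (rule holomorphic_on_subset) (simp add: S_def)
      qed (use nn_integral_strip_norm_square[OF f(1,2)] in \<open>auto simp: S_def intro!: sum_nonneg\<close>)
    qed
  qed
qed

end

section \<open>Quasiperiodic extensions\<close>

lemma holomorphic_on_locally:
  assumes S: "open S" and loc: "\<And>z. z \<in> S \<Longrightarrow> \<exists>V g. open V \<and> z \<in> V \<and> g holomorphic_on V \<and> (\<forall>w\<in>V. f w = g w)"
  shows "f holomorphic_on S"
  unfolding holomorphic_on_def
proof
  fix z assume "z \<in> S"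
  then obtain V g where V: "open V" "z \<in> V" "g holomorphic_on V" "\<forall>w\<in>V. f w = g w"
    using loc by blast
  have "f holomorphic_on V" using V(3,4) by (simp cong: holomorphic_cong)
  then have "f field_differentiable at z" using V(1,2) by (rule holomorphic_on_imp_differentiable_at)
  then show "f field_differentiable at z within S" by (rule field_differentiable_at_within)
qed

lemma L2_cong:
  assumes "\<And>z. z \<in> S \<Longrightarrow> f z = g z"
  shows "f \<in> L2 S \<longleftrightarrow> g \<in> L2 S" "L2_norm S f = L2_norm S g"
proof -
  have sp: "\<And>z. z \<in> space (lebesgue_on S) \<Longrightarrow> f z = g z" using assms by simp
  have "f \<in> borel_measurable (lebesgue_on S) \<longleftrightarrow> g \<in> borel_measurable (lebesgue_on S)"
    by (rule measurable_cong) (rule sp)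
  moreover have "integrable (lebesgue_on S) (\<lambda>z. (norm (f z))\<^sup>2) \<longleftrightarrow> integrable (lebesgue_on S) (\<lambda>z. (norm (g z))\<^sup>2)"
    by (rule Bochner_Integration.integrable_cong[OF refl]) (simp add: sp)
  ultimately show "f \<in> L2 S \<longleftrightarrow> g \<in> L2 S" by (simp add: L2_def)
  show "L2_norm S f = L2_norm S g" unfolding L2_norm_def
    by (intro arg_cong[of _ _ sqrt] Bochner_Integration.integral_cong refl) (simp add: sp)
qed

context floquet_cell
begin

text \<open>The multiplier law is imposed for all integers at once, and only over the open cell,
  where \<open>g\<close> carries information. In this form it can be checked by pointwise limits on
  each translate; on the vertical lines it follows by continuity.\<close>

definition quasi_ext :: "real \<Rightarrow> (complex \<Rightarrow> complex) \<Rightarrow> (complex \<Rightarrow> complex) \<Rightarrow> bool" where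
  "quasi_ext \<eta> g h \<longleftrightarrow> h holomorphic_on \<Omega> \<and>
     (\<forall>z\<in>\<omega>. \<forall>m::int. h (z + of_int m) = exp (\<i> * of_real \<eta> * of_int m) * g z)"

lemma A2_ext_quasi_ext:
  assumes "f \<in> A2_ext a b \<omega> \<eta>"
  shows "\<exists>h. quasi_ext \<eta> f h"
proof -
  obtain U h where U: "open U" "closure \<omega> \<inter> \<Omega> \<subseteq> U" "U \<subseteq> \<Omega>" "h analytic_on U"
    and hf: "\<And>z. z \<in> \<omega> \<Longrightarrow> h z = f z"
    and qp: "\<And>y. a < y \<Longrightarrow> y < b \<Longrightarrow> h (Complex 1 y) = exp (\<i> * of_real \<eta>) * h (Complex 0 y)"
    using assms unfolding A2_ext_def by blast
  have holU: "h holomorphic_on U" using U by (simp add: analytic_on_open)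
  define E where "E m = exp (\<i> * of_real \<eta> * of_int m)" for m :: int
  have E_add: "E (m + n) = E m * E n" for m n by (simp add: E_def exp_add algebra_simps)
  have E_neg: "E (-1) * (exp (\<i> * of_real \<eta>) * x) = x" for x by (simp add: E_def exp_minus)
  have cellU: "\<omega> \<subseteq> U" using U cell_subset closure_subset by blast
  \<comment> \<open>At a point of a vertical line the floor selects the cell to its right, so
    \<open>h\<close> is evaluated on the left edge of the cell.\<close>
  define H where "H z = E \<lfloor>Re z\<rfloor> * h (z - of_int \<lfloor>Re z\<rfloor>)" for z
  have "H holomorphic_on \<Omega>"
  proof (rule holomorphic_on_locally[OF open_Omega])
    fix z assume z: "z \<in> \<Omega>"
    have shift_open: "open {w. w - of_int m \<in> B}" if "open B" for m :: int and B :: "complex set"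
      using open_vimage[OF that, of "\<lambda>w. w - of_int m"] by (simp add: vimage_def continuous_intros)
    have shift_hol: "(\<lambda>w. E m * h (w - of_int m)) holomorphic_on {w. w - of_int m \<in> B}" if "B \<subseteq> U" for m :: int and B
    proof -
      have "(\<lambda>w. w - of_int m) holomorphic_on {w. w - of_int m \<in> B}" by (intro holomorphic_intros)
      moreover have "(\<lambda>w. w - of_int m) ` {w. w - of_int m \<in> B} \<subseteq> U" using that by auto
      ultimately have "(h \<circ> (\<lambda>w. w - of_int m)) holomorphic_on {w. w - of_int m \<in> B}"
        using holomorphic_on_compose_gen[OF _ holU] by blast
      then show ?thesis by (intro holomorphic_on_mult holomorphic_on_const) (simp add: o_def)
    qed
    show "\<exists>V g. open V \<and> z \<in> V \<and> g holomorphic_on V \<and> (\<forall>w\<in>V. H w = g w)"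
    proof (cases "Re z \<in> \<int>")
      case False
      define m where "m = \<lfloor>Re z\<rfloor>"
      have "H w = E m * h (w - of_int m)" if "w - of_int m \<in> \<omega>" for w
        using floor_cell[OF that, of m] by (simp add: H_def)
      then show ?thesis
        using shift_open[OF open_cell, of m] shift_hol[OF cellU, of m] Omega_floor[OF z False]
        by (intro exI[of _ "{w. w - of_int m \<in> \<omega>}"] exI[of _ "\<lambda>w. E m * h (w - of_int m)"]) (simp add: m_def)
    next
      case True
      then obtain m :: int where m: "Re z = of_int m" by (auto simp: Ints_def)
      define z0 where "z0 = z - of_int m"
      have z0: "z0 \<in> \<Omega>" "Re z0 = 0" using z m by (auto simp: z0_def)
      have "z0 + 1 \<in> \<Omega>" using z0(1) Omega_shift[of z0 1] by simp
      then have "z0 \<in> U" "z0 + 1 \<in> U" using Omega_line[OF z0] z0 U(2) by blast+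
      then obtain r1 r2 where r12: "r1 > 0" "ball z0 r1 \<subseteq> U" "r2 > 0" "ball (z0 + 1) r2 \<subseteq> U"
        using U(1) open_contains_ball by metis
      \<comment> \<open>Radius at most 1 ensures that the ball meets only the two cells adjacent to
        the line, so that only two values of the floor occur.\<close>
      define r where "r = min 1 (min r1 r2)"
      have r: "r > 0" "r \<le> 1" "ball z0 r \<subseteq> U" "ball (z0 + 1) r \<subseteq> U"
        using r12 by (auto simp: r_def)
      have ball1: "w + 1 \<in> ball (z0 + 1) r" if "w \<in> ball z0 r" for w using that by (simp add: dist_norm)
      \<comment> \<open>Near a point of the left edge, \<open>h\<close> and its copy carried over
        from the right edge are both analytic. The boundary condition makes them agree on the
        vertical diameter, which accumulates at the centre, so they agree on the ball.\<close>
      have glue: "E (-1) * h (w + 1) - h w = 0" if w: "w \<in> ball z0 r" for w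
      proof (rule analytic_continuation[where f = "\<lambda>w. E (-1) * h (w + 1) - h w"])
        have "(\<lambda>w. w + 1) holomorphic_on ball z0 r" by (intro holomorphic_intros)
        moreover have "(\<lambda>w. w + 1) ` ball z0 r \<subseteq> U" using ball1 r(4) by blast
        ultimately have "(h \<circ> (\<lambda>w. w + 1)) holomorphic_on ball z0 r"
          using holomorphic_on_compose_gen[OF _ holU] by blast
        moreover have "h holomorphic_on ball z0 r" using holU r(3) by (rule holomorphic_on_subset)
        ultimately show "(\<lambda>w. E (-1) * h (w + 1) - h w) holomorphic_on ball z0 r"
          by (intro holomorphic_on_diff holomorphic_on_mult holomorphic_on_const) (simp_all add: o_def)
        show "z0 islimpt {w \<in> ball z0 r. Re w = 0}"
          unfolding islimpt_approachable
        proof (intro allI impI)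
          fix e :: real assume e: "e > 0"
          define t where "t = min e r / 2"
          have t: "t > 0" "t < e" "t < r" using e r by (auto simp: t_def)
          have "norm (Complex 0 t) = t" using t by (simp add: complex_norm)
          then show "\<exists>x'\<in>{w \<in> ball z0 r. Re w = 0}. x' \<noteq> z0 \<and> dist x' z0 < e"
            using t z0(2) by (intro bexI[of _ "z0 + Complex 0 t"]) (auto simp: dist_norm complex_eq_iff)
        qed
        show "E (-1) * h (u + 1) - h u = 0" if "u \<in> {w \<in> ball z0 r. Re w = 0}" for u
        proof -
          have u: "u = Complex 0 (Im u)" "u \<in> \<Omega>" using that r(3) U(3) by (auto simp: complex_eq_iff)
          have "u + 1 = Complex 1 (Im u)" using u(1) by (simp add: complex_eq_iff)
          then have "h (u + 1) = exp (\<i> * of_real \<eta>) * h u"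
            using qp[of "Im u"] Omega_line[OF u(2)] that u(1) by simp
          then show ?thesis by (simp add: E_neg)
        qed
      qed (use w r in auto)
      have "H w = E m * h (w - of_int m)" if w: "w - of_int m \<in> ball z0 r" for w
      proof -
        define v where "v = w - of_int m"
        have "\<bar>Re (v - z0)\<bar> < 1"
          using w r(2) abs_Re_le_cmod[of "v - z0"] by (simp add: v_def dist_norm norm_minus_commute)
        then have rev: "\<bar>Re v\<bar> < 1" using z0 by simp
        show ?thesis
        proof (cases "Re v \<ge> 0")
          case True
          then have "\<lfloor>Re w\<rfloor> = m" using rev by (simp add: v_def floor_eq_iff)
          then show ?thesis by (simp add: H_def)
        next
          \<comment> \<open>To the left of the line the floor drops to \<open>m - 1\<close>; the
            factor \<open>E (-1)\<close> that this leaves over is the one absorbed by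
            \<open>glue\<close>.\<close>
          case False
          then have fl: "\<lfloor>Re w\<rfloor> = m + (-1)" using rev by (simp add: v_def floor_eq_iff)
          have "H w = E (m + (-1)) * h (w - of_int (m + (-1)))" by (simp only: H_def fl)
          also have "w - of_int (m + (-1)) = v + 1" by (simp add: v_def)
          finally have "H w = E (m + (-1)) * h (v + 1)" .
          also have "E (m + (-1)) * h (v + 1) = E m * (E (-1) * h (v + 1))" by (simp only: E_add mult.assoc)
          also have "E (-1) * h (v + 1) = h v" using glue[of v] w by (simp add: v_def)
          finally show ?thesis by (simp add: v_def)
        qed
      qed
      then show ?thesis
        using shift_open[OF open_ball, of m z0 r] shift_hol[OF r(3), of m] r(1)
        by (intro exI[of _ "{w. w - of_int m \<in> ball z0 r}"] exI[of _ "\<lambda>w. E m * h (w - of_int m)"]) (simp add: z0_def)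
    qed
  qed
  moreover have "H (z + of_int m) = exp (\<i> * of_real \<eta> * of_int m) * f z" if "z \<in> \<omega>" for z m
    using floor_cell[OF that, of m] hf[OF that] by (simp add: H_def E_def)
  ultimately show ?thesis unfolding quasi_ext_def by blast
qed

text \<open>The converse of the gluing. The extension is defined on all of \<open>\<Omega>\<close>,
  which is taken as the neighbourhood \<open>U\<close>.\<close>

lemma quasi_ext_A2_ext:
  assumes g: "g \<in> A2 \<omega>" and qe: "quasi_ext \<eta> g h"
  shows "g \<in> A2_ext a b \<omega> \<eta>"
proof -
  have hol: "h holomorphic_on \<Omega>" using qe by (simp add: quasi_ext_def)
  have cell_eq: "h (z + of_int m) = exp (\<i> * of_real \<eta> * of_int m) * g z" if "z \<in> \<omega>" for z m
    using qe that by (simp add: quasi_ext_def)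
  \<comment> \<open>The boundary condition is demanded for all \<open>y\<close> between
    \<open>a\<close> and \<open>b\<close>. If \<open>Complex 0 y\<close> is not in
    \<open>\<Omega>\<close>, neither is \<open>Complex 1 y\<close>, and the value 0 makes both sides
    vanish.\<close>
  define h0 where "h0 z = (if z \<in> \<Omega> then h z else 0)" for z
  have "h0 holomorphic_on \<Omega>" using hol by (simp add: h0_def cong: holomorphic_cong)
  then have "h0 analytic_on \<Omega>" using open_Omega by (simp add: analytic_on_open)
  moreover have "h0 z = g z" if "z \<in> \<omega>" for z
    using cell_eq[OF that, of 0] that cell_subset by (auto simp: h0_def)
  moreover have "h0 (Complex 1 y) = exp (\<i> * of_real \<eta>) * h0 (Complex 0 y)" for y
  proof (cases "Complex 0 y \<in> \<Omega>")
    case True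
    have p1: "Complex 0 y + 1 = Complex 1 y" by (simp add: complex_eq_iff)
    have Om1: "Complex 1 y \<in> \<Omega>" using True Omega_shift[of "Complex 0 y" 1] by (simp add: p1)
    have "Complex 0 y \<in> closure \<omega>" using Omega_line[OF True] by simp
    \<comment> \<open>The law is known inside the cell only, so the point of the line is approached
      from there and continuity is used on both sides of the shift.\<close>
    then obtain x where x: "\<And>n. x n \<in> \<omega>" "x \<longlonglongrightarrow> Complex 0 y" by (auto simp: closure_sequential)
    have cont: "isCont h w" if "w \<in> \<Omega>" for w
      using that hol open_Omega holomorphic_on_imp_continuous_on continuous_on_eq_continuous_at by blast
    have "(\<lambda>n. h (x n)) \<longlonglongrightarrow> h (Complex 0 y)"
      using cont[OF True] x(2) by (rule isCont_tendsto_compose)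
    then have 1: "(\<lambda>n. exp (\<i> * of_real \<eta>) * h (x n)) \<longlonglongrightarrow> exp (\<i> * of_real \<eta>) * h (Complex 0 y)"
      by (rule tendsto_mult_left)
    have "(\<lambda>n. x n + 1) \<longlonglongrightarrow> Complex 1 y"
      using tendsto_add[OF x(2) tendsto_const, of 1] by (simp add: p1)
    then have "(\<lambda>n. h (x n + 1)) \<longlonglongrightarrow> h (Complex 1 y)"
      using cont[OF Om1] isCont_tendsto_compose by blast
    moreover have "h (x n + 1) = exp (\<i> * of_real \<eta>) * h (x n)" for n
      using cell_eq[OF x(1), of n 1] cell_eq[OF x(1), of n 0] by simp
    ultimately have "h (Complex 1 y) = exp (\<i> * of_real \<eta>) * h (Complex 0 y)"
      by (intro LIMSEQ_unique[OF _ 1]) simp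
    then show ?thesis using True Om1 by (simp add: h0_def)
  next
    case False
    have "Complex 1 y = Complex 0 y + of_int 1" by (simp add: complex_eq_iff)
    then have "Complex 1 y \<notin> \<Omega>" using False Omega_shift[of "Complex 0 y" 1] by metis
    then show ?thesis using False by (simp add: h0_def)
  qed
  ultimately show ?thesis unfolding A2_ext_def using g open_Omega by blast
qed

lemma A2_ext_A2_eta:
  assumes "g \<in> A2_ext a b \<omega> \<eta>" shows "g \<in> A2_eta a b \<omega> \<eta>"
proof -
  have "g \<in> A2 \<omega>" using assms by (simp add: A2_ext_def)
  moreover have "L2_norm \<omega> (\<lambda>z. g z - g z) = 0" by simp
  ultimately show ?thesis unfolding A2_eta_def using assms by force
qed

lemma quasi_ext_L2:
  assumes qe: "quasi_ext \<eta> g h" and g: "g \<in> L2 \<omega>"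
  shows "(\<lambda>z. h (z + of_int m)) \<in> L2 \<omega>" "L2_norm \<omega> (\<lambda>z. h (z + of_int m)) = L2_norm \<omega> g"
proof -
  have eq: "\<And>z. z \<in> \<omega> \<Longrightarrow> h (z + of_int m) = exp (\<i> * of_real \<eta> * of_int m) * g z"
    using qe by (simp add: quasi_ext_def)
  have n1: "norm (exp (\<i> * of_real \<eta> * of_int m)) = 1" by (simp add: norm_exp_eq_Re)
  show "(\<lambda>z. h (z + of_int m)) \<in> L2 \<omega>" using L2_cong(1)[of \<omega>, OF eq] L2_mult[OF g] by simp
  show "L2_norm \<omega> (\<lambda>z. h (z + of_int m)) = L2_norm \<omega> g"
  proof -
    have "L2_norm \<omega> (\<lambda>z. h (z + of_int m)) = L2_norm \<omega> (\<lambda>z. exp (\<i> * of_real \<eta> * of_int m) * g z)"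
      by (rule L2_cong(2)) (rule eq)
    then show ?thesis by (simp only: L2_norm_mult n1 mult_1)
  qed
qed

text \<open>The multipliers are unimodular, so each of the cells \<open>-N\<close> to
  \<open>N\<close> contributes the same norm. The constant does not depend on \<open>\<eta>\<close>,
  as required for a dominating function in the integral over \<open>\<eta>\<close>.\<close>

lemma quasi_ext_bound:
  assumes "z \<in> \<Omega>"
  obtains r C where "r > 0" "C \<ge> 0" "ball z r \<subseteq> \<Omega>"
    "\<And>\<eta> g h w. g \<in> L2 \<omega> \<Longrightarrow> quasi_ext \<eta> g h \<Longrightarrow> w \<in> ball z r \<Longrightarrow> norm (h w) \<le> C * L2_norm \<omega> g"
proof (rule Bergman_Omega[OF assms])
  fix r C :: real and N :: nat
  assume *: "r > 0" "C > 0" "ball z r \<subseteq> \<Omega>"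
    "\<And>f w. f holomorphic_on \<Omega> \<Longrightarrow> (\<And>m::int. (\<lambda>z. f (z + of_int m)) \<in> L2 \<omega>) \<Longrightarrow> w \<in> ball z r \<Longrightarrow>
      (norm (f w))\<^sup>2 \<le> C * (\<Sum>m\<in>{-int N..int N}. (L2_norm \<omega> (\<lambda>z. f (z + of_int m)))\<^sup>2)"
  define D where "D = C * real (card {-int N..int N})"
  have D: "D \<ge> 0" using *(2) by (simp add: D_def)
  show thesis
  proof (rule that[OF *(1) _ *(3)])
    show "sqrt D \<ge> 0" using D by simp
    fix \<eta> g h w assume g: "g \<in> L2 \<omega>" and qe: "quasi_ext \<eta> g h" and w: "w \<in> ball z r"
    have "(norm (h w))\<^sup>2 \<le> C * (\<Sum>m\<in>{-int N..int N}. (L2_norm \<omega> (\<lambda>z. h (z + of_int m)))\<^sup>2)"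
      by (rule *(4)[OF _ quasi_ext_L2(1)[OF qe g] w]) (use qe in \<open>simp add: quasi_ext_def\<close>)
    also have "\<dots> = D * (L2_norm \<omega> g)\<^sup>2"
      unfolding quasi_ext_L2(2)[OF qe g] by (simp add: D_def)
    also have "\<dots> = (sqrt D * L2_norm \<omega> g)\<^sup>2" using D by (simp add: power_mult_distrib)
    finally show "norm (h w) \<le> sqrt D * L2_norm \<omega> g"
      by (rule power2_le_imp_le) (use D in simp)
  qed
qed

text \<open>No uniformity in the cell \<open>m\<close> is assumed: locally only finitely many cells
  enter the Bergman bound, and the maximum of finitely many indices is taken.\<close>

lemma Cauchy_Omega:
  assumes hol: "\<And>n. h n holomorphic_on \<Omega>" and L2: "\<And>n m. (\<lambda>z. h n (z + of_int m)) \<in> L2 \<omega>"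
    and Cau: "\<And>(m::int) e. e > 0 \<Longrightarrow> \<exists>N. \<forall>k\<ge>N. \<forall>l\<ge>N. L2_norm \<omega> (\<lambda>z. h k (z + of_int m) - h l (z + of_int m)) < e"
  obtains g where "g holomorphic_on \<Omega>" "\<And>z. z \<in> \<Omega> \<Longrightarrow> (\<lambda>n. h n z) \<longlonglongrightarrow> g z"
proof (rule locally_uniformly_Cauchy_holomorphic_limit[OF open_Omega, of h])
  show "h n holomorphic_on \<Omega>" for n by (rule hol)
  fix z assume "z \<in> \<Omega>"
  then show "\<exists>r>0. uniformly_Cauchy_on (ball z r) h"
  proof (rule Bergman_Omega)
    fix r C :: real and N :: nat
    assume *: "r > 0" "C > 0" "ball z r \<subseteq> \<Omega>"
      "\<And>f w. f holomorphic_on \<Omega> \<Longrightarrow> (\<And>m::int. (\<lambda>z. f (z + of_int m)) \<in> L2 \<omega>) \<Longrightarrow> w \<in> ball z r \<Longrightarrow>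
        (norm (f w))\<^sup>2 \<le> C * (\<Sum>m\<in>{-int N..int N}. (L2_norm \<omega> (\<lambda>z. f (z + of_int m)))\<^sup>2)"
    have "uniformly_Cauchy_on (ball z r) h"
      unfolding uniformly_Cauchy_on_def
    proof (intro allI impI)
      fix e :: real assume e: "e > 0"
      define J where "J = {-int N..int N}"
      define D where "D = C * real (card J)"
      have D: "D > 0" using *(2) by (simp add: D_def J_def)
      \<comment> \<open>With this \<open>d\<close> the bound over all cells of the window is
        \<open>D * d\<^sup>2\<close>, a quarter of \<open>e\<^sup>2\<close>.\<close>
      define d where "d = e / (2 * sqrt D)"
      have d: "d > 0" "D * d\<^sup>2 < e\<^sup>2" using e D by (auto simp: d_def power_divide power_mult_distrib field_simps)
      have "\<forall>m\<in>J. \<exists>K. \<forall>k\<ge>K. \<forall>l\<ge>K. L2_norm \<omega> (\<lambda>z. h k (z + of_int m) - h l (z + of_int m)) < d"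
        using Cau[OF d(1)] by blast
      then obtain K where K: "\<forall>m\<in>J. \<forall>k\<ge>K m. \<forall>l\<ge>K m. L2_norm \<omega> (\<lambda>z. h k (z + of_int m) - h l (z + of_int m)) < d"
        by metis
      have finJ: "finite J" by (simp add: J_def)
      show "\<exists>M. \<forall>x\<in>ball z r. \<forall>m\<ge>M. \<forall>n\<ge>M. dist (h m x) (h n x) < e"
      proof (intro exI[of _ "Max (K ` J)"] ballI allI impI)
        fix x k l assume x: "x \<in> ball z r" and kl: "Max (K ` J) \<le> k" "Max (K ` J) \<le> l"
        have "(norm (h k x - h l x))\<^sup>2 \<le> C * (\<Sum>m\<in>J. (L2_norm \<omega> (\<lambda>z. h k (z + of_int m) - h l (z + of_int m)))\<^sup>2)"
          unfolding J_def
          by (rule *(4)[of "\<lambda>x. h k x - h l x", OF _ _ x]) (intro holomorphic_on_diff hol L2_diff L2)+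
        also have "\<dots> \<le> C * (\<Sum>m\<in>J. d\<^sup>2)"
        proof (intro mult_left_mono sum_mono power_mono)
          fix m assume m: "m \<in> J"
          then have "K m \<le> Max (K ` J)" using finJ by (intro Max_ge) auto
          then show "L2_norm \<omega> (\<lambda>z. h k (z + of_int m) - h l (z + of_int m)) \<le> d"
            using K m kl by (meson less_imp_le order_trans)
        qed (use *(2) in auto)
        also have "\<dots> = D * d\<^sup>2" by (simp add: D_def)
        also have "\<dots> < e\<^sup>2" by (rule d(2))
        finally show "dist (h k x) (h l x) < e" using e by (simp add: dist_norm power2_less_imp_less)
      qed
    qed
    then show ?thesis using *(1) by blast
  qed
qed (rule that)

section \<open>Norm limits in the Bergman space\<close>

lemma L2_limit_pointwise:
  assumes hol: "\<And>n. g n holomorphic_on \<omega>" "g' holomorphic_on \<omega>"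
    and L2: "\<And>n. g n \<in> L2 \<omega>" "g' \<in> L2 \<omega>"
    and lim: "(\<lambda>n. L2_norm \<omega> (\<lambda>z. g n z - g' z)) \<longlonglongrightarrow> 0" and z: "z \<in> \<omega>"
  shows "(\<lambda>n. g n z) \<longlonglongrightarrow> g' z"
proof (rule Bergman_cell[OF z])
  fix r C :: real
  assume *: "r > 0" "C > 0" "ball z r \<subseteq> \<omega>"
    "\<And>f w. f holomorphic_on \<omega> \<Longrightarrow> f \<in> L2 \<omega> \<Longrightarrow> w \<in> ball z r \<Longrightarrow> (norm (f w))\<^sup>2 \<le> C * (L2_norm \<omega> f)\<^sup>2"
  have le: "norm (g n z - g' z) \<le> sqrt C * L2_norm \<omega> (\<lambda>z. g n z - g' z)" for n
  proof -
    have "(norm (g n z - g' z))\<^sup>2 \<le> C * (L2_norm \<omega> (\<lambda>z. g n z - g' z))\<^sup>2"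
      by (rule *(4)[of "\<lambda>z. g n z - g' z", OF holomorphic_on_diff[OF hol] L2_diff[OF L2]]) (use *(1) in simp)
    also have "\<dots> = (sqrt C * L2_norm \<omega> (\<lambda>z. g n z - g' z))\<^sup>2" using *(2) by (simp add: power_mult_distrib)
    finally show ?thesis by (rule power2_le_imp_le) (use *(2) in simp)
  qed
  have s0: "(\<lambda>n. sqrt C * L2_norm \<omega> (\<lambda>z. g n z - g' z)) \<longlonglongrightarrow> 0"
    using tendsto_mult_left[OF lim, of "sqrt C"] by simp
  have "(\<lambda>n. g n z - g' z) \<longlonglongrightarrow> 0"
    by (rule Lim_null_comparison[OF always_eventually s0]) (use le in auto)
  then show ?thesis by (simp add: LIM_zero_iff)
qed

text \<open>Completeness of the Bergman space. Bergman's inequality provides an analytic pointwise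
  limit, and Fatou's lemma turns the Cauchy condition into norm convergence towards it.\<close>

lemma Cauchy_A2_cell:
  assumes g: "\<And>n. g n \<in> A2 \<omega>"
    and Cau: "\<And>e. e > 0 \<Longrightarrow> \<exists>N. \<forall>k\<ge>N. \<forall>l\<ge>N. L2_norm \<omega> (\<lambda>z. g k z - g l z) < e"
  obtains g' where "g' \<in> A2 \<omega>" "(\<lambda>n. L2_norm \<omega> (\<lambda>z. g n z - g' z)) \<longlonglongrightarrow> 0"
proof -
  have hol: "g n holomorphic_on \<omega>" for n using A2_holomorphic[OF g open_cell] .
  have L2: "g n \<in> L2 \<omega>" for n using g by (simp add: A2_def)
  have "\<exists>r>0. uniformly_Cauchy_on (ball z r) g" if "z \<in> \<omega>" for z
    using that
  proof (rule Bergman_cell)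
    fix r C :: real
    assume *: "r > 0" "C > 0" "ball z r \<subseteq> \<omega>"
      "\<And>f w. f holomorphic_on \<omega> \<Longrightarrow> f \<in> L2 \<omega> \<Longrightarrow> w \<in> ball z r \<Longrightarrow> (norm (f w))\<^sup>2 \<le> C * (L2_norm \<omega> f)\<^sup>2"
    have "uniformly_Cauchy_on (ball z r) g"
      unfolding uniformly_Cauchy_on_def
    proof (intro allI impI)
      fix e :: real assume e: "e > 0"
      have "e / sqrt C > 0" using e *(2) by simp
      from Cau[OF this] obtain N where N: "\<forall>k\<ge>N. \<forall>l\<ge>N. L2_norm \<omega> (\<lambda>z. g k z - g l z) < e / sqrt C" by blast
      show "\<exists>M. \<forall>x\<in>ball z r. \<forall>m\<ge>M. \<forall>n\<ge>M. dist (g m x) (g n x) < e"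
      proof (intro exI[of _ N] ballI allI impI)
        fix x k l assume x: "x \<in> ball z r" and kl: "N \<le> k" "N \<le> l"
        have "(norm (g k x - g l x))\<^sup>2 \<le> C * (L2_norm \<omega> (\<lambda>z. g k z - g l z))\<^sup>2"
          by (rule *(4)[of "\<lambda>x. g k x - g l x", OF _ _ x]) (intro holomorphic_on_diff hol L2_diff L2)+
        also have "\<dots> = (sqrt C * L2_norm \<omega> (\<lambda>z. g k z - g l z))\<^sup>2" using *(2) by (simp add: power_mult_distrib)
        finally have "norm (g k x - g l x) \<le> sqrt C * L2_norm \<omega> (\<lambda>z. g k z - g l z)"
          by (rule power2_le_imp_le) (use *(2) in simp)
        also have "\<dots> < sqrt C * (e / sqrt C)"
          using N kl *(2) by (intro mult_strict_left_mono) auto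
        also have "\<dots> = e" using *(2) by simp
        finally show "dist (g k x) (g l x) < e" by (simp add: dist_norm)
      qed
    qed
    then show ?thesis using *(1) by blast
  qed
  then obtain g0 where g0: "g0 holomorphic_on \<omega>" "\<And>z. z \<in> \<omega> \<Longrightarrow> (\<lambda>n. g n z) \<longlonglongrightarrow> g0 z"
    using locally_uniformly_Cauchy_holomorphic_limit[OF open_cell, of g] hol by metis
  define g' where "g' z = (if z \<in> \<omega> then g0 z else 0)" for z
  have hol': "g' holomorphic_on \<omega>" using g0(1) by (simp add: g'_def cong: holomorphic_cong)
  have lim: "(\<lambda>n. g n z) \<longlonglongrightarrow> g' z" if "z \<in> \<omega>" for z using g0(2) that by (simp add: g'_def)
  have diff: "(\<integral>\<^sup>+z. indicator \<omega> z * ennreal ((norm (g k z - g' z))\<^sup>2) \<partial>lborel) \<le> ennreal (e\<^sup>2)"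
    if e: "e > 0" and kN: "\<forall>l\<ge>N. L2_norm \<omega> (\<lambda>z. g k z - g l z) < e" for e k N
  proof -
    define u where "u l z = indicator \<omega> z * ennreal ((norm (g k z - g l z))\<^sup>2)" for l z
    have "(\<integral>\<^sup>+z. indicator \<omega> z * ennreal ((norm (g k z - g' z))\<^sup>2) \<partial>lborel) = (\<integral>\<^sup>+z. liminf (\<lambda>l. u l z) \<partial>lborel)"
    proof (intro nn_integral_cong)
      fix z :: complex
      have "(\<lambda>l. u l z) \<longlonglongrightarrow> indicator \<omega> z * ennreal ((norm (g k z - g' z))\<^sup>2)"
      proof (cases "z \<in> \<omega>")
        case True
        then show ?thesis unfolding u_def using lim[OF True] by (auto intro!: tendsto_intros)
      qed (simp add: u_def)
      then show "indicator \<omega> z * ennreal ((norm (g k z - g' z))\<^sup>2) = liminf (\<lambda>l. u l z)"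
        by (simp add: lim_imp_Liminf)
    qed
    \<comment> \<open>Fatou's lemma in \<open>l\<close>, with \<open>k\<close> fixed: the Cauchy
      bound on the distance of \<open>g k\<close> to \<open>g l\<close> survives in the
      limit.\<close>
    also have "\<dots> \<le> liminf (\<lambda>l. \<integral>\<^sup>+z. u l z \<partial>lborel)"
    proof (rule nn_integral_liminf)
      fix l
      have "u l \<in> borel_measurable borel" unfolding u_def
        by (intro borel_measurable_indicator_norm_square open_cell continuous_on_diff holomorphic_on_imp_continuous_on hol)
      then show "u l \<in> borel_measurable lborel" by simp
    qed
    also have "\<dots> \<le> ennreal (e\<^sup>2)"
    proof (rule Liminf_le)
      show "\<forall>\<^sub>F l in sequentially. (\<integral>\<^sup>+z. u l z \<partial>lborel) \<le> ennreal (e\<^sup>2)"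
        unfolding eventually_sequentially
      proof (intro exI[of _ N] allI impI)
        fix l assume "N \<le> l"
        have mem: "(\<lambda>z. g k z - g l z) \<in> L2 \<omega>" by (intro L2_diff L2)
        then have "(\<lambda>z. g k z - g l z) \<in> borel_measurable (lebesgue_on \<omega>)" by (simp add: L2_def)
        from L2_iff_nn_integral(2)[OF sets_cell this mem]
        have "(\<integral>\<^sup>+z. u l z \<partial>lborel) = ennreal ((L2_norm \<omega> (\<lambda>z. g k z - g l z))\<^sup>2)" by (simp add: u_def)
        also have "\<dots> \<le> ennreal (e\<^sup>2)"
          using kN \<open>N \<le> l\<close> by (intro ennreal_leI power_mono) (auto intro: less_imp_le)
        finally show "(\<integral>\<^sup>+z. u l z \<partial>lborel) \<le> ennreal (e\<^sup>2)" .
      qed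
    qed simp
    finally show ?thesis .
  qed
  have meas: "(\<lambda>z. g k z - g' z) \<in> borel_measurable (lebesgue_on \<omega>)" for k
    by (intro borel_measurable_lebesgue_on_continuous open_cell continuous_on_diff
        holomorphic_on_imp_continuous_on hol hol')
  have main: "(\<lambda>z. g k z - g' z) \<in> L2 \<omega> \<and> L2_norm \<omega> (\<lambda>z. g k z - g' z) \<le> e"
    if e: "e > 0" and kN: "\<forall>l\<ge>N. L2_norm \<omega> (\<lambda>z. g k z - g l z) < e" for e k N
  proof
    note d = diff[OF that]
    show mem: "(\<lambda>z. g k z - g' z) \<in> L2 \<omega>"
      unfolding L2_iff_nn_integral(1)[OF sets_cell meas] using le_less_trans[OF d] by simp
    have "ennreal ((L2_norm \<omega> (\<lambda>z. g k z - g' z))\<^sup>2) \<le> ennreal (e\<^sup>2)"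
      using d by (simp only: L2_iff_nn_integral(2)[OF sets_cell meas mem])
    then have "(L2_norm \<omega> (\<lambda>z. g k z - g' z))\<^sup>2 \<le> e\<^sup>2" by simp
    then show "L2_norm \<omega> (\<lambda>z. g k z - g' z) \<le> e"
      by (rule power2_le_imp_le) (use e in simp)
  qed
  obtain N1 where "\<forall>k\<ge>N1. \<forall>l\<ge>N1. L2_norm \<omega> (\<lambda>z. g k z - g l z) < 1" using Cau[of 1] by auto
  then have "(\<lambda>z. g N1 z - g' z) \<in> L2 \<omega>" using main[of 1 N1 N1] by auto
  \<comment> \<open>The limit is \<open>g N1\<close> minus its difference to the limit, both square
    integrable.\<close>
  from L2_diff[OF L2[of N1] this] have "g' \<in> L2 \<omega>" by simp
  then have mem': "g' \<in> A2 \<omega>" using hol' open_cell by (simp add: A2_def analytic_on_open g'_def)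
  have "(\<lambda>n. L2_norm \<omega> (\<lambda>z. g n z - g' z)) \<longlonglongrightarrow> 0"
  proof (rule LIMSEQ_I)
    fix e :: real assume e: "e > 0"
    then obtain N where N: "\<forall>k\<ge>N. \<forall>l\<ge>N. L2_norm \<omega> (\<lambda>z. g k z - g l z) < e / 2"
      using Cau[of "e / 2"] by auto
    have "L2_norm \<omega> (\<lambda>z. g k z - g' z) \<le> e / 2" if "k \<ge> N" for k
      using main[of "e / 2" N k] N that e by auto
    then show "\<exists>N. \<forall>k\<ge>N. norm (L2_norm \<omega> (\<lambda>z. g k z - g' z) - 0) < e"
      using e by (intro exI[of _ N]) (force simp: dist_norm)
  qed
  with mem' show thesis by (rule that)
qed

text \<open>The approximants satisfy the multiplier law only asymptotically, separately on each
  translate. This covers two uses: extensions of approximants from \<open>A2_ext\<close>, where the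
  law is exact, and partial sums of the Floquet series, where it is not.\<close>

lemma quasi_ext_limit:
  assumes hol: "\<And>n. h n holomorphic_on \<Omega>" and L2: "\<And>n m. (\<lambda>z. h n (z + of_int m)) \<in> L2 \<omega>"
    and g: "g \<in> A2 \<omega>"
    and lim: "\<And>m::int. (\<lambda>n. L2_norm \<omega> (\<lambda>z. h n (z + of_int m) - exp (\<i> * of_real \<eta> * of_int m) * g z)) \<longlonglongrightarrow> 0"
  shows "\<exists>H. quasi_ext \<eta> g H"
proof -
  define E where "E m = exp (\<i> * of_real \<eta> * of_int m)" for m :: int
  have gL: "(\<lambda>z. E m * g z) \<in> L2 \<omega>" for m using g by (intro L2_mult) (simp add: A2_def)
  have ghol: "(\<lambda>z. E m * g z) holomorphic_on \<omega>" for m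
    by (intro holomorphic_on_mult holomorphic_on_const A2_holomorphic[OF g open_cell])
  have Cau: "\<exists>N. \<forall>k\<ge>N. \<forall>l\<ge>N. L2_norm \<omega> (\<lambda>z. h k (z + of_int m) - h l (z + of_int m)) < e"
    if e: "e > 0" for m :: int and e
  proof -
    have "\<forall>\<^sub>F n in sequentially. L2_norm \<omega> (\<lambda>z. h n (z + of_int m) - E m * g z) < e / 2"
      unfolding E_def using e by (intro order_tendstoD(2)[OF lim]) simp
    then obtain N where N: "\<And>n. n \<ge> N \<Longrightarrow> L2_norm \<omega> (\<lambda>z. h n (z + of_int m) - E m * g z) < e / 2"
      by (auto simp: eventually_sequentially)
    show ?thesis
    proof (intro exI[of _ N] allI impI)
      fix k l assume kl: "N \<le> k" "N \<le> l"
      have "L2_norm \<omega> (\<lambda>z. h k (z + of_int m) - h l (z + of_int m))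
        \<le> L2_norm \<omega> (\<lambda>z. h k (z + of_int m) - E m * g z) + L2_norm \<omega> (\<lambda>z. E m * g z - h l (z + of_int m))"
        by (rule L2_norm_triangle_diff[OF L2 gL L2])
      also have "L2_norm \<omega> (\<lambda>z. E m * g z - h l (z + of_int m)) = L2_norm \<omega> (\<lambda>z. h l (z + of_int m) - E m * g z)"
        by (rule L2_norm_minus_commute)
      also have "L2_norm \<omega> (\<lambda>z. h k (z + of_int m) - E m * g z) + L2_norm \<omega> (\<lambda>z. h l (z + of_int m) - E m * g z) < e"
        using N[OF kl(1)] N[OF kl(2)] by simp
      finally show "L2_norm \<omega> (\<lambda>z. h k (z + of_int m) - h l (z + of_int m)) < e" .
    qed
  qed
  show ?thesis
  proof (rule Cauchy_Omega[of h])
    show "h n holomorphic_on \<Omega>" for n by (rule hol)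
    show "(\<lambda>z. h n (z + of_int m)) \<in> L2 \<omega>" for n m by (rule L2)
    show "\<exists>N. \<forall>k\<ge>N. \<forall>l\<ge>N. L2_norm \<omega> (\<lambda>z. h k (z + of_int m) - h l (z + of_int m)) < e"
      if "e > 0" for m :: int and e by (rule Cau[OF that])
    fix H assume H: "H holomorphic_on \<Omega>" "\<And>z. z \<in> \<Omega> \<Longrightarrow> (\<lambda>n. h n z) \<longlonglongrightarrow> H z"
    have "H (z + of_int m) = E m * g z" if z: "z \<in> \<omega>" for z m
    proof (rule LIMSEQ_unique)
      show "(\<lambda>n. h n (z + of_int m)) \<longlonglongrightarrow> H (z + of_int m)" by (rule H(2)[OF cell_shift[OF z]])
      show "(\<lambda>n. h n (z + of_int m)) \<longlonglongrightarrow> E m * g z"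
        by (rule L2_limit_pointwise[where g = "\<lambda>n z. h n (z + of_int m)" and g' = "\<lambda>z. E m * g z",
              OF holomorphic_on_cell_shift[OF hol] ghol L2 gL lim[of m, folded E_def] z])
    qed
    then show ?thesis using H(1) unfolding quasi_ext_def E_def by blast
  qed
qed

text \<open>Since the multipliers have modulus 1, the distance of the extensions to the expected
  limit is the same on every translate as on the cell, so convergence on the cell spreads to all
  translates.\<close>

lemma A2_eta_quasi_ext:
  assumes f: "f \<in> A2_eta a b \<omega> \<eta>"
  shows "\<exists>h. quasi_ext \<eta> f h"
proof -
  have fA: "f \<in> A2 \<omega>" using f by (simp add: A2_eta_def)
  have "\<exists>g. g \<in> A2_ext a b \<omega> \<eta> \<and> L2_norm \<omega> (\<lambda>z. f z - g z) < inverse (real (Suc n))" for n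
  proof -
    have "inverse (real (Suc n)) > 0" by simp
    then show ?thesis using f unfolding A2_eta_def by blast
  qed
  then obtain g where g: "\<And>n. g n \<in> A2_ext a b \<omega> \<eta>" "\<And>n. L2_norm \<omega> (\<lambda>z. f z - g n z) < inverse (real (Suc n))"
    by metis
  have gA: "g n \<in> A2 \<omega>" for n using g(1) by (simp add: A2_ext_def)
  have gL: "g n \<in> L2 \<omega>" for n using gA by (simp add: A2_def)
  have lim: "(\<lambda>n. L2_norm \<omega> (\<lambda>z. f z - g n z)) \<longlonglongrightarrow> 0"
    by (rule Lim_null_comparison[OF always_eventually LIMSEQ_inverse_real_of_nat])
       (simp add: less_imp_le[OF g(2)] del: of_nat_Suc)
  then have lim': "(\<lambda>n. L2_norm \<omega> (\<lambda>z. g n z - f z)) \<longlonglongrightarrow> 0"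
    by (subst L2_norm_minus_commute)
  obtain h where h: "\<And>n. quasi_ext \<eta> (g n) (h n)" using A2_ext_quasi_ext[OF g(1)] by metis
  show ?thesis
  proof (rule quasi_ext_limit[of h, OF _ quasi_ext_L2(1)[OF h gL] fA])
    show "h n holomorphic_on \<Omega>" for n using h[of n] by (simp add: quasi_ext_def)
    fix m :: int
    define E where "E = exp (\<i> * of_real \<eta> * of_int m)"
    have nE: "norm E = 1" by (simp add: E_def norm_exp_eq_Re)
    have "L2_norm \<omega> (\<lambda>z. h n (z + of_int m) - E * f z) = L2_norm \<omega> (\<lambda>z. g n z - f z)" for n
    proof -
      have "L2_norm \<omega> (\<lambda>z. h n (z + of_int m) - E * f z) = L2_norm \<omega> (\<lambda>z. E * (g n z - f z))"
        using h[of n] by (intro L2_cong(2)) (simp add: quasi_ext_def E_def right_diff_distrib)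
      then show ?thesis by (simp only: L2_norm_mult nE mult_1)
    qed
    then show "(\<lambda>n. L2_norm \<omega> (\<lambda>z. h n (z + of_int m) - exp (\<i> * of_real \<eta> * of_int m) * f z)) \<longlonglongrightarrow> 0"
      using lim' by (simp only: E_def)
  qed
qed

end

section \<open>Completeness of the exponentials\<close>

lemma integrable_lebesgue_on_continuous_mult:
  fixes \<phi> v :: "real \<Rightarrow> complex"
  assumes "continuous_on {a..b} \<phi>" "integrable (lebesgue_on {a..b}) v"
  shows "integrable (lebesgue_on {a..b}) (\<lambda>x. \<phi> x * v x)"
proof -
  have "bounded (\<phi> ` {a..b})"
    using assms(1) by (intro compact_imp_bounded compact_continuous_image) auto
  then obtain B where "\<forall>y\<in>\<phi> ` {a..b}. norm y \<le> B" by (auto simp only: bounded_iff)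
  then have B: "norm (\<phi> x) \<le> B" if "x \<in> {a..b}" for x using that by blast
  show ?thesis
  proof (rule Bochner_Integration.integrable_bound)
    show "integrable (lebesgue_on {a..b}) (\<lambda>x. B * norm (v x))"
      using assms(2) by (intro integrable_mult_right integrable_norm)
    have "\<phi> \<in> borel_measurable (lebesgue_on {a..b})"
      using assms(1) by (intro continuous_imp_measurable_on_sets_lebesgue) auto
    then show "(\<lambda>x. \<phi> x * v x) \<in> borel_measurable (lebesgue_on {a..b})"
      using assms(2) by (intro borel_measurable_times) auto
    show "AE x in lebesgue_on {a..b}. norm (\<phi> x * v x) \<le> norm (B * norm (v x))"
    proof (rule AE_I2)
      fix x assume "x \<in> space (lebesgue_on {a..b})"
      then have "norm (\<phi> x) \<le> \<bar>B\<bar>" using B[of x] by simp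
      then show "norm (\<phi> x * v x) \<le> norm (B * norm (v x))"
        by (simp add: norm_mult abs_mult mult_right_mono)
    qed
  qed
qed

text \<open>Annihilation by all exponentials. The class is closed under multiplication by
  exponentials, and the test functions are enlarged from there: polynomials in
  \<open>cis \<eta>\<close>, continuous functions on the circle, indicators of open, Borel and
  finally Lebesgue sets.\<close>

definition fourier_null :: "(real \<Rightarrow> complex) \<Rightarrow> bool" where
  "fourier_null v \<longleftrightarrow> integrable \<T> v \<and>
     (\<forall>m::int. (\<integral>\<eta>. exp (\<i> * of_real \<eta> * of_int m) * v \<eta> \<partial>\<T>) = 0)"

lemma fourier_null_integrable:
  assumes "fourier_null v"
  shows "integrable \<T> (\<lambda>\<eta>. exp (\<i> * of_real \<eta> * of_int m) * v \<eta>)"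
  using assms unfolding fourier_null_def
  by (intro integrable_lebesgue_on_continuous_mult continuous_intros) auto

lemma fourier_null_lincomb:
  assumes v: "fourier_null v" and w: "fourier_null w"
  shows "fourier_null (\<lambda>\<eta>. c * v \<eta> + d * w \<eta>)"
proof -
  have "(\<integral>\<eta>. exp (\<i> * of_real \<eta> * of_int m) * (c * v \<eta> + d * w \<eta>) \<partial>\<T>) = 0" for m :: int
  proof -
    have "(\<integral>\<eta>. exp (\<i> * of_real \<eta> * of_int m) * (c * v \<eta> + d * w \<eta>) \<partial>\<T>) =
      (\<integral>\<eta>. c * (exp (\<i> * of_real \<eta> * of_int m) * v \<eta>) + d * (exp (\<i> * of_real \<eta> * of_int m) * w \<eta>) \<partial>\<T>)"
      by (intro Bochner_Integration.integral_cong) (auto simp: algebra_simps)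
    also have "\<dots> = 0"
      using fourier_null_integrable[OF v, of m] fourier_null_integrable[OF w, of m] v w
      by (simp add: fourier_null_def)
    finally show ?thesis .
  qed
  then show ?thesis using v w by (simp add: fourier_null_def)
qed

lemma fourier_null_shift:
  assumes v: "fourier_null v"
  shows "fourier_null (\<lambda>\<eta>. exp (\<i> * of_real \<eta> * of_int k) * v \<eta>)"
proof -
  have "(\<integral>\<eta>. exp (\<i> * of_real \<eta> * of_int m) * (exp (\<i> * of_real \<eta> * of_int k) * v \<eta>) \<partial>\<T>) = 0" for m :: int
  proof -
    have "(\<integral>\<eta>. exp (\<i> * of_real \<eta> * of_int m) * (exp (\<i> * of_real \<eta> * of_int k) * v \<eta>) \<partial>\<T>) =
      (\<integral>\<eta>. exp (\<i> * of_real \<eta> * of_int (m + k)) * v \<eta> \<partial>\<T>)"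
      by (intro Bochner_Integration.integral_cong) (auto simp: algebra_simps exp_add)
    then show ?thesis using v unfolding fourier_null_def by metis
  qed
  then show ?thesis using fourier_null_integrable[OF v] by (simp add: fourier_null_def)
qed

text \<open>For a product of polynomials the induction hypothesis is applied to
  \<open>of_real (g (cis \<eta>)) * v \<eta>\<close> in place of \<open>v\<close>, hence the generalization over \<open>v\<close>.\<close>

lemma fourier_null_polynomial:
  assumes "real_polynomial_function p"
  shows "fourier_null v \<Longrightarrow> fourier_null (\<lambda>\<eta>. of_real (p (cis \<eta>)) * v \<eta>)"
  using assms
proof (induction arbitrary: v rule: real_polynomial_function.induct)
  case (linear f)
  interpret bounded_linear f by (rule linear)
  have fcis: "f (cis \<eta>) = cos \<eta> * f 1 + sin \<eta> * f \<i>" for \<eta>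
  proof -
    have "cis \<eta> = cos \<eta> *\<^sub>R 1 + sin \<eta> *\<^sub>R \<i>" by (simp add: complex_eq_iff)
    then show ?thesis by (simp only: add scaleR real_scaleR_def)
  qed
  \<comment> \<open>A real linear functional of \<open>cis \<eta>\<close> is a combination of cosine
    and sine, which Euler's formulas express by the exponentials of index 1 and -1.\<close>
  have eq: "of_real (f (cis \<eta>)) * v \<eta> =
    ((of_real (f 1) - \<i> * of_real (f \<i>)) / 2) * (exp (\<i> * of_real \<eta> * of_int 1) * v \<eta>) +
    ((of_real (f 1) + \<i> * of_real (f \<i>)) / 2) * (exp (\<i> * of_real \<eta> * of_int (-1)) * v \<eta>)" for \<eta>
  proof -
    have e1: "exp (\<i> * of_real \<eta> * of_int 1) = Complex (cos \<eta>) (sin \<eta>)"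
      by (simp add: cis_conv_exp[symmetric] complex_eq_iff)
    have e2: "exp (\<i> * of_real \<eta> * of_int (-1)) = Complex (cos \<eta>) (- sin \<eta>)"
      using cis_conv_exp[of "- \<eta>"] by (simp add: complex_eq_iff)
    have "of_real (f (cis \<eta>)) = ((of_real (f 1) - \<i> * of_real (f \<i>)) / 2) * Complex (cos \<eta>) (sin \<eta>) +
      ((of_real (f 1) + \<i> * of_real (f \<i>)) / 2) * Complex (cos \<eta>) (- sin \<eta>)"
      unfolding fcis by (simp add: complex_eq_iff field_simps)
    then show ?thesis unfolding e1 e2 by (simp only: distrib_right mult.assoc)
  qed
  show ?case unfolding eq by (rule fourier_null_lincomb[OF fourier_null_shift[OF linear.prems] fourier_null_shift[OF linear.prems]])
next
  case (const c)
  then show ?case using fourier_null_lincomb[OF const const, of "of_real c" 0] by simp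
next
  case (add f g)
  then show ?case using fourier_null_lincomb[OF add.IH(1) add.IH(2), of v v 1 1] by (simp add: algebra_simps)
next
  case (mult f g)
  then show ?case using mult.IH(1)[OF mult.IH(2)[OF mult.prems]] by (simp add: mult.assoc)
qed

text \<open>By the Stone-Weierstrass theorem on the unit circle. Working there rather than on the
  interval identifies the end points, so that periodicity is built in.\<close>

lemma fourier_null_continuous:
  fixes F :: "complex \<Rightarrow> real"
  assumes v: "fourier_null v" and F: "continuous_on (sphere 0 1) F"
  shows "(\<integral>\<eta>. of_real (F (cis \<eta>)) * v \<eta> \<partial>\<T>) = 0"
proof -
  have int: "integrable \<T> v" using v by (simp add: fourier_null_def)
  define N where "N = (\<integral>\<eta>. norm (v \<eta>) \<partial>\<T>)"
  have N: "N \<ge> 0" by (simp add: N_def)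
  have cis: "continuous_on {-pi..pi} cis" unfolding cis_conv_exp by (intro continuous_intros)
  have intF: "integrable \<T> (\<lambda>\<eta>. of_real (G (cis \<eta>)) * v \<eta>)"
    if "continuous_on (sphere 0 1) G" for G :: "complex \<Rightarrow> real"
    by (intro integrable_lebesgue_on_continuous_mult int continuous_on_of_real continuous_on_compose2[OF that cis]) auto
  have le: "norm (\<integral>\<eta>. of_real (F (cis \<eta>)) * v \<eta> \<partial>\<T>) \<le> e * N" if e: "e > 0" for e
  proof -
    obtain p where p: "real_polynomial_function p" "\<And>x. x \<in> sphere 0 1 \<Longrightarrow> \<bar>F x - p x\<bar> < e"
      using Stone_Weierstrass_real_polynomial_function[OF _ F e] by auto
    have pc: "continuous_on (sphere 0 1) p"
      using p(1) continuous_on_polymonial_function real_polynomial_function_eq by blast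
    have "(\<integral>\<eta>. of_real (p (cis \<eta>)) * v \<eta> \<partial>\<T>) = 0"
      using fourier_null_polynomial[OF p(1) v] unfolding fourier_null_def
      by (elim conjE allE[of _ 0]) simp
    then have "(\<integral>\<eta>. of_real (F (cis \<eta>)) * v \<eta> \<partial>\<T>) =
      (\<integral>\<eta>. of_real (F (cis \<eta>)) * v \<eta> - of_real (p (cis \<eta>)) * v \<eta> \<partial>\<T>)"
      using intF[OF F] intF[OF pc] by simp
    also have "norm \<dots> \<le> (\<integral>\<eta>. e * norm (v \<eta>) \<partial>\<T>)"
    proof (rule Bochner_Integration.integral_norm_bound_integral)
      show "integrable \<T> (\<lambda>\<eta>. of_real (F (cis \<eta>)) * v \<eta> - of_real (p (cis \<eta>)) * v \<eta>)"
        using intF[OF F] intF[OF pc] by simp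
      show "integrable \<T> (\<lambda>\<eta>. e * norm (v \<eta>))" using int by simp
      fix \<eta> :: real
      have "norm (of_real (F (cis \<eta>)) * v \<eta> - of_real (p (cis \<eta>)) * v \<eta>) = \<bar>F (cis \<eta>) - p (cis \<eta>)\<bar> * norm (v \<eta>)"
        by (simp add: left_diff_distrib[symmetric] norm_mult flip: of_real_diff)
      also have "\<dots> \<le> e * norm (v \<eta>)" using p(2)[of "cis \<eta>"] by (intro mult_right_mono) auto
      finally show "norm (of_real (F (cis \<eta>)) * v \<eta> - of_real (p (cis \<eta>)) * v \<eta>) \<le> e * norm (v \<eta>)" .
    qed
    also have "\<dots> = e * N" by (simp add: N_def)
    finally show ?thesis .
  qed
  have "norm (\<integral>\<eta>. of_real (F (cis \<eta>)) * v \<eta> \<partial>\<T>) \<le> 0 + d" if d: "d > 0" for d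
  proof -
    \<comment> \<open>The denominator \<open>N + 1\<close> avoids a case distinction on whether
      \<open>N\<close> vanishes.\<close>
    have "d / (N + 1) * N \<le> d" using d N by (simp add: field_simps)
    then show ?thesis using le[of "d / (N + 1)"] d N by (auto intro: order_trans)
  qed
  then have "norm (\<integral>\<eta>. of_real (F (cis \<eta>)) * v \<eta> \<partial>\<T>) \<le> 0" by (rule field_le_epsilon)
  then show ?thesis by simp
qed

text \<open>The indicator of \<open>U\<close> is the pointwise limit of truncated multiples of the
  distance to the complement, with values between 0 and 1. A nonempty complement is required because
  \<open>infdist\<close> to the empty set is 0 by convention.\<close>

lemma fourier_null_open_circle:
  assumes v: "fourier_null v" and U: "open U" "U \<noteq> UNIV"
  shows "(\<integral>\<eta>. of_real (indicator U (cis \<eta>)) * v \<eta> \<partial>\<T>) = 0"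
proof -
  have int: "integrable \<T> v" using v by (simp add: fourier_null_def)
  define F where "F n w = min 1 (real n * infdist w (- U))" for n and w :: complex
  have F01: "\<bar>F n w\<bar> \<le> 1" for n w by (auto simp: F_def infdist_nonneg min_def)
  have Fcont: "continuous_on S (F n)" for n S unfolding F_def by (intro continuous_intros)
  have Flim: "(\<lambda>n. F n w) \<longlonglongrightarrow> indicator U w" for w
  proof (cases "w \<in> U")
    case True
    then have pos: "infdist w (- U) > 0"
      using in_closed_iff_infdist_zero[of "- U" w] U infdist_nonneg[of w "- U"] by (auto simp: less_le closed_Compl)
    obtain N :: nat where N: "1 / infdist w (- U) \<le> real N" using real_arch_simple by blast
    have "F n w = 1" if "n \<ge> N" for n
    proof -
      have "1 / infdist w (- U) \<le> real n" using N that by linarith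
      then show ?thesis using pos by (simp add: F_def field_simps)
    qed
    then have "(\<lambda>n. F n w) \<longlonglongrightarrow> 1"
      by (intro tendsto_eventually) (auto simp: eventually_sequentially)
    then show ?thesis using True by simp
  next
    case False
    then show ?thesis by (simp add: F_def)
  qed
  have cis: "continuous_on {-pi..pi} cis" unfolding cis_conv_exp by (intro continuous_intros)
  have meas: "(\<lambda>\<eta>. of_real (F n (cis \<eta>)) * v \<eta>) \<in> borel_measurable \<T>" for n
    using integrable_lebesgue_on_continuous_mult[OF continuous_on_of_real[OF continuous_on_compose2[OF Fcont cis]] int]
    by (rule borel_measurable_integrable) auto
  have lim: "(\<lambda>n. of_real (F n (cis \<eta>)) * v \<eta>) \<longlonglongrightarrow> of_real (indicator U (cis \<eta>)) * v \<eta>" for \<eta>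
    by (intro tendsto_mult_right tendsto_of_real Flim)
  have "(\<lambda>n. \<integral>\<eta>. of_real (F n (cis \<eta>)) * v \<eta> \<partial>\<T>) \<longlonglongrightarrow>
    (\<integral>\<eta>. of_real (indicator U (cis \<eta>)) * v \<eta> \<partial>\<T>)"
  proof (rule integral_dominated_convergence[where w = "\<lambda>\<eta>. norm (v \<eta>)"])
    show "(\<lambda>\<eta>. of_real (indicator U (cis \<eta>)) * v \<eta>) \<in> borel_measurable \<T>"
      by (rule borel_measurable_LIMSEQ_metric[OF meas lim])
    show "integrable \<T> (\<lambda>\<eta>. norm (v \<eta>))" using int by simp
    show "AE \<eta> in \<T>. norm (of_real (F n (cis \<eta>)) * v \<eta>) \<le> norm (v \<eta>)" for n
      using F01[of n] by (simp add: norm_mult mult_left_le_one_le)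
  qed (use meas lim in auto)
  moreover have "(\<integral>\<eta>. of_real (F n (cis \<eta>)) * v \<eta> \<partial>\<T>) = 0" for n
    by (rule fourier_null_continuous[OF v Fcont])
  ultimately show ?thesis by (simp add: LIMSEQ_const_iff)
qed

text \<open>An open set of quasimomenta is carried to the slit plane by \<open>Arg\<close>. The slit
  removes only the image of the end points \<open>-pi\<close> and \<open>pi\<close>, a null
  set.\<close>

lemma fourier_null_open:
  assumes v: "fourier_null v" and S: "open S"
  shows "(\<integral>\<eta>. indicator S \<eta> *\<^sub>R v \<eta> \<partial>\<T>) = 0"
proof -
  define U where "U = (- \<real>\<^sub>\<le>\<^sub>0) \<inter> Arg -` S"
  have op: "open (- \<real>\<^sub>\<le>\<^sub>0 :: complex set)" using closed_nonpos_Reals_complex by (rule open_Compl)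
  have "continuous_on (- \<real>\<^sub>\<le>\<^sub>0) Arg"
    using continuous_at_Arg by (simp add: continuous_on_eq_continuous_at[OF op])
  then have "open U" unfolding U_def using op S by (rule continuous_open_preimage)
  moreover have "0 \<notin> U" by (simp add: U_def)
  then have "U \<noteq> UNIV" by blast
  ultimately have *: "(\<integral>\<eta>. of_real (indicator U (cis \<eta>)) * v \<eta> \<partial>\<T>) = 0"
    by (rule fourier_null_open_circle[OF v])
  have mem: "cis \<eta> \<in> U \<longleftrightarrow> \<eta> \<in> S" if "\<eta> \<in> {-pi<..<pi}" for \<eta>
  proof -
    have Arg: "Arg (cis \<eta>) = \<eta>" using that by (intro Arg_cis) auto
    have "cis \<eta> \<notin> \<real>\<^sub>\<le>\<^sub>0"
    proof
      assume "cis \<eta> \<in> \<real>\<^sub>\<le>\<^sub>0"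
      then have sc: "sin \<eta> = 0" "cos \<eta> \<le> 0" by (auto simp: complex_nonpos_Reals_iff)
      have "\<eta> = 0" by (rule sin_eq_0_pi) (use that sc(1) in auto)
      with sc(2) show False by simp
    qed
    then show ?thesis using Arg by (simp add: U_def)
  qed
  have "(\<integral>\<eta>. indicator S \<eta> *\<^sub>R v \<eta> \<partial>\<T>) = (\<integral>\<eta>. of_real (indicator U (cis \<eta>)) * v \<eta> \<partial>\<T>)"
  proof (rule integral_cong_AE)
    have vm: "v \<in> borel_measurable \<T>"
      using v by (intro borel_measurable_integrable) (simp add: fourier_null_def)
    have "S \<inter> {-pi..pi} \<in> sets lborel" using S by simp
    then have "S \<inter> {-pi..pi} \<in> sets lebesgue" by (rule sets_completionI_sets)
    then have "S \<inter> {-pi..pi} \<in> sets \<T>"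
      by (subst sets_restrict_space_iff) auto
    then have "(indicator S :: real \<Rightarrow> real) \<in> borel_measurable \<T>"
      by (simp add: borel_measurable_indicator_iff)
    then show m1: "(\<lambda>\<eta>. indicator S \<eta> *\<^sub>R v \<eta>) \<in> borel_measurable \<T>"
      using vm by (rule borel_measurable_scaleR)
    have "{pi, -pi} \<in> null_sets lebesgue"
      by (rule null_sets_completionI[OF finite_imp_null_set_lborel]) simp
    then have "AE \<eta> in lebesgue. \<eta> \<notin> {pi, -pi}" by (rule AE_not_in)
    then have "AE \<eta> in \<T>. \<eta> \<notin> {pi, -pi}"
      by (subst AE_restrict_space_iff) auto
    then show ae: "AE \<eta> in \<T>. indicator S \<eta> *\<^sub>R v \<eta> = of_real (indicator U (cis \<eta>)) * v \<eta>"
      using AE_space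
    proof eventually_elim
      case (elim \<eta>)
      then have "\<eta> \<in> {-pi<..<pi}" by auto
      from mem[OF this] show ?case by (simp add: indicator_def)
    qed
    show "(\<lambda>\<eta>. of_real (indicator U (cis \<eta>)) * v \<eta>) \<in> borel_measurable \<T>"
    proof (rule borel_measurable_lebesgue_on_AE_limit[OF m1])
      show "AE \<eta> in \<T>. (\<lambda>n. indicator S \<eta> *\<^sub>R v \<eta>) \<longlonglongrightarrow> of_real (indicator U (cis \<eta>)) * v \<eta>"
        using ae by eventually_elim (simp only: tendsto_const)
    qed auto
  qed
  with * show ?thesis by simp
qed

text \<open>Dynkin's argument: open sets are stable under intersection and generate the Borel sets.
  Complements use that the total integral of \<open>v\<close> vanishes, which is the case of the
  open set \<open>UNIV\<close>.\<close>

lemma fourier_null_borel: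
  assumes v: "fourier_null v" and A: "A \<in> sets borel"
  shows "(\<integral>\<eta>. indicator A \<eta> *\<^sub>R v \<eta> \<partial>\<T>) = 0"
proof -
  have int: "integrable \<T> v" using v by (simp add: fourier_null_def)
  have res: "A \<inter> {-pi..pi} \<in> sets \<T>" if "A \<in> sets borel" for A :: "real set"
  proof -
    have "A \<inter> {-pi..pi} \<in> sets lborel" using that by simp
    then have "A \<inter> {-pi..pi} \<in> sets lebesgue" by (rule sets_completionI_sets)
    then show ?thesis by (subst sets_restrict_space_iff) auto
  qed
  have ind: "indicator A \<eta> *\<^sub>R v \<eta> = indicator (A \<inter> {-pi..pi}) \<eta> *\<^sub>R v \<eta>"
    if "\<eta> \<in> space \<T>" for A \<eta> using that by (auto simp: indicator_def)
  have intA: "integrable \<T> (\<lambda>\<eta>. indicator A \<eta> *\<^sub>R v \<eta>)" if "A \<in> sets borel" for A :: "real set"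
  proof -
    have "integrable \<T> (\<lambda>\<eta>. indicator A \<eta> *\<^sub>R v \<eta>) \<longleftrightarrow>
      integrable \<T> (\<lambda>\<eta>. indicator (A \<inter> {-pi..pi}) \<eta> *\<^sub>R v \<eta>)"
      by (intro Bochner_Integration.integrable_cong refl ind)
    then show ?thesis using integrable_mult_indicator[OF res[OF that] int] by simp
  qed
  have seq: "(\<integral>\<eta>. indicator A \<eta> *\<^sub>R v \<eta> \<partial>\<T>) =
      set_lebesgue_integral \<T> (A \<inter> {-pi..pi}) v" for A
    unfolding set_lebesgue_integral_def by (intro Bochner_Integration.integral_cong refl ind)
  have tot: "(\<integral>\<eta>. v \<eta> \<partial>\<T>) = 0"
    using fourier_null_open[OF v open_UNIV] by simp
  have stable: "Int_stable (Collect open :: real set set)" by (auto simp: Int_stable_def)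
  have sub_Pow: "Collect open \<subseteq> Pow (UNIV :: real set)" by simp
  have "A \<in> sigma_sets UNIV (Collect open)" using A by (simp add: borel_def)
  with stable sub_Pow show ?thesis
  proof (induction rule: sigma_sets_induct_disjoint)
    case (basic A)
    then show ?case using fourier_null_open[OF v] by simp
  next
    case empty
    then show ?case by simp
  next
    case (compl A)
    have Ab: "A \<in> sets borel" using compl(1) by (simp add: borel_def)
    have "(\<integral>\<eta>. indicator (UNIV - A) \<eta> *\<^sub>R v \<eta> \<partial>\<T>) =
      (\<integral>\<eta>. v \<eta> - indicator A \<eta> *\<^sub>R v \<eta> \<partial>\<T>)"
      by (intro Bochner_Integration.integral_cong) (auto simp: indicator_def)
    also have "\<dots> = 0" using int intA[OF Ab] tot compl(2) by simp
    finally show ?case .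
  next
    case (union A)
    have Ab: "A i \<in> sets borel" for i using union(2) by (auto simp: borel_def)
    have "(\<Union>i. A i) \<inter> {-pi..pi} = (\<Union>i. A i \<inter> {-pi..pi})" by auto
    then have "(\<integral>\<eta>. indicator (\<Union>i. A i) \<eta> *\<^sub>R v \<eta> \<partial>\<T>) =
      set_lebesgue_integral \<T> (\<Union>i. A i \<inter> {-pi..pi}) v" by (simp add: seq)
    also have "\<dots> = (\<Sum>i. set_lebesgue_integral \<T> (A i \<inter> {-pi..pi}) v)"
    proof (rule lebesgue_integral_countable_add)
      show "A i \<inter> {-pi..pi} \<in> sets \<T>" for i by (rule res[OF Ab])
      show "(A i \<inter> {-pi..pi}) \<inter> (A j \<inter> {-pi..pi}) = {}" if "i \<noteq> j" for i j
        using union(1) that by (auto simp: disjoint_family_on_def)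
      show "set_integrable \<T> (\<Union>i. A i \<inter> {-pi..pi}) v"
        unfolding set_integrable_def using res[OF Ab] by (intro integrable_mult_indicator int sets.countable_UN) auto
    qed
    also have "\<dots> = 0" by (simp only: seq[symmetric] union(3) suminf_zero)
    finally show ?case .
  qed
qed

text \<open>A Lebesgue set differs from a Borel set by a null set, so all set integrals of
  \<open>v\<close> vanish and \<open>v\<close> is the zero density.\<close>

lemma fourier_null_AE:
  assumes v: "fourier_null v"
  shows "AE \<eta> in \<T>. v \<eta> = 0"
proof -
  interpret finite_measure "\<T>" by (rule finite_measure_lebesgue_on) auto
  show ?thesis
  proof (rule density_zero)
    show int: "integrable \<T> v" using v by (simp add: fourier_null_def)
    fix A assume A: "A \<in> sets \<T>"
    then have "A \<in> sets lebesgue" by (auto simp: sets_restrict_space)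
    then obtain S N N' where SN: "A = S \<union> N" "N \<subseteq> N'" "N' \<in> null_sets lborel" "S \<in> sets lborel"
      by (rule sets_completionE)
    have "set_lebesgue_integral \<T> A v = (\<integral>\<eta>. indicator S \<eta> *\<^sub>R v \<eta> \<partial>\<T>)"
      unfolding set_lebesgue_integral_def
    proof (rule integral_cong_AE)
      show m1: "(\<lambda>\<eta>. indicator A \<eta> *\<^sub>R v \<eta>) \<in> borel_measurable \<T>"
        using borel_measurable_integrable[OF integrable_mult_indicator[OF A int]] .
      have "N' \<in> null_sets lebesgue" using SN(3) by (rule null_sets_completionI)
      then have "AE \<eta> in lebesgue. \<eta> \<notin> N'" by (rule AE_not_in)
      then have "AE \<eta> in \<T>. \<eta> \<notin> N'"
        by (subst AE_restrict_space_iff) auto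
      then show ae: "AE \<eta> in \<T>. indicator A \<eta> *\<^sub>R v \<eta> = indicator S \<eta> *\<^sub>R v \<eta>"
        by eventually_elim (use SN(1,2) in \<open>auto simp: indicator_def\<close>)
      show "(\<lambda>\<eta>. indicator S \<eta> *\<^sub>R v \<eta>) \<in> borel_measurable \<T>"
      proof (rule borel_measurable_lebesgue_on_AE_limit[OF m1])
        show "AE \<eta> in \<T>. (\<lambda>n. indicator A \<eta> *\<^sub>R v \<eta>) \<longlonglongrightarrow> indicator S \<eta> *\<^sub>R v \<eta>"
          using ae by eventually_elim (simp only: tendsto_const)
      qed auto
    qed
    also have "\<dots> = 0" using SN(4) by (intro fourier_null_borel v) simp
    finally show "set_lebesgue_integral \<T> A v = 0" .
  qed
qed

section \<open>Fourier series with values in the Bergman space\<close>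

lemma integral_exp_int:
  "(\<integral>\<eta>. exp (\<i> * of_real \<eta> * of_int k) \<partial>\<T>) = (if k = 0 then of_real (2 * pi) else 0)"
proof (cases "k = 0")
  case False
  have int: "integrable \<T> (\<lambda>\<eta>. exp (\<i> * of_real \<eta> * of_int k))"
    by (intro continuous_imp_integrable_real continuous_intros)
  have "((\<lambda>\<eta>. exp (\<i> * of_real \<eta> * of_int k)) has_integral
     exp (\<i> * of_real pi * of_int k) / (\<i> * of_int k) - exp (\<i> * of_real (-pi) * of_int k) / (\<i> * of_int k)) {-pi..pi}"
  proof (rule fundamental_theorem_of_calculus)
    fix x :: real
    have "((\<lambda>w. exp (\<i> * w * of_int k) / (\<i> * of_int k)) has_field_derivative exp (\<i> * of_real x * of_int k)) (at (of_real x))"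
      using False by (auto intro!: derivative_eq_intros simp: field_simps)
    then have "((\<lambda>t. exp (\<i> * of_real t * of_int k) / (\<i> * of_int k)) has_vector_derivative exp (\<i> * of_real x * of_int k)) (at x)"
      by (rule has_vector_derivative_real_field)
    then show "((\<lambda>t. exp (\<i> * of_real t * of_int k) / (\<i> * of_int k)) has_vector_derivative exp (\<i> * of_real x * of_int k)) (at x within {-pi..pi})"
      by (rule has_vector_derivative_at_within)
  qed simp
  moreover have "exp (\<i> * of_real pi * of_int k) = exp (\<i> * of_real (-pi) * of_int k)"
    unfolding exp_eq by (intro exI[of _ k]) (simp add: algebra_simps)
  ultimately have "integral {-pi..pi} (\<lambda>\<eta>. exp (\<i> * of_real \<eta> * of_int k)) = 0"
    by (simp add: integral_unique)
  then show ?thesis using False lebesgue_integral_eq_integral[OF int] by simp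
qed (simp add: measure_restrict_space scaleR_conv_of_real)

lemma norm_exp_diff_le: "norm (exp (- \<i> * of_real s * of_int m) - exp (- \<i> * of_real t * of_int m)) \<le> \<bar>s - t\<bar> * \<bar>real_of_int m\<bar>"
proof -
  define x where "x = (t - s) * real_of_int m"
  have "exp (- \<i> * of_real s * of_int m) - exp (- \<i> * of_real t * of_int m) =
     exp (\<i> * of_real (- t * real_of_int m)) * (exp (\<i> * of_real x) - 1)"
    by (simp add: right_diff_distrib exp_add[symmetric] x_def algebra_simps)
  then have "norm (exp (- \<i> * of_real s * of_int m) - exp (- \<i> * of_real t * of_int m)) = 2 * \<bar>sin (x / 2)\<bar>"
    by (simp only: norm_mult norm_exp_i_times dist_exp_i_1 mult_1)
  also have "\<dots> \<le> \<bar>x\<bar>" using abs_sin_x_le_abs_x[of "x / 2"] by simp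
  finally show ?thesis by (simp add: x_def abs_mult abs_minus_commute)
qed

text \<open>A Floquet sum with arbitrary coefficient functions in place of translates. The freedom
  is needed to use the pieces of \<open>f\<close> extended by zero: they lie in
  \<open>A2 \<omega>\<close>, whereas the translates of \<open>f\<close> in general do not vanish
  outside the cell. Constant coefficients give scalar sums.\<close>

definition trig_sum :: "(int \<Rightarrow> complex \<Rightarrow> complex) \<Rightarrow> int set \<Rightarrow> real \<Rightarrow> complex \<Rightarrow> complex" where
  "trig_sum p K \<eta> z = 1 / of_real (sqrt (2 * pi)) * (\<Sum>m\<in>K. exp (- \<i> * of_real \<eta> * of_int m) * p m z)"

lemma floquet_sum_eq_trig_sum: "floquet_sum f K \<eta> z = trig_sum (\<lambda>m z. f (z + of_int m)) K \<eta> z"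
  by (simp add: floquet_sum_def trig_sum_def)

lemma trig_sum_L2: "(\<And>m. p m \<in> L2 S) \<Longrightarrow> trig_sum p K \<eta> \<in> L2 S"
  unfolding trig_sum_def[abs_def] by (rule L2_mult[OF L2_sum[OF L2_mult]])

lemma trig_sum_diff: "finite K \<Longrightarrow> L \<subseteq> K \<Longrightarrow> trig_sum p K \<eta> z - trig_sum p L \<eta> z = trig_sum p (K - L) \<eta> z"
  by (simp add: trig_sum_def sum_diff right_diff_distrib)

lemma norm_exp_minus [simp]: "norm (exp (- (\<i> * of_real \<eta> * of_int m))) = 1"
  by (simp add: norm_exp_eq_Re)

lemma L2_norm_trig_sum_le:
  assumes "\<And>m. p m \<in> L2 S"
  shows "L2_norm S (trig_sum p K \<eta>) \<le> (\<Sum>m\<in>K. L2_norm S (p m))"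
proof -
  have "1 \<le> 2 * pi" using pi_gt3 by simp
  then have c: "norm (1 / complex_of_real (sqrt (2 * pi))) \<le> 1"
    by (simp add: norm_divide real_sqrt_ge_1_iff)
  have "L2_norm S (trig_sum p K \<eta>) = norm (1 / complex_of_real (sqrt (2 * pi))) * L2_norm S (\<lambda>z. \<Sum>m\<in>K. exp (- \<i> * of_real \<eta> * of_int m) * p m z)"
    unfolding trig_sum_def[abs_def] by (rule L2_norm_mult)
  also have "\<dots> \<le> 1 * L2_norm S (\<lambda>z. \<Sum>m\<in>K. exp (- \<i> * of_real \<eta> * of_int m) * p m z)"
    by (intro mult_right_mono c) simp
  also have "\<dots> \<le> (\<Sum>m\<in>K. L2_norm S (\<lambda>z. exp (- \<i> * of_real \<eta> * of_int m) * p m z))"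
    using L2_norm_sum[of K "\<lambda>m z. exp (- \<i> * of_real \<eta> * of_int m) * p m z" S] L2_mult assms by simp
  also have "\<dots> = (\<Sum>m\<in>K. L2_norm S (p m))" by (simp add: L2_norm_mult)
  finally show ?thesis .
qed

lemma L2_norm_trig_sum_lipschitz:
  assumes p: "\<And>m. p m \<in> L2 S"
  shows "L2_norm S (\<lambda>z. trig_sum p K s z - trig_sum p K t z) \<le> \<bar>s - t\<bar> * (\<Sum>m\<in>K. \<bar>real_of_int m\<bar> * L2_norm S (p m))"
proof -
  \<comment> \<open>The difference at \<open>s\<close> and \<open>t\<close> is itself a
    trigonometric sum, evaluated at 0, with the differences of the exponentials moved into the
    coefficients.\<close>
  define q where "q m z = (exp (- \<i> * of_real s * of_int m) - exp (- \<i> * of_real t * of_int m)) * p m z" for m z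
  have q: "q m \<in> L2 S" for m unfolding q_def[abs_def] by (rule L2_mult[OF p])
  have "(\<lambda>z. trig_sum p K s z - trig_sum p K t z) = trig_sum q K 0"
    by (simp add: trig_sum_def q_def fun_eq_iff left_diff_distrib right_diff_distrib sum_subtractf)
  then have "L2_norm S (\<lambda>z. trig_sum p K s z - trig_sum p K t z) \<le> (\<Sum>m\<in>K. L2_norm S (q m))"
    using L2_norm_trig_sum_le[of q S K 0, OF q] by simp
  also have "\<dots> \<le> (\<Sum>m\<in>K. \<bar>s - t\<bar> * \<bar>real_of_int m\<bar> * L2_norm S (p m))"
    unfolding q_def[abs_def] L2_norm_mult by (intro sum_mono mult_right_mono norm_exp_diff_le) simp
  also have "\<dots> = \<bar>s - t\<bar> * (\<Sum>m\<in>K. \<bar>real_of_int m\<bar> * L2_norm S (p m))"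
    by (simp add: sum_distrib_left mult.assoc)
  finally show ?thesis .
qed

text \<open>In the Gram expansion only the diagonal survives integration over \<open>\<eta>\<close>.
  The squared prefactor \<open>1 / (2 * pi)\<close> cancels the length of the interval.\<close>

lemma trig_sum_Parseval:
  assumes p: "\<And>m. p m \<in> L2 S" and K: "finite K"
  shows "integrable \<T> (\<lambda>\<eta>. (L2_norm S (trig_sum p K \<eta>))\<^sup>2)"
    and "(\<integral>\<eta>. (L2_norm S (trig_sum p K \<eta>))\<^sup>2 \<partial>\<T>) = (\<Sum>m\<in>K. (L2_norm S (p m))\<^sup>2)"
proof -
  define c where "c m n = 1 / of_real (2 * pi) * L2_inner S (p m) (p n)" for m n
  have eq: "complex_of_real ((L2_norm S (trig_sum p K \<eta>))\<^sup>2) =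
    (\<Sum>m\<in>K. \<Sum>n\<in>K. c m n * exp (\<i> * of_real \<eta> * of_int (n - m)))" for \<eta>
  proof -
    have "complex_of_real ((L2_norm S (trig_sum p K \<eta>))\<^sup>2) = of_real ((L2_norm S (\<lambda>z. \<Sum>m\<in>K. (1 / of_real (sqrt (2 * pi)) * exp (- \<i> * of_real \<eta> * of_int m)) * p m z))\<^sup>2)"
      by (simp add: trig_sum_def[abs_def] sum_distrib_left mult.assoc)
    also have "\<dots> = (\<Sum>m\<in>K. \<Sum>n\<in>K. (1 / of_real (sqrt (2 * pi)) * exp (- \<i> * of_real \<eta> * of_int m)) *
       cnj (1 / of_real (sqrt (2 * pi)) * exp (- \<i> * of_real \<eta> * of_int n)) * L2_inner S (p m) (p n))"
      by (rule L2_norm_square_sum) (rule p)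
    also have "\<dots> = (\<Sum>m\<in>K. \<Sum>n\<in>K. c m n * exp (\<i> * of_real \<eta> * of_int (n - m)))"
    proof (intro sum.cong refl)
      fix m n
      have sq: "complex_of_real (sqrt (2 * pi)) * of_real (sqrt (2 * pi)) = of_real (2 * pi)"
        by (simp flip: of_real_mult)
      have "exp (- \<i> * of_real \<eta> * of_int m) * cnj (exp (- \<i> * of_real \<eta> * of_int n)) = exp (\<i> * of_real \<eta> * of_int (n - m))"
        by (simp add: exp_cnj exp_add[symmetric] algebra_simps)
      then show "(1 / of_real (sqrt (2 * pi)) * exp (- \<i> * of_real \<eta> * of_int m)) *
       cnj (1 / of_real (sqrt (2 * pi)) * exp (- \<i> * of_real \<eta> * of_int n)) * L2_inner S (p m) (p n) = c m n * exp (\<i> * of_real \<eta> * of_int (n - m))"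
        unfolding c_def sq[symmetric] by (simp only: complex_cnj_mult complex_cnj_divide complex_cnj_one complex_cnj_complex_of_real) (simp add: divide_inverse mult_ac)
    qed
    finally show ?thesis .
  qed
  have inte: "integrable \<T> (\<lambda>\<eta>. exp (\<i> * of_real \<eta> * of_int k))" for k
    by (intro continuous_imp_integrable_real continuous_intros)
  have intc: "integrable \<T> (\<lambda>\<eta>. complex_of_real ((L2_norm S (trig_sum p K \<eta>))\<^sup>2))"
    unfolding eq by (intro Bochner_Integration.integrable_sum integrable_mult_right inte)
  show int: "integrable \<T> (\<lambda>\<eta>. (L2_norm S (trig_sum p K \<eta>))\<^sup>2)"
    using integrable_Re[OF intc] by simp
  have "complex_of_real (\<integral>\<eta>. (L2_norm S (trig_sum p K \<eta>))\<^sup>2 \<partial>\<T>) =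
    (\<integral>\<eta>. complex_of_real ((L2_norm S (trig_sum p K \<eta>))\<^sup>2) \<partial>\<T>)"
    by (rule integral_complex_of_real[symmetric])
  also have "\<dots> = (\<Sum>m\<in>K. \<Sum>n\<in>K. c m n * (\<integral>\<eta>. exp (\<i> * of_real \<eta> * of_int (n - m)) \<partial>\<T>))"
    unfolding eq by (simp only: Bochner_Integration.integral_sum Bochner_Integration.integrable_sum
        integrable_mult_right inte integral_mult_right_zero)
  also have "\<dots> = (\<Sum>m\<in>K. c m m * of_real (2 * pi))"
    unfolding integral_exp_int using K by (intro sum.cong refl) (simp add: sum.delta if_distrib cong: if_cong)
  also have "\<dots> = of_real (\<Sum>m\<in>K. (L2_norm S (p m))\<^sup>2)"
    by (simp add: c_def L2_norm_square_inner[symmetric])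
  finally show "(\<integral>\<eta>. (L2_norm S (trig_sum p K \<eta>))\<^sup>2 \<partial>\<T>) = (\<Sum>m\<in>K. (L2_norm S (p m))\<^sup>2)"
    by (simp only: of_real_eq_iff)
qed

text \<open>Rounding the quasimomentum down to a grid turns Lipschitz functions of it into simple ones.\<close>

definition grid :: "nat \<Rightarrow> real \<Rightarrow> real" where
  "grid n \<eta> = of_int \<lfloor>real (Suc n) * \<eta>\<rfloor> / real (Suc n)"

lemma grid_close: "\<bar>grid n \<eta> - \<eta>\<bar> \<le> 1 / real (Suc n)"
proof -
  have "\<bar>of_int \<lfloor>real (Suc n) * \<eta>\<rfloor> - real (Suc n) * \<eta>\<bar> \<le> 1"
    using of_int_floor_le[of "real (Suc n) * \<eta>"] real_of_int_floor_add_one_gt[of "real (Suc n) * \<eta>"] by linarith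
  moreover have "grid n \<eta> - \<eta> = (of_int \<lfloor>real (Suc n) * \<eta>\<rfloor> - real (Suc n) * \<eta>) / real (Suc n)"
    by (simp add: grid_def diff_divide_distrib del: of_nat_Suc)
  ultimately show ?thesis by (simp add: abs_divide divide_right_mono del: of_nat_Suc)
qed

text \<open>The rounding takes finitely many values on a bounded interval, so any function of the
  rounded argument is simple, whatever its range. Here the range is a space of functions.\<close>

lemma simple_function_grid: "simple_function \<T> (\<lambda>\<eta>. g (grid n \<eta>))"
proof -
  have "simple_function \<T> (grid n)"
  proof (rule simple_function_borel_measurable)
    have "grid n \<in> borel_measurable borel" unfolding grid_def by measurable
    then have "grid n \<in> borel_measurable lebesgue" by (simp add: measurable_completion)
    then show "grid n \<in> borel_measurable \<T>" by (rule measurable_restrict_space1)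
    have "grid n ` space \<T> \<subseteq> (\<lambda>k. of_int k / real (Suc n)) ` {\<lfloor>real (Suc n) * (-pi)\<rfloor>..\<lfloor>real (Suc n) * pi\<rfloor>}"
    proof
      fix x assume "x \<in> grid n ` space \<T>"
      then obtain \<eta> where \<eta>: "-pi \<le> \<eta>" "\<eta> \<le> pi" "x = grid n \<eta>" by auto
      have "\<lfloor>real (Suc n) * \<eta>\<rfloor> \<in> {\<lfloor>real (Suc n) * (-pi)\<rfloor>..\<lfloor>real (Suc n) * pi\<rfloor>}"
        unfolding atLeastAtMost_iff using \<eta> by (intro conjI floor_mono mult_left_mono) auto
      then show "x \<in> (\<lambda>k. of_int k / real (Suc n)) ` {\<lfloor>real (Suc n) * (-pi)\<rfloor>..\<lfloor>real (Suc n) * pi\<rfloor>}"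
        unfolding \<eta>(3) grid_def by (rule imageI)
    qed
    then show "finite (grid n ` space \<T>)" by (rule finite_subset) simp
  qed
  from simple_function_compose[OF this, of g] show ?thesis by (simp add: o_def)
qed

lemma L2_norm_trig_sum_grid:
  assumes "\<And>m. p m \<in> L2 S"
  shows "L2_norm S (\<lambda>z. trig_sum p K (grid n \<eta>) z - trig_sum p K \<eta> z)
    \<le> (\<Sum>m\<in>K. \<bar>real_of_int m\<bar> * L2_norm S (p m)) / real (Suc n)"
proof -
  have "L2_norm S (\<lambda>z. trig_sum p K (grid n \<eta>) z - trig_sum p K \<eta> z)
    \<le> \<bar>grid n \<eta> - \<eta>\<bar> * (\<Sum>m\<in>K. \<bar>real_of_int m\<bar> * L2_norm S (p m))"
    by (rule L2_norm_trig_sum_lipschitz[OF assms])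
  also have "\<dots> \<le> 1 / real (Suc n) * (\<Sum>m\<in>K. \<bar>real_of_int m\<bar> * L2_norm S (p m))"
    by (intro mult_right_mono grid_close sum_nonneg) auto
  finally show ?thesis by simp
qed

text \<open>A finite sum is Lipschitz in \<open>\<eta>\<close> for the norm of \<open>L2 S\<close>,
  so sampling it on finer and finer grids gives the simple functions that strong measurability
  demands.\<close>

lemma trig_sum_bochner_L2:
  assumes p: "\<And>m. p m \<in> L2 S" and K: "finite K"
  shows "trig_sum p K \<in> bochner_L2 S (L2 S)"
proof -
  define T where "T n \<eta> = trig_sum p K (grid n \<eta>)" for n \<eta>
  define C where "C = (\<Sum>m\<in>K. \<bar>real_of_int m\<bar> * L2_norm S (p m))"
  have "(\<lambda>n. L2_norm S (\<lambda>z. T n \<eta> z - trig_sum p K \<eta> z)) \<longlonglongrightarrow> 0" for \<eta>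
  proof -
    have le: "L2_norm S (\<lambda>z. T n \<eta> z - trig_sum p K \<eta> z) \<le> C / real (Suc n)" for n
      unfolding T_def C_def by (rule L2_norm_trig_sum_grid[OF p])
    have lim: "(\<lambda>n. C / real (Suc n)) \<longlonglongrightarrow> 0"
      using tendsto_mult_left[OF LIMSEQ_inverse_real_of_nat, of C] by (simp add: divide_inverse)
    show ?thesis by (rule Lim_null_comparison[OF always_eventually lim]) (use le in simp)
  qed
  moreover have "simple_function \<T> (T n)" for n
    unfolding T_def by (rule simple_function_grid)
  ultimately have "strongly_measurable S (L2 S) (trig_sum p K)"
    unfolding strongly_measurable_def using trig_sum_L2[of p S, OF p]
    by (intro exI[of _ T]) (simp add: T_def)
  then show ?thesis
    using trig_sum_L2[of p S, OF p] trig_sum_Parseval(1)[of p S K, OF p K] by (simp add: bochner_L2_def)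
qed

lemma bochner_norm_trig_sum:
  assumes p: "\<And>m. p m \<in> L2 S" and K: "finite K"
  shows "(bochner_norm S (trig_sum p K))\<^sup>2 = (\<Sum>m\<in>K. (L2_norm S (p m))\<^sup>2)"
  unfolding bochner_norm_square by (rule trig_sum_Parseval(2)[OF p K])

text \<open>A Borel-Cantelli argument: weighted by \<open>4 ^ k\<close>, the squares have integrals
  at most \<open>(1/4) ^ k\<close>, so their sum is finite almost everywhere. A finite sum bounds
  each weighted square, and the root of \<open>4 ^ k\<close> is the factor gained.\<close>

lemma AE_geometric_bound:
  fixes d :: "nat \<Rightarrow> 'a \<Rightarrow> real"
  assumes meas: "\<And>k. d k \<in> borel_measurable M" 
    and int: "\<And>k. (\<integral>\<^sup>+x. ennreal ((d k x)\<^sup>2) \<partial>M) \<le> ennreal ((1/16) ^ k)"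
  shows "AE x in M. \<exists>C. \<forall>k. \<bar>d k x\<bar> \<le> C * (1/2) ^ k"
proof -
  note meas[measurable]
  have "(\<integral>\<^sup>+x. (\<Sum>k. ennreal (4 ^ k * (d k x)\<^sup>2)) \<partial>M) = (\<Sum>k. \<integral>\<^sup>+x. ennreal (4 ^ k * (d k x)\<^sup>2) \<partial>M)"
    by (rule nn_integral_suminf) measurable
  also have "\<dots> = (\<Sum>k. ennreal (4 ^ k) * (\<integral>\<^sup>+x. ennreal ((d k x)\<^sup>2) \<partial>M))"
    by (simp add: ennreal_mult nn_integral_cmult)
  also have "\<dots> \<le> (\<Sum>k. ennreal ((1/4) ^ k))"
  proof (intro suminf_le summableI)
    fix k
    have "ennreal (4 ^ k) * (\<integral>\<^sup>+x. ennreal ((d k x)\<^sup>2) \<partial>M) \<le> ennreal (4 ^ k) * ennreal ((1/16) ^ k)"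
      by (intro mult_left_mono int) simp
    also have "\<dots> = ennreal (4 ^ k * (1/16) ^ k)" by (simp only: ennreal_mult[symmetric] zero_le_power zero_le_numeral zero_le_divide_1_iff)
    also have "4 ^ k * (1/16) ^ k = (1/4 :: real) ^ k" by (simp only: power_mult_distrib[symmetric]) simp
    finally show "ennreal (4 ^ k) * (\<integral>\<^sup>+x. ennreal ((d k x)\<^sup>2) \<partial>M) \<le> ennreal ((1/4) ^ k)" .
  qed
  also have "(\<Sum>k. ennreal ((1/4) ^ k)) = ennreal (\<Sum>k. (1/4) ^ k)"
    by (rule suminf_ennreal2) (auto intro!: summable_geometric)
  also have "\<dots> < \<infinity>" by simp
  finally have "AE x in M. (\<Sum>k. ennreal (4 ^ k * (d k x)\<^sup>2)) \<noteq> \<infinity>"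
    by (intro nn_integral_PInf_AE) auto
  then show ?thesis
  proof eventually_elim
    case (elim x)
    define s where "s = (\<Sum>k. ennreal (4 ^ k * (d k x)\<^sup>2))"
    have "s \<noteq> \<infinity>" using elim by (simp only: s_def not_False_eq_True)
    then obtain B where "B \<ge> 0" "s = ennreal B" by (cases s) auto
    then have B: "B \<ge> 0" "(\<Sum>k. ennreal (4 ^ k * (d k x)\<^sup>2)) = ennreal B" by (simp_all only: s_def)
    have "\<bar>d k x\<bar> \<le> sqrt B * (1/2) ^ k" for k
    proof -
      have "ennreal (4 ^ k * (d k x)\<^sup>2) = (\<Sum>i\<in>{k}. ennreal (4 ^ i * (d i x)\<^sup>2))" by simp
      also have "\<dots> \<le> (\<Sum>k. ennreal (4 ^ k * (d k x)\<^sup>2))"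
        by (intro sum_le_suminf summableI) auto
      finally have "4 ^ k * (d k x)\<^sup>2 \<le> B" using B by simp
      then have "(d k x)\<^sup>2 \<le> B * (1/4) ^ k"
        by (simp add: power_one_over field_simps)
      also have "(1/4 :: real) ^ k = ((1/2) ^ k)\<^sup>2"
        by (simp add: power2_eq_square flip: power_mult_distrib)
      also have "B * ((1/2) ^ k)\<^sup>2 = (sqrt B * (1/2) ^ k)\<^sup>2"
        using B(1) by (simp only: power_mult_distrib real_sqrt_pow2)
      finally have "(\<bar>d k x\<bar>)\<^sup>2 \<le> (sqrt B * (1/2) ^ k)\<^sup>2" by simp
      then show ?thesis by (rule power2_le_imp_le) (use B(1) in simp)
    qed
    then show ?case by blast
  qed
qed

text \<open>Stated for an abstract pseudometric, because the norm distance of representatives is not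
  the \<open>dist\<close> of a metric type.\<close>

lemma geometric_increments_Cauchy:
  fixes D :: "nat \<Rightarrow> nat \<Rightarrow> real"
  assumes tri: "\<And>i j k. D i k \<le> D i j + D j k" and sym: "\<And>i j. D i j = D j i" and refl: "\<And>i. D i i = 0"
    and bound: "\<And>k. D k (Suc k) \<le> C * (1/2) ^ k" and e: "e > 0"
  shows "\<exists>N. \<forall>k\<ge>N. \<forall>l\<ge>N. D k l < e"
proof -
  \<comment> \<open>The right-hand side is the exact value of the geometric sum of the increments,
    which makes the induction close.\<close>
  have step: "D k (k + j) \<le> 2 * C * (1/2) ^ k - 2 * C * (1/2) ^ (k + j)" for k j
  proof (induction j)
    case 0
    then show ?case by (simp add: refl)
  next
    case (Suc j)
    have "D k (k + Suc j) \<le> D k (k + j) + D (k + j) (Suc (k + j))" using tri by simp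
    also have "\<dots> \<le> (2 * C * (1/2) ^ k - 2 * C * (1/2) ^ (k + j)) + C * (1/2) ^ (k + j)"
      using Suc bound by (intro add_mono)
    also have "\<dots> = 2 * C * (1/2) ^ k - 2 * C * (1/2) ^ (k + Suc j)" by simp
    finally show ?case .
  qed
  have "D 0 0 \<le> D 0 1 + D 1 0" by (rule tri)
  then have C: "C \<ge> 0" using bound[of 0] sym[of 0 1] refl[of 0] by simp
  have le: "D k l \<le> 2 * C * (1/2) ^ k" if "k \<le> l" for k l
    using step[of k "l - k"] C that by (simp add: le_diff_conv) (smt (verit) C mult_nonneg_nonneg zero_le_power zero_le_divide_1_iff)
  have "(\<lambda>k. 2 * C * (1/2) ^ k) \<longlonglongrightarrow> 2 * C * 0"
    by (intro tendsto_mult_left LIMSEQ_power_zero) simp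
  then have "\<forall>\<^sub>F k in sequentially. 2 * C * (1/2) ^ k < e"
    using e by (intro order_tendstoD(2)) auto
  then obtain N where N: "\<And>k. k \<ge> N \<Longrightarrow> 2 * C * (1/2) ^ k < e" by (auto simp: eventually_sequentially)
  show ?thesis
  proof (intro exI[of _ N] allI impI)
    fix k l assume kl: "N \<le> k" "N \<le> l"
    show "D k l < e"
    proof (cases "k \<le> l")
      case True
      from le[OF this] N[OF kl(1)] show ?thesis by simp
    next
      case False
      then have "l \<le> k" by simp
      from le[OF this] N[OF kl(2)] show ?thesis by (simp add: sym[of k l])
    qed
  qed
qed

section \<open>The Riesz-Fischer theorem along symmetric windows\<close>

lemma finite_int_subset_interval:
  fixes K :: "int set"
  assumes "finite K"
  obtains n :: nat where "K \<subseteq> {-int n..int n}"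
proof -
  define n where "n = nat (Max (insert 0 (abs ` K)))"
  have "K \<subseteq> {-int n..int n}"
  proof
    fix m assume "m \<in> K"
    then have "\<bar>m\<bar> \<le> Max (insert 0 (abs ` K))" using assms by (intro Max_ge) auto
    then show "m \<in> {-int n..int n}" by (auto simp: n_def)
  qed
  then show thesis by (rule that)
qed

lemma summable_int_exhaustion:
  fixes u :: "int \<Rightarrow> real"
  assumes nonneg: "\<And>m. u m \<ge> 0" and sum: "u summable_on UNIV"
  obtains N :: "nat \<Rightarrow> nat" where "mono N" "\<And>k. k \<le> N k"
    "\<And>k. infsum u UNIV - (\<Sum>m\<in>{-int (N k)..int (N k)}. u m) \<le> (1/16) ^ k"
proof -
  have "\<exists>n::nat. infsum u UNIV - (\<Sum>m\<in>{-int n..int n}. u m) \<le> (1/16) ^ k" for k :: nat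
  proof -
    have "(sum u \<longlongrightarrow> infsum u UNIV) (finite_subsets_at_top UNIV)"
      using has_sum_infsum[OF sum] by (simp add: has_sum_def)
    then have "\<forall>\<^sub>F K in finite_subsets_at_top UNIV. infsum u UNIV - (1/16) ^ k < sum u K"
      by (rule order_tendstoD(1)) simp
    then obtain K where K: "finite K" "\<And>L. finite L \<Longrightarrow> K \<subseteq> L \<Longrightarrow> infsum u UNIV - (1/16) ^ k < sum u L"
      by (auto simp: eventually_finite_subsets_at_top)
    obtain n :: nat where "K \<subseteq> {-int n..int n}" using finite_int_subset_interval[OF K(1)] .
    with K(2)[of "{-int n..int n}"] show ?thesis by (intro exI[of _ n]) auto
  qed
  then obtain n where n: "\<And>k. infsum u UNIV - (\<Sum>m\<in>{-int (n k)..int (n k)}. u m) \<le> (1/16) ^ k"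
    by metis
  \<comment> \<open>Summing the \<open>n i\<close> makes the sequence monotone while keeping it
    above \<open>n k\<close>; adding \<open>k\<close> makes it unbounded.\<close>
  define N where "N k = (\<Sum>i\<le>k. n i) + k" for k :: nat
  show thesis
  proof (rule that[of N])
    show "mono N" unfolding N_def mono_def by (auto intro!: add_mono sum_mono2)
    show "k \<le> N k" for k by (simp add: N_def)
    show "infsum u UNIV - (\<Sum>m\<in>{-int (N k)..int (N k)}. u m) \<le> (1/16) ^ k" for k
    proof -
      have "n k \<le> (\<Sum>i\<le>k. n i)" by (rule member_le_sum) auto
      then have "n k \<le> N k" by (simp add: N_def)
      then have "(\<Sum>m\<in>{-int (n k)..int (n k)}. u m) \<le> (\<Sum>m\<in>{-int (N k)..int (N k)}. u m)"
        by (intro sum_mono2) (auto simp: nonneg)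
      then show ?thesis using n[of k] by linarith
    qed
  qed
qed

lemma A2_mult: "f \<in> A2 S \<Longrightarrow> (\<lambda>z. c * f z) \<in> A2 S"
  by (auto simp: A2_def intro!: L2_mult analytic_on_mult analytic_on_const)

lemma A2_sum: "(\<And>i. i \<in> I \<Longrightarrow> f i \<in> A2 S) \<Longrightarrow> (\<lambda>z. \<Sum>i\<in>I. f i z) \<in> A2 S"
  by (auto simp: A2_def intro!: L2_sum analytic_on_sum)

lemma A2_zero: "(\<lambda>z. 0) \<in> A2 S"
  by (auto simp: A2_def)

lemma trig_sum_A2: "(\<And>m. p m \<in> A2 S) \<Longrightarrow> trig_sum p K \<eta> \<in> A2 S"
  unfolding trig_sum_def[abs_def] by (rule A2_mult[OF A2_sum[OF A2_mult]])

context floquet_cell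
begin

text \<open>Two modes of convergence are needed. The unordered limit in the Bochner norm is what
  \<open>floquet\<close> asks for, while the analytic argument needs convergence at individual
  \<open>\<eta>\<close>. The latter is available along a subsequence of windows whose tails decay
  like \<open>(1/16) ^ k\<close>.\<close>

lemma Riesz_Fischer:
  fixes p :: "int \<Rightarrow> complex \<Rightarrow> complex"
  assumes p: "\<And>m. p m \<in> A2 \<omega>" and sum: "(\<lambda>m. (L2_norm \<omega> (p m))\<^sup>2) summable_on UNIV"
  obtains N :: "nat \<Rightarrow> nat" and G where
    "\<And>k. k \<le> N k"
    "G \<in> bochner_L2 \<omega> (A2 \<omega>)"
    "AE \<eta> in \<T>. (\<lambda>k. L2_norm \<omega> (\<lambda>z. trig_sum p {-int (N k)..int (N k)} \<eta> z - G \<eta> z)) \<longlonglongrightarrow> 0"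
    "((\<lambda>K. bochner_norm \<omega> (\<lambda>\<eta> z. trig_sum p K \<eta> z - G \<eta> z)) \<longlongrightarrow> 0) (finite_subsets_at_top UNIV)"
proof -
  define u where "u m = (L2_norm \<omega> (p m))\<^sup>2" for m
  have u0: "u m \<ge> 0" for m by (simp add: u_def)
  have sumu: "u summable_on UNIV" using sum by (simp add: u_def[abs_def])
  have pL: "p m \<in> L2 \<omega>" for m using p by (simp add: A2_def)
  obtain N where N: "mono N" "\<And>k. k \<le> N k" "\<And>k. infsum u UNIV - (\<Sum>m\<in>{-int (N k)..int (N k)}. u m) \<le> (1/16) ^ k"
    using summable_int_exhaustion[OF u0 sumu] by metis
  define J where "J k = {-int (N k)..int (N k)}" for k
  have finJ: "finite (J k)" for k by (simp add: J_def)
  have Jmono: "J k \<subseteq> J l" if "k \<le> l" for k l using monoD[OF N(1) that] by (auto simp: J_def)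
  have ule: "(\<Sum>m\<in>K. u m) \<le> infsum u UNIV" if "finite K" for K
    by (rule finite_sum_le_infsum[OF sumu that]) (use u0 in auto)
  define S where "S k \<eta> = trig_sum p (J k) \<eta>" for k \<eta>
  have SA: "S k \<eta> \<in> A2 \<omega>" for k \<eta> unfolding S_def by (rule trig_sum_A2) (rule p)
  have SL: "S k \<eta> \<in> L2 \<omega>" for k \<eta> using SA by (simp add: A2_def)
  have TL: "trig_sum p K \<eta> \<in> L2 \<omega>" for K \<eta> by (rule trig_sum_L2) (rule pL)
  have diff_meas: "(\<lambda>\<eta>. L2_norm \<omega> (\<lambda>z. trig_sum p K \<eta> z - trig_sum p L \<eta> z)) \<in> borel_measurable \<T>"
    if "finite K" "finite L" for K L
    by (rule bochner_L2_memD(4)[OF bochner_L2_diff]) (intro trig_sum_bochner_L2 pL that)+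
  have diff_nn: "(\<integral>\<^sup>+\<eta>. ennreal ((L2_norm \<omega> (\<lambda>z. trig_sum p K \<eta> z - trig_sum p L \<eta> z))\<^sup>2) \<partial>\<T>)
     = ennreal ((\<Sum>m\<in>K. u m) - (\<Sum>m\<in>L. u m))" if "finite K" "L \<subseteq> K" for K L
  proof -
    have "(\<integral>\<^sup>+\<eta>. ennreal ((L2_norm \<omega> (\<lambda>z. trig_sum p K \<eta> z - trig_sum p L \<eta> z))\<^sup>2) \<partial>\<T>)
      = (\<integral>\<^sup>+\<eta>. ennreal ((L2_norm \<omega> (trig_sum p (K - L) \<eta>))\<^sup>2) \<partial>\<T>)"
      by (simp add: trig_sum_diff[OF that])
    also have "\<dots> = ennreal (\<integral>\<eta>. (L2_norm \<omega> (trig_sum p (K - L) \<eta>))\<^sup>2 \<partial>\<T>)"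
      using that by (intro nn_integral_eq_integral trig_sum_Parseval pL) auto
    also have "\<dots> = ennreal (\<Sum>m\<in>K - L. u m)"
      unfolding u_def using that by (subst trig_sum_Parseval(2)) (auto intro: pL)
    finally show ?thesis using that by (simp add: sum_diff finite_subset)
  qed
  have AEC: "AE \<eta> in \<T>. \<exists>C. \<forall>k. \<bar>L2_norm \<omega> (\<lambda>z. S (Suc k) \<eta> z - S k \<eta> z)\<bar> \<le> C * (1/2) ^ k"
  proof (rule AE_geometric_bound)
    show "(\<lambda>\<eta>. L2_norm \<omega> (\<lambda>z. S (Suc k) \<eta> z - S k \<eta> z)) \<in> borel_measurable \<T>" for k
      unfolding S_def by (intro diff_meas finJ)
    show "(\<integral>\<^sup>+\<eta>. ennreal ((L2_norm \<omega> (\<lambda>z. S (Suc k) \<eta> z - S k \<eta> z))\<^sup>2) \<partial>\<T>) \<le> ennreal ((1/16) ^ k)" for k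
    proof -
      have "(\<integral>\<^sup>+\<eta>. ennreal ((L2_norm \<omega> (\<lambda>z. S (Suc k) \<eta> z - S k \<eta> z))\<^sup>2) \<partial>\<T>)
        = ennreal ((\<Sum>m\<in>J (Suc k). u m) - (\<Sum>m\<in>J k. u m))"
        unfolding S_def by (intro diff_nn finJ Jmono) simp
      also have "\<dots> \<le> ennreal ((1/16) ^ k)"
        using ule[OF finJ, of "Suc k"] N(3)[of k] by (intro ennreal_leI) (simp add: J_def)
      finally show ?thesis .
    qed
  qed
  have AElim: "AE \<eta> in \<T>. \<exists>g\<in>A2 \<omega>. (\<lambda>k. L2_norm \<omega> (\<lambda>z. S k \<eta> z - g z)) \<longlonglongrightarrow> 0"
    using AEC
  proof eventually_elim
    case (elim \<eta>)
    then obtain C where C: "\<And>k. \<bar>L2_norm \<omega> (\<lambda>z. S (Suc k) \<eta> z - S k \<eta> z)\<bar> \<le> C * (1/2) ^ k" by blast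
    have Cau: "\<exists>N. \<forall>k\<ge>N. \<forall>l\<ge>N. L2_norm \<omega> (\<lambda>z. S k \<eta> z - S l \<eta> z) < e" if "e > 0" for e
    proof (rule geometric_increments_Cauchy[where D = "\<lambda>k l. L2_norm \<omega> (\<lambda>z. S k \<eta> z - S l \<eta> z)" and C = C])
      show "L2_norm \<omega> (\<lambda>z. S i \<eta> z - S k \<eta> z) \<le> L2_norm \<omega> (\<lambda>z. S i \<eta> z - S j \<eta> z) + L2_norm \<omega> (\<lambda>z. S j \<eta> z - S k \<eta> z)" for i j k
        by (rule L2_norm_triangle_diff[OF SL SL SL])
      show "L2_norm \<omega> (\<lambda>z. S k \<eta> z - S (Suc k) \<eta> z) \<le> C * (1/2) ^ k" for k
        using C[of k] by (subst L2_norm_minus_commute) simp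
    qed (rule L2_norm_minus_commute, simp, rule that)
    show ?case
    proof (rule Cauchy_A2_cell[of "\<lambda>k. S k \<eta>"])
      show "S k \<eta> \<in> A2 \<omega>" for k by (rule SA)
      fix g assume "g \<in> A2 \<omega>" "(\<lambda>k. L2_norm \<omega> (\<lambda>z. S k \<eta> z - g z)) \<longlonglongrightarrow> 0"
      then show ?thesis by blast
    qed (rule Cau)
  qed
  define P where "P \<eta> g \<longleftrightarrow> g \<in> A2 \<omega> \<and> (\<lambda>k. L2_norm \<omega> (\<lambda>z. S k \<eta> z - g z)) \<longlonglongrightarrow> 0" for \<eta> g
  \<comment> \<open>On the exceptional null set the value is 0, because \<open>bochner_L2\<close>
    requires \<open>G \<eta>\<close> to lie in the space for every \<open>\<eta>\<close>.\<close>
  define G where "G \<eta> = (if \<exists>g. P \<eta> g then SOME g. P \<eta> g else (\<lambda>z. 0))" for \<eta>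
  have GA: "G \<eta> \<in> A2 \<omega>" for \<eta>
    using someI_ex[of "P \<eta>"] A2_zero by (auto simp: G_def P_def)
  have GL: "G \<eta> \<in> L2 \<omega>" for \<eta> using GA by (simp add: A2_def)
  have Glim: "AE \<eta> in \<T>. (\<lambda>k. L2_norm \<omega> (\<lambda>z. S k \<eta> z - G \<eta> z)) \<longlonglongrightarrow> 0"
    using AElim
  proof eventually_elim
    case (elim \<eta>)
    then have ex: "\<exists>g. P \<eta> g" by (auto simp: P_def)
    have "P \<eta> (G \<eta>)" using someI_ex[OF ex] by (simp add: G_def ex)
    then show ?case by (simp add: P_def)
  qed
  \<comment> \<open>The Lipschitz constant of the \<open>k\<close>-th partial sum grows with
    \<open>k\<close>; the grid is refined accordingly so that the rounding error still tends to
    zero.\<close>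
  have "\<exists>n. (\<Sum>m\<in>J k. \<bar>real_of_int m\<bar> * L2_norm \<omega> (p m)) / real (Suc n) \<le> 1 / real (Suc k)" for k
  proof -
    define C where "C = (\<Sum>m\<in>J k. \<bar>real_of_int m\<bar> * L2_norm \<omega> (p m))"
    obtain n :: nat where "C * real (Suc k) \<le> real n" using real_arch_simple by blast
    then have "C * real (Suc k) \<le> 1 * real (Suc n)" by simp
    then have "C / real (Suc n) \<le> 1 / real (Suc k)" by (subst frac_le_eq) (simp_all add: divide_le_0_iff del: of_nat_Suc)
    then show ?thesis unfolding C_def by blast
  qed
  then obtain n where n: "\<And>k. (\<Sum>m\<in>J k. \<bar>real_of_int m\<bar> * L2_norm \<omega> (p m)) / real (Suc (n k)) \<le> 1 / real (Suc k)"
    by metis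
  define T where "T k \<eta> = S k (grid (n k) \<eta>)" for k \<eta>
  have TS: "L2_norm \<omega> (\<lambda>z. T k \<eta> z - S k \<eta> z) \<le> 1 / real (Suc k)" for k \<eta>
    unfolding T_def S_def by (rule order_trans[OF L2_norm_trig_sum_grid[OF pL] n])
  have "AE \<eta> in \<T>. (\<lambda>k. L2_norm \<omega> (\<lambda>z. T k \<eta> z - G \<eta> z)) \<longlonglongrightarrow> 0"
    using Glim
  proof eventually_elim
    case (elim \<eta>)
    have le: "L2_norm \<omega> (\<lambda>z. T k \<eta> z - G \<eta> z) \<le> inverse (real (Suc k)) + L2_norm \<omega> (\<lambda>z. S k \<eta> z - G \<eta> z)" for k
      using L2_norm_triangle_diff[of "T k \<eta>" \<omega> "S k \<eta>" "G \<eta>"] TS[of k \<eta>] SL GL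
      by (simp add: T_def inverse_eq_divide del: of_nat_Suc)
    have lim: "(\<lambda>k. inverse (real (Suc k)) + L2_norm \<omega> (\<lambda>z. S k \<eta> z - G \<eta> z)) \<longlonglongrightarrow> 0"
      using tendsto_add[OF LIMSEQ_inverse_real_of_nat elim] by simp
    show ?case by (rule Lim_null_comparison[OF always_eventually lim]) (use le in simp)
  qed
  moreover have "simple_function \<T> (T k)" for k
    unfolding T_def by (rule simple_function_grid)
  ultimately have smG: "strongly_measurable \<omega> (A2 \<omega>) G"
    unfolding strongly_measurable_def using SA by (intro exI[of _ T]) (simp add: T_def)
  have smGL: "strongly_measurable \<omega> (L2 \<omega>) G"
    using smG unfolding strongly_measurable_def A2_def by blast
  \<comment> \<open>Fatou's lemma along the subsequence: eventually the window contains
    \<open>K\<close>, and the distance to the partial sum over \<open>K\<close> is then part of the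
    tail of the series.\<close>
  have bound: "(\<integral>\<^sup>+\<eta>. ennreal ((L2_norm \<omega> (\<lambda>z. trig_sum p K \<eta> z - G \<eta> z))\<^sup>2) \<partial>\<T>)
     \<le> ennreal (infsum u UNIV - (\<Sum>m\<in>K. u m))" if K: "finite K" for K
  proof -
    define w where "w k \<eta> = ennreal ((L2_norm \<omega> (\<lambda>z. trig_sum p K \<eta> z - S k \<eta> z))\<^sup>2)" for k \<eta>
    have "(\<integral>\<^sup>+\<eta>. ennreal ((L2_norm \<omega> (\<lambda>z. trig_sum p K \<eta> z - G \<eta> z))\<^sup>2) \<partial>\<T>)
      = (\<integral>\<^sup>+\<eta>. liminf (\<lambda>k. w k \<eta>) \<partial>\<T>)"
    proof (rule nn_integral_cong_AE)
      show "AE \<eta> in \<T>. ennreal ((L2_norm \<omega> (\<lambda>z. trig_sum p K \<eta> z - G \<eta> z))\<^sup>2) = liminf (\<lambda>k. w k \<eta>)"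
        using Glim
      proof eventually_elim
        case (elim \<eta>)
        have le: "norm (L2_norm \<omega> (\<lambda>z. trig_sum p K \<eta> z - S k \<eta> z) - L2_norm \<omega> (\<lambda>z. trig_sum p K \<eta> z - G \<eta> z))
          \<le> L2_norm \<omega> (\<lambda>z. S k \<eta> z - G \<eta> z)" for k
          using L2_norm_diff_le[OF L2_diff[OF TL SL] L2_diff[OF TL GL], of K \<eta> k \<eta> K \<eta> \<eta>]
            L2_norm_minus_commute[of \<omega> "S k \<eta>" "G \<eta>"] by simp
        have "(\<lambda>k. L2_norm \<omega> (\<lambda>z. trig_sum p K \<eta> z - S k \<eta> z) - L2_norm \<omega> (\<lambda>z. trig_sum p K \<eta> z - G \<eta> z)) \<longlonglongrightarrow> 0"
          by (rule Lim_null_comparison[OF always_eventually elim]) (use le in simp)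
        then have "(\<lambda>k. L2_norm \<omega> (\<lambda>z. trig_sum p K \<eta> z - S k \<eta> z)) \<longlonglongrightarrow> L2_norm \<omega> (\<lambda>z. trig_sum p K \<eta> z - G \<eta> z)"
          by (simp add: LIM_zero_iff)
        then have "(\<lambda>k. w k \<eta>) \<longlonglongrightarrow> ennreal ((L2_norm \<omega> (\<lambda>z. trig_sum p K \<eta> z - G \<eta> z))\<^sup>2)"
          unfolding w_def by (intro tendsto_ennrealI tendsto_power)
        then show ?case by (simp add: lim_imp_Liminf)
      qed
    qed
    also have "\<dots> \<le> liminf (\<lambda>k. \<integral>\<^sup>+\<eta>. w k \<eta> \<partial>\<T>)"
    proof (rule nn_integral_liminf)
      show "w k \<in> borel_measurable \<T>" for k
        unfolding w_def S_def using diff_meas[OF K finJ] by measurable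
    qed
    also have "\<dots> \<le> ennreal (infsum u UNIV - (\<Sum>m\<in>K. u m))"
    proof (rule Liminf_le)
      obtain k0 :: nat where k0: "K \<subseteq> {-int k0..int k0}" using finite_int_subset_interval[OF K] .
      show "\<forall>\<^sub>F k in sequentially. (\<integral>\<^sup>+\<eta>. w k \<eta> \<partial>\<T>) \<le> ennreal (infsum u UNIV - (\<Sum>m\<in>K. u m))"
        unfolding eventually_sequentially
      proof (intro exI[of _ k0] allI impI)
        fix k assume "k0 \<le> k"
        then have "int k0 \<le> int (N k)" using N(2)[of k] by linarith
        then have KJ: "K \<subseteq> J k" using k0 by (auto simp: J_def)
        have "(\<integral>\<^sup>+\<eta>. w k \<eta> \<partial>\<T>) = (\<integral>\<^sup>+\<eta>. ennreal ((L2_norm \<omega> (\<lambda>z. S k \<eta> z - trig_sum p K \<eta> z))\<^sup>2) \<partial>\<T>)"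
          unfolding w_def by (intro nn_integral_cong arg_cong[of _ _ ennreal] arg_cong[of _ _ "\<lambda>x. x\<^sup>2"] L2_norm_minus_commute)
        also have "\<dots> = ennreal ((\<Sum>m\<in>J k. u m) - (\<Sum>m\<in>K. u m))"
          unfolding S_def by (rule diff_nn[OF finJ KJ])
        also have "\<dots> \<le> ennreal (infsum u UNIV - (\<Sum>m\<in>K. u m))"
          using ule[OF finJ, of k] by (intro ennreal_leI) simp
        finally show "(\<integral>\<^sup>+\<eta>. w k \<eta> \<partial>\<T>) \<le> ennreal (infsum u UNIV - (\<Sum>m\<in>K. u m))" .
      qed
    qed simp
    finally show ?thesis .
  qed
  have Gmeas: "(\<lambda>\<eta>. L2_norm \<omega> (G \<eta>)) \<in> borel_measurable \<T>"
    by (rule strongly_measurable_L2_norm[OF smGL order_refl GL])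
  have "(\<integral>\<^sup>+\<eta>. ennreal ((L2_norm \<omega> (G \<eta>))\<^sup>2) \<partial>\<T>) \<le> ennreal (infsum u UNIV)"
    using bound[of "{}"] L2_norm_minus_commute[of \<omega> "\<lambda>z. 0"] by (simp add: trig_sum_def)
  also have "\<dots> < \<infinity>" by simp
  \<comment> \<open>The error bound for the empty partial sum is a bound for the norm of
    \<open>G\<close> itself.\<close>
  finally have Gint: "integrable \<T> (\<lambda>\<eta>. (L2_norm \<omega> (G \<eta>))\<^sup>2)"
    using Gmeas by (simp add: integrable_iff_bounded)
  have GbA: "G \<in> bochner_L2 \<omega> (A2 \<omega>)" using GA smG Gint by (simp add: bochner_L2_def)
  have GbL: "G \<in> bochner_L2 \<omega> (L2 \<omega>)" using GL smGL Gint by (simp add: bochner_L2_def)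
  have bn: "(bochner_norm \<omega> (\<lambda>\<eta> z. trig_sum p K \<eta> z - G \<eta> z))\<^sup>2 \<le> infsum u UNIV - (\<Sum>m\<in>K. u m)" if K: "finite K" for K
  proof -
    have "(\<lambda>\<eta> z. trig_sum p K \<eta> z - G \<eta> z) \<in> bochner_L2 \<omega> (L2 \<omega>)"
      by (rule bochner_L2_diff[OF trig_sum_bochner_L2[OF pL K] GbL])
    from bochner_L2_memD(3)[OF this]
    have "ennreal ((bochner_norm \<omega> (\<lambda>\<eta> z. trig_sum p K \<eta> z - G \<eta> z))\<^sup>2) =
      (\<integral>\<^sup>+\<eta>. ennreal ((L2_norm \<omega> (\<lambda>z. trig_sum p K \<eta> z - G \<eta> z))\<^sup>2) \<partial>\<T>)"
      unfolding bochner_norm_square by (subst nn_integral_eq_integral) auto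
    also have "\<dots> \<le> ennreal (infsum u UNIV - (\<Sum>m\<in>K. u m))" by (rule bound[OF K])
    finally show ?thesis using ule[OF K] by (subst (asm) ennreal_le_iff) auto
  qed
  have "((\<lambda>K. bochner_norm \<omega> (\<lambda>\<eta> z. trig_sum p K \<eta> z - G \<eta> z)) \<longlongrightarrow> 0) (finite_subsets_at_top UNIV)"
  proof (rule Lim_null_comparison)
    have "(sum u \<longlongrightarrow> infsum u UNIV) (finite_subsets_at_top UNIV)"
      using has_sum_infsum[OF sumu] by (simp add: has_sum_def)
    from tendsto_real_sqrt[OF tendsto_diff[OF tendsto_const this, of "infsum u UNIV"]]
    show "((\<lambda>K. sqrt (infsum u UNIV - sum u K)) \<longlongrightarrow> 0) (finite_subsets_at_top UNIV)" by simp
    show "\<forall>\<^sub>F K in finite_subsets_at_top UNIV. norm (bochner_norm \<omega> (\<lambda>\<eta> z. trig_sum p K \<eta> z - G \<eta> z)) \<le> sqrt (infsum u UNIV - sum u K)"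
      using eventually_finite_subsets_at_top_weakI[of UNIV "\<lambda>K. norm (bochner_norm \<omega> (\<lambda>\<eta> z. trig_sum p K \<eta> z - G \<eta> z)) \<le> sqrt (infsum u UNIV - sum u K)"]
        bn by (auto intro: real_le_rsqrt)
  qed
  then show thesis using N(2) GbA Glim unfolding S_def J_def by (intro that) auto
qed

end

section \<open>The Floquet transform\<close>

lemma bochner_norm_cong:
  assumes "\<And>\<eta> z. z \<in> S \<Longrightarrow> F \<eta> z = G \<eta> z"
  shows "bochner_norm S F = bochner_norm S G"
proof -
  have "L2_norm S (F \<eta>) = L2_norm S (G \<eta>)" for \<eta> by (rule L2_cong(2)) (rule assms)
  then show ?thesis by (simp add: bochner_norm_def)
qed

lemma summable_on_finite_large:
  fixes u :: "'a \<Rightarrow> real"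
  assumes nonneg: "\<And>m. u m \<ge> 0" and sum: "u summable_on UNIV" and e: "e > 0"
  obtains K where "finite K" "\<And>m. m \<notin> K \<Longrightarrow> u m < e"
proof -
  have "(sum u \<longlongrightarrow> infsum u UNIV) (finite_subsets_at_top UNIV)"
    using has_sum_infsum[OF sum] by (simp add: has_sum_def)
  then have "\<forall>\<^sub>F K in finite_subsets_at_top UNIV. infsum u UNIV - e < sum u K"
    by (rule order_tendstoD(1)) (use e in simp)
  then obtain K where K: "finite K" "infsum u UNIV - e < sum u K"
    by (auto simp: eventually_finite_subsets_at_top)
  have "u m < e" if "m \<notin> K" for m
  proof -
    have "sum u (insert m K) \<le> infsum u UNIV"
      by (rule finite_sum_le_infsum[OF sum]) (use nonneg K in auto)
    then show ?thesis using that K by simp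
  qed
  with K(1) show thesis by (rule that)
qed

text \<open>The window and its shift by \<open>j\<close> differ only in indices within
  \<open>\<bar>j\<bar>\<close> of the end points, where the coefficients are already small. The
  bound depends on \<open>j\<close> but not on the length of the window.\<close>

lemma trig_sum_shift_le:
  assumes p: "\<And>m. p m \<in> L2 S" and N: "N0 + nat \<bar>j\<bar> \<le> N" and small: "\<And>m. \<bar>m\<bar> \<ge> int N0 \<Longrightarrow> L2_norm S (p m) \<le> e"
    and e: "e \<ge> 0"
  shows "L2_norm S (\<lambda>z. trig_sum p ((\<lambda>m. m + j) ` {-int N..int N}) \<eta> z - trig_sum p {-int N..int N} \<eta> z)
    \<le> e * (8 * real_of_int \<bar>j\<bar> + 4)"
proof -
  define J where "J = {-int N..int N}"
  define J' where "J' = (\<lambda>m. m + j) ` J"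
  \<comment> \<open>Two intervals of \<open>2 * \<bar>j\<bar> + 1\<close> integers each. Both
    one-sided differences of the windows lie in \<open>B\<close>, whence the constant
    \<open>8 * \<bar>j\<bar> + 4\<close>.\<close>
  define B where "B = {int N - \<bar>j\<bar>..int N + \<bar>j\<bar>} \<union> {-int N - \<bar>j\<bar>..-int N + \<bar>j\<bar>}"
  have J': "m \<in> J' \<longleftrightarrow> - int N + j \<le> m \<and> m \<le> int N + j" for m
    unfolding J'_def J_def by (auto simp: image_iff intro!: bexI[of _ "m - j"])
  have B: "J' - J \<subseteq> B" "J - J' \<subseteq> B" by (auto simp: J' J_def B_def)
  have finB: "finite B" by (simp add: B_def)
  have "card B \<le> card {int N - \<bar>j\<bar>..int N + \<bar>j\<bar>} + card {-int N - \<bar>j\<bar>..-int N + \<bar>j\<bar>}"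
    unfolding B_def by (rule card_Un_le)
  also have "\<dots> = nat (4 * \<bar>j\<bar> + 2)" by simp
  finally have cardB: "real (card B) \<le> 4 * real_of_int \<bar>j\<bar> + 2" by linarith
  have leB: "(\<Sum>m\<in>D. L2_norm S (p m)) \<le> e * (4 * real_of_int \<bar>j\<bar> + 2)" if "D \<subseteq> B" for D
  proof -
    have "L2_norm S (p m) \<le> e" if "m \<in> B" for m
      using that N by (intro small) (auto simp: B_def)
    then have "(\<Sum>m\<in>D. L2_norm S (p m)) \<le> (\<Sum>m\<in>D. e)" using that by (intro sum_mono) auto
    also have "\<dots> \<le> real (card B) * e"
      using card_mono[OF finB that] e by (simp add: mult_right_mono)
    also have "\<dots> \<le> (4 * real_of_int \<bar>j\<bar> + 2) * e" by (rule mult_right_mono[OF cardB e])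
    finally show ?thesis by (simp add: mult.commute)
  qed
  have fin: "finite J" "finite J'" by (simp_all add: J_def J'_def)
  have pL: "trig_sum p D \<eta> \<in> L2 S" for D by (rule trig_sum_L2) (rule p)
  have "trig_sum p J' \<eta> z - trig_sum p J \<eta> z = trig_sum p (J' - J) \<eta> z - trig_sum p (J - J') \<eta> z" for z
  proof -
    have "trig_sum p J' \<eta> z - trig_sum p (J \<inter> J') \<eta> z = trig_sum p (J' - J) \<eta> z"
      using trig_sum_diff[OF fin(2), of "J \<inter> J'" p \<eta> z] by (simp add: Diff_Int)
    moreover have "trig_sum p J \<eta> z - trig_sum p (J \<inter> J') \<eta> z = trig_sum p (J - J') \<eta> z"
      using trig_sum_diff[OF fin(1), of "J \<inter> J'" p \<eta> z] by (simp add: Diff_Int)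
    ultimately show ?thesis by (simp add: algebra_simps)
  qed
  then have "L2_norm S (\<lambda>z. trig_sum p J' \<eta> z - trig_sum p J \<eta> z) = L2_norm S (\<lambda>z. trig_sum p (J' - J) \<eta> z - trig_sum p (J - J') \<eta> z)"
    by simp
  also have "\<dots> \<le> L2_norm S (trig_sum p (J' - J) \<eta>) + L2_norm S (trig_sum p (J - J') \<eta>)"
    using L2_norm_triangle_diff[OF pL L2_zero pL, of "J' - J" "J - J'"] L2_norm_minus_commute[of S "\<lambda>z. 0"] by simp
  also have "\<dots> \<le> e * (4 * real_of_int \<bar>j\<bar> + 2) + e * (4 * real_of_int \<bar>j\<bar> + 2)"
    by (intro add_mono order_trans[OF L2_norm_trig_sum_le leB] p B)
  finally show ?thesis by (simp add: J_def J'_def algebra_simps)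
qed

lemma A2_lincomb: "f \<in> A2 S \<Longrightarrow> g \<in> A2 S \<Longrightarrow> (\<lambda>z. c * f z + d * g z) \<in> A2 S"
  by (auto simp: A2_def intro!: L2_add L2_mult analytic_on_mult analytic_on_add analytic_on_const)

context floquet_cell
begin

section \<open>Existence, isometry and uniqueness of the transform\<close>

lemma floquet_sum_bochner_L2:
  assumes "f \<in> A2 \<Omega>" "finite K"
  shows "floquet_sum f K \<in> bochner_L2 \<omega> (L2 \<omega>)"
proof -
  have "floquet_sum f K = trig_sum (\<lambda>m z. f (z + of_int m)) K"
    by (simp add: fun_eq_iff floquet_sum_eq_trig_sum)
  then show ?thesis
    using trig_sum_bochner_L2[of "\<lambda>m z. f (z + of_int m)" \<omega> K] A2_Omega_shift(1)[OF assms(1)] assms(2) by simp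
qed

lemma bochner_norm_floquet_sum:
  assumes "f \<in> A2 \<Omega>" "finite K"
  shows "(bochner_norm \<omega> (floquet_sum f K))\<^sup>2 = (\<Sum>m\<in>K. (L2_norm \<omega> (\<lambda>z. f (z + of_int m)))\<^sup>2)"
proof -
  have "floquet_sum f K = trig_sum (\<lambda>m z. f (z + of_int m)) K"
    by (simp add: fun_eq_iff floquet_sum_eq_trig_sum)
  then show ?thesis
    using bochner_norm_trig_sum[of "\<lambda>m z. f (z + of_int m)" \<omega> K] A2_Omega_shift(1)[OF assms(1)] assms(2) by simp
qed

lemma holomorphic_on_Omega_shift:
  assumes "f holomorphic_on \<Omega>"
  shows "(\<lambda>z. f (z + of_int m)) holomorphic_on \<Omega>"
proof -
  have "(\<lambda>z. z + of_int m) holomorphic_on \<Omega>" by (intro holomorphic_intros)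
  moreover have "(\<lambda>z. z + of_int m) ` \<Omega> \<subseteq> \<Omega>" by auto
  ultimately show ?thesis using holomorphic_on_compose_gen[OF _ assms] by (simp add: o_def)
qed

lemma A2_cell_piece:
  assumes f: "f \<in> A2 \<Omega>"
  shows "(\<lambda>z. if z \<in> \<omega> then f (z + of_int m) else 0) \<in> A2 \<omega>"
proof -
  have "(\<lambda>z. if z \<in> \<omega> then f (z + of_int m) else 0) holomorphic_on \<omega>"
    using holomorphic_on_cell_shift[OF A2_holomorphic[OF f open_Omega], of m] by (simp cong: holomorphic_cong)
  moreover have "(\<lambda>z. if z \<in> \<omega> then f (z + of_int m) else 0) \<in> L2 \<omega>"
    using A2_Omega_shift(1)[OF f, of m] by (subst L2_cong(1)[of \<omega> _ "\<lambda>z. f (z + of_int m)"]) auto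
  ultimately show ?thesis using open_cell by (simp add: A2_def analytic_on_open)
qed

text \<open>The partial sums are analytic on all of \<open>\<Omega>\<close>. On the translate by
  \<open>j\<close> such a sum is the multiplier times the sum over a shifted window, and the two
  windows give the same limit, so the partial sums converge on every translate to the expected
  multiple of \<open>G \<eta>\<close>.\<close>

lemma floquet_A2_exists:
  assumes f: "f \<in> A2 \<Omega>"
  obtains G where "G \<in> L2_A2_eta a b \<omega>" "G \<in> floquet \<omega> f"
proof -
  define p where "p m z = (if z \<in> \<omega> then f (z + of_int m) else 0)" for m :: int and z
  have p: "p m \<in> A2 \<omega>" for m unfolding p_def by (rule A2_cell_piece[OF f])
  have pL: "p m \<in> L2 \<omega>" for m using p by (simp add: A2_def)
  have pn: "L2_norm \<omega> (p m) = L2_norm \<omega> (\<lambda>z. f (z + of_int m))" for m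
    by (rule L2_cong(2)) (simp add: p_def)
  have sum: "(\<lambda>m. (L2_norm \<omega> (p m))\<^sup>2) summable_on UNIV"
    using A2_Omega_shift(2)[OF f] by (auto simp: pn summable_on_def)
  have eq: "trig_sum p K \<eta> z = floquet_sum f K \<eta> z" if "z \<in> \<omega>" for K \<eta> z
    using that by (simp add: trig_sum_def floquet_sum_def p_def)
  have fhol: "f holomorphic_on \<Omega>" by (rule A2_holomorphic[OF f open_Omega])
  show thesis
  proof (rule Riesz_Fischer[OF p sum])
    fix N :: "nat \<Rightarrow> nat" and G
    assume N: "\<And>k. k \<le> N k" and G: "G \<in> bochner_L2 \<omega> (A2 \<omega>)"
      and AEG: "AE \<eta> in \<T>. (\<lambda>k. L2_norm \<omega> (\<lambda>z. trig_sum p {-int (N k)..int (N k)} \<eta> z - G \<eta> z)) \<longlonglongrightarrow> 0"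
      and lim: "((\<lambda>K. bochner_norm \<omega> (\<lambda>\<eta> z. trig_sum p K \<eta> z - G \<eta> z)) \<longlongrightarrow> 0) (finite_subsets_at_top UNIV)"
    have GbL: "G \<in> bochner_L2 \<omega> (L2 \<omega>)"
      using G unfolding bochner_L2_def strongly_measurable_def A2_def by blast
    have "bochner_norm \<omega> (\<lambda>\<eta> z. trig_sum p K \<eta> z - G \<eta> z) = bochner_norm \<omega> (\<lambda>\<eta> z. floquet_sum f K \<eta> z - G \<eta> z)" for K
      by (rule bochner_norm_cong) (simp add: eq)
    then have Gfl: "G \<in> floquet \<omega> f" using GbL lim by (simp add: floquet_def)
    have "AE \<eta> in \<T>. G \<eta> \<in> A2_eta a b \<omega> \<eta>"
      using AEG AE_space
    proof eventually_elim
      case (elim \<eta>)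
      have GA: "G \<eta> \<in> A2 \<omega>" using G elim(2) by (simp add: bochner_L2_def)
      have GL: "G \<eta> \<in> L2 \<omega>" using GA by (simp add: A2_def)
      define h where "h k z = floquet_sum f {-int (N k)..int (N k)} \<eta> z" for k z
      define E where "E m = exp (\<i> * of_real \<eta> * of_int m)" for m :: int
      have nE: "norm (E m) = 1" for m by (simp add: E_def norm_exp_eq_Re)
      \<comment> \<open>Reindexing by \<open>m + j\<close> uncovers the multiplier
        \<open>E j\<close>; what remains is the sum over the shifted window, evaluated in the
        cell.\<close>
      have hE: "h k (z + of_int j) = E j * trig_sum p ((\<lambda>m. m + j) ` {-int (N k)..int (N k)}) \<eta> z" if z: "z \<in> \<omega>" for k j z
      proof -
        have "trig_sum p ((\<lambda>m. m + j) ` {-int (N k)..int (N k)}) \<eta> z =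
          1 / of_real (sqrt (2 * pi)) * (\<Sum>m\<in>{-int (N k)..int (N k)}. exp (- \<i> * of_real \<eta> * of_int (m + j)) * f (z + of_int (m + j)))"
        proof -
          have inj: "inj_on (\<lambda>m. m + j) {-int (N k)..int (N k)}" by (simp add: inj_on_def)
          show ?thesis unfolding trig_sum_def sum.reindex[OF inj] using z by (simp add: p_def)
        qed
        moreover have "E j * (exp (- \<i> * of_real \<eta> * of_int (m + j)) * x) = exp (- \<i> * of_real \<eta> * of_int m) * x" for m x
        proof -
          have "E j * exp (- \<i> * of_real \<eta> * of_int (m + j)) = exp (- \<i> * of_real \<eta> * of_int m)"
            unfolding E_def exp_add[symmetric] by (simp add: algebra_simps)
          then show ?thesis by (simp only: mult.assoc[symmetric])
        qed
        moreover have "E j * (c * (\<Sum>m\<in>K. g m)) = c * (\<Sum>m\<in>K. E j * g m)" for c :: complex and g and K :: "int set"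
          unfolding sum_distrib_left[symmetric] by (rule mult.left_commute)
        ultimately have "E j * trig_sum p ((\<lambda>m. m + j) ` {-int (N k)..int (N k)}) \<eta> z =
          1 / of_real (sqrt (2 * pi)) * (\<Sum>m\<in>{-int (N k)..int (N k)}. exp (- \<i> * of_real \<eta> * of_int m) * f (z + of_int (m + j)))"
          by (simp only:)
        then show ?thesis by (simp add: h_def floquet_sum_def add_ac)
      qed
      have "\<exists>H. quasi_ext \<eta> (G \<eta>) H"
      proof (rule quasi_ext_limit[OF _ _ GA])
        show "h k holomorphic_on \<Omega>" for k
          unfolding h_def[abs_def] floquet_sum_def
          by (intro holomorphic_on_mult holomorphic_on_const holomorphic_on_sum holomorphic_on_Omega_shift fhol)
        show "(\<lambda>z. h k (z + of_int j)) \<in> L2 \<omega>" for k j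
          using L2_cong(1)[of \<omega>, OF hE] L2_mult[OF trig_sum_L2[of p, OF pL]] by simp
        fix j :: int
        have "(\<lambda>k. L2_norm \<omega> (\<lambda>z. trig_sum p ((\<lambda>m. m + j) ` {-int (N k)..int (N k)}) \<eta> z - trig_sum p {-int (N k)..int (N k)} \<eta> z)) \<longlonglongrightarrow> 0"
        proof (rule LIMSEQ_I)
          fix r :: real assume r: "r > 0"
          define c where "c = 8 * real_of_int \<bar>j\<bar> + 4"
          have c: "c > 0" by (simp add: c_def)
          \<comment> \<open>The factor 2 in the denominator makes the resulting bound strictly
            smaller than \<open>r\<close>.\<close>
          define e where "e = r / (2 * c)"
          have "e * c = r / 2" using c by (simp add: e_def)
          then have "e * c < r" using r by simp
          moreover have "e > 0" using r c by (simp add: e_def)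
          ultimately have e: "e > 0" "e * (8 * real_of_int \<bar>j\<bar> + 4) < r" by (simp_all only: c_def)
          have "e\<^sup>2 > 0" using e by simp
          then obtain K where K: "finite K" "\<And>m. m \<notin> K \<Longrightarrow> (L2_norm \<omega> (p m))\<^sup>2 < e\<^sup>2"
            using summable_on_finite_large[OF _ sum, of "e\<^sup>2"] by auto
          obtain n :: nat where n: "K \<subseteq> {-int n..int n}" using finite_int_subset_interval[OF K(1)] .
          have small: "L2_norm \<omega> (p m) \<le> e" if "\<bar>m\<bar> \<ge> int (Suc n)" for m
          proof -
            have "m \<notin> {-int n..int n}" using that by auto
            then have "m \<notin> K" using n by blast
            then show ?thesis using K(2) e(1) power2_less_imp_less[of "L2_norm \<omega> (p m)" e] by (simp add: less_imp_le)
          qed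
          show "\<exists>no. \<forall>k\<ge>no. norm (L2_norm \<omega> (\<lambda>z. trig_sum p ((\<lambda>m. m + j) ` {-int (N k)..int (N k)}) \<eta> z - trig_sum p {-int (N k)..int (N k)} \<eta> z) - 0) < r"
          proof (intro exI[of _ "Suc n + nat \<bar>j\<bar>"] allI impI)
            fix k assume "Suc n + nat \<bar>j\<bar> \<le> k"
            then have "Suc n + nat \<bar>j\<bar> \<le> N k" using N[of k] by simp
            then have "L2_norm \<omega> (\<lambda>z. trig_sum p ((\<lambda>m. m + j) ` {-int (N k)..int (N k)}) \<eta> z - trig_sum p {-int (N k)..int (N k)} \<eta> z)
              \<le> e * (8 * real_of_int \<bar>j\<bar> + 4)"
              using small less_imp_le[OF e(1)] by (rule trig_sum_shift_le[of p \<omega>, OF pL])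
            also note e(2)
            finally show "norm (L2_norm \<omega> (\<lambda>z. trig_sum p ((\<lambda>m. m + j) ` {-int (N k)..int (N k)}) \<eta> z - trig_sum p {-int (N k)..int (N k)} \<eta> z) - 0) < r"
              by simp
          qed
        qed
        from tendsto_add[OF this elim(1)]
        have lim0: "(\<lambda>k. L2_norm \<omega> (\<lambda>z. trig_sum p ((\<lambda>m. m + j) ` {-int (N k)..int (N k)}) \<eta> z - trig_sum p {-int (N k)..int (N k)} \<eta> z)
          + L2_norm \<omega> (\<lambda>z. trig_sum p {-int (N k)..int (N k)} \<eta> z - G \<eta> z)) \<longlonglongrightarrow> 0" by simp
        have le: "L2_norm \<omega> (\<lambda>z. h k (z + of_int j) - E j * G \<eta> z) \<le>
          L2_norm \<omega> (\<lambda>z. trig_sum p ((\<lambda>m. m + j) ` {-int (N k)..int (N k)}) \<eta> z - trig_sum p {-int (N k)..int (N k)} \<eta> z)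
          + L2_norm \<omega> (\<lambda>z. trig_sum p {-int (N k)..int (N k)} \<eta> z - G \<eta> z)" for k
        proof -
          have "L2_norm \<omega> (\<lambda>z. h k (z + of_int j) - E j * G \<eta> z) =
            L2_norm \<omega> (\<lambda>z. E j * (trig_sum p ((\<lambda>m. m + j) ` {-int (N k)..int (N k)}) \<eta> z - G \<eta> z))"
            by (rule L2_cong(2)) (simp add: hE right_diff_distrib)
          also have "\<dots> = L2_norm \<omega> (\<lambda>z. trig_sum p ((\<lambda>m. m + j) ` {-int (N k)..int (N k)}) \<eta> z - G \<eta> z)"
            by (simp only: L2_norm_mult nE mult_1)
          also note L2_norm_triangle_diff[OF trig_sum_L2[of p, OF pL] trig_sum_L2[of p, OF pL] GL]
          finally show ?thesis .
        qed
        have "(\<lambda>k. L2_norm \<omega> (\<lambda>z. h k (z + of_int j) - E j * G \<eta> z)) \<longlonglongrightarrow> 0"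
          by (rule Lim_null_comparison[OF always_eventually lim0]) (use le in simp)
        then show "(\<lambda>k. L2_norm \<omega> (\<lambda>z. h k (z + of_int j) - exp (\<i> * of_real \<eta> * of_int j) * G \<eta> z)) \<longlonglongrightarrow> 0"
          by (simp only: E_def)
      qed
      then show ?case using quasi_ext_A2_ext[OF GA] A2_ext_A2_eta by blast
    qed
    then have "G \<in> L2_A2_eta a b \<omega>" using G by (simp add: L2_A2_eta_def)
    then show thesis using Gfl by (rule that)
  qed
qed

text \<open>For finite sums Parseval's identity is exact, and both norms are limits of the same
  expressions over finite index sets. The statement concerns every representative of the
  transform.\<close>

lemma floquet_norm:
  assumes f: "f \<in> A2 \<Omega>" and F: "F \<in> floquet \<omega> f"
  shows "bochner_norm \<omega> F = L2_norm \<Omega> f"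
proof -
  have Fb: "F \<in> bochner_L2 \<omega> (L2 \<omega>)" using F by (simp add: floquet_def)
  have lim: "((\<lambda>K. bochner_norm \<omega> (\<lambda>\<eta> z. floquet_sum f K \<eta> z - F \<eta> z)) \<longlongrightarrow> 0) (finite_subsets_at_top UNIV)"
    using F by (simp add: floquet_def)
  have zero: "(\<lambda>\<eta> z. 0) \<in> bochner_L2 \<omega> (L2 \<omega>)" using bochner_L2_lincomb[OF Fb Fb, of 0 0] by simp
  have le: "norm (bochner_norm \<omega> (floquet_sum f K) - bochner_norm \<omega> F) \<le> bochner_norm \<omega> (\<lambda>\<eta> z. floquet_sum f K \<eta> z - F \<eta> z)"
    if K: "finite K" for K
    using bochner_norm_triangle_diff[OF floquet_sum_bochner_L2[OF f K] Fb zero]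
      bochner_norm_triangle_diff[OF Fb floquet_sum_bochner_L2[OF f K] zero]
      bochner_norm_minus_commute[of \<omega> "floquet_sum f K" F] by simp
  have "((\<lambda>K. bochner_norm \<omega> (floquet_sum f K) - bochner_norm \<omega> F) \<longlongrightarrow> 0) (finite_subsets_at_top UNIV)"
    by (rule Lim_null_comparison[OF eventually_finite_subsets_at_top_weakI lim]) (rule le)
  then have "((\<lambda>K. bochner_norm \<omega> (floquet_sum f K)) \<longlongrightarrow> bochner_norm \<omega> F) (finite_subsets_at_top UNIV)"
    by (simp add: LIM_zero_iff)
  then have 1: "((\<lambda>K. (bochner_norm \<omega> (floquet_sum f K))\<^sup>2) \<longlongrightarrow> (bochner_norm \<omega> F)\<^sup>2) (finite_subsets_at_top UNIV)"
    by (intro tendsto_power)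
  have "((\<lambda>K. \<Sum>m\<in>K. (L2_norm \<omega> (\<lambda>z. f (z + of_int m)))\<^sup>2) \<longlongrightarrow> (L2_norm \<Omega> f)\<^sup>2) (finite_subsets_at_top UNIV)"
    using A2_Omega_shift(2)[OF f] by (simp add: has_sum_def)
  then have 2: "((\<lambda>K. (bochner_norm \<omega> (floquet_sum f K))\<^sup>2) \<longlongrightarrow> (L2_norm \<Omega> f)\<^sup>2) (finite_subsets_at_top UNIV)"
    by (rule Lim_transform_eventually)
       (rule eventually_finite_subsets_at_top_weakI, simp add: bochner_norm_floquet_sum[OF f])
  have "(bochner_norm \<omega> F)\<^sup>2 = (L2_norm \<Omega> f)\<^sup>2"
    by (rule tendsto_unique[OF finite_subsets_at_top_neq_bot 1 2])
  then show ?thesis by (simp add: power2_eq_iff_nonneg)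
qed

lemma floquet_lincomb:
  assumes f: "f \<in> A2 \<Omega>" and g: "g \<in> A2 \<Omega>" and F: "F \<in> floquet \<omega> f" and G: "G \<in> floquet \<omega> g"
  shows "(\<lambda>\<eta> z. c * F \<eta> z + d * G \<eta> z) \<in> floquet \<omega> (\<lambda>z. c * f z + d * g z)"
proof -
  have Fb: "F \<in> bochner_L2 \<omega> (L2 \<omega>)" and Gb: "G \<in> bochner_L2 \<omega> (L2 \<omega>)" using F G by (simp_all add: floquet_def)
  have limF: "((\<lambda>K. bochner_norm \<omega> (\<lambda>\<eta> z. floquet_sum f K \<eta> z - F \<eta> z)) \<longlongrightarrow> 0) (finite_subsets_at_top UNIV)"
    and limG: "((\<lambda>K. bochner_norm \<omega> (\<lambda>\<eta> z. floquet_sum g K \<eta> z - G \<eta> z)) \<longlongrightarrow> 0) (finite_subsets_at_top UNIV)"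
    using F G by (simp_all add: floquet_def)
  have le: "norm (bochner_norm \<omega> (\<lambda>\<eta> z. floquet_sum (\<lambda>z. c * f z + d * g z) K \<eta> z - (c * F \<eta> z + d * G \<eta> z)))
    \<le> norm c * bochner_norm \<omega> (\<lambda>\<eta> z. floquet_sum f K \<eta> z - F \<eta> z) + norm d * bochner_norm \<omega> (\<lambda>\<eta> z. floquet_sum g K \<eta> z - G \<eta> z)"
    if K: "finite K" for K
  proof -
    have DF: "(\<lambda>\<eta> z. floquet_sum f K \<eta> z - F \<eta> z) \<in> bochner_L2 \<omega> (L2 \<omega>)"
      and DG: "(\<lambda>\<eta> z. floquet_sum g K \<eta> z - G \<eta> z) \<in> bochner_L2 \<omega> (L2 \<omega>)"
      by (intro bochner_L2_diff floquet_sum_bochner_L2 f g K Fb Gb)+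
    have cDF: "(\<lambda>\<eta> z. c * (floquet_sum f K \<eta> z - F \<eta> z)) \<in> bochner_L2 \<omega> (L2 \<omega>)"
      using bochner_L2_lincomb[OF DF DF, of c 0] by simp
    have dDG: "(\<lambda>\<eta> z. d * (floquet_sum g K \<eta> z - G \<eta> z)) \<in> bochner_L2 \<omega> (L2 \<omega>)"
      using bochner_L2_lincomb[OF DG DG, of d 0] by simp
    have "floquet_sum (\<lambda>z. c * f z + d * g z) K \<eta> z - (c * F \<eta> z + d * G \<eta> z) =
      c * (floquet_sum f K \<eta> z - F \<eta> z) + d * (floquet_sum g K \<eta> z - G \<eta> z)" for \<eta> z
      by (simp add: floquet_sum_def distrib_left sum.distrib sum_distrib_left right_diff_distrib mult_ac)
    then show ?thesis using bochner_norm_triangle[OF cDF dDG] by (simp add: bochner_norm_mult)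
  qed
  have "((\<lambda>K. norm c * bochner_norm \<omega> (\<lambda>\<eta> z. floquet_sum f K \<eta> z - F \<eta> z) + norm d * bochner_norm \<omega> (\<lambda>\<eta> z. floquet_sum g K \<eta> z - G \<eta> z)) \<longlongrightarrow> 0) (finite_subsets_at_top UNIV)"
    using tendsto_add[OF tendsto_mult_left[OF limF, of "norm c"] tendsto_mult_left[OF limG, of "norm d"]] by simp
  then have "((\<lambda>K. bochner_norm \<omega> (\<lambda>\<eta> z. floquet_sum (\<lambda>z. c * f z + d * g z) K \<eta> z - (c * F \<eta> z + d * G \<eta> z))) \<longlongrightarrow> 0) (finite_subsets_at_top UNIV)"
    by (rule Lim_null_comparison[OF eventually_finite_subsets_at_top_weakI, rotated]) (rule le)
  then show ?thesis using bochner_L2_lincomb[OF Fb Gb] by (simp add: floquet_def)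
qed

text \<open>The isometry is applied to \<open>f + c * g\<close> for the four values of
  \<open>c\<close> in the polarization identity.\<close>

lemma floquet_inner:
  assumes f: "f \<in> A2 \<Omega>" and g: "g \<in> A2 \<Omega>" and F: "F \<in> floquet \<omega> f" and G: "G \<in> floquet \<omega> g"
  shows "bochner_inner \<omega> F G = L2_inner \<Omega> f g"
proof -
  have Fb: "F \<in> bochner_L2 \<omega> (L2 \<omega>)" and Gb: "G \<in> bochner_L2 \<omega> (L2 \<omega>)" using F G by (simp_all add: floquet_def)
  have fL: "f \<in> L2 \<Omega>" and gL: "g \<in> L2 \<Omega>" using f g by (simp_all add: A2_def)
  have "bochner_norm \<omega> (\<lambda>\<eta> z. 1 * F \<eta> z + c * G \<eta> z) = L2_norm \<Omega> (\<lambda>z. 1 * f z + c * g z)" for c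
    by (rule floquet_norm[OF A2_lincomb[OF f g] floquet_lincomb[OF f g F G]])
  then have "4 * bochner_inner \<omega> F G = 4 * L2_inner \<Omega> f g"
    by (simp only: bochner_inner_polarization[OF Fb Gb] L2_inner_polarization[OF fL gL])
  then show ?thesis by simp
qed

text \<open>Links the two descriptions of a class: representatives to which the series converges,
  and functions agreeing almost everywhere with one of them.\<close>

lemma floquet_eq_bochner_class:
  assumes f: "f \<in> A2 \<Omega>" and G: "G \<in> floquet \<omega> f"
  shows "floquet \<omega> f = bochner_class \<omega> G"
proof -
  have Gb: "G \<in> bochner_L2 \<omega> (L2 \<omega>)"
    and limG: "((\<lambda>K. bochner_norm \<omega> (\<lambda>\<eta> z. floquet_sum f K \<eta> z - G \<eta> z)) \<longlongrightarrow> 0) (finite_subsets_at_top UNIV)"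
    using G by (simp_all add: floquet_def)
  have "H \<in> floquet \<omega> f \<longleftrightarrow> bochner_norm \<omega> (\<lambda>\<eta> z. H \<eta> z - G \<eta> z) = 0" if H: "H \<in> bochner_L2 \<omega> (L2 \<omega>)" for H
  proof
    assume Hf: "H \<in> floquet \<omega> f"
    show "bochner_norm \<omega> (\<lambda>\<eta> z. H \<eta> z - G \<eta> z) = 0"
    proof -
      \<comment> \<open>By linearity the difference of two representatives is a transform of the
        zero function, and its norm vanishes by the isometry.\<close>
      have "(\<lambda>\<eta> z. 1 * H \<eta> z + (-1) * G \<eta> z) \<in> floquet \<omega> (\<lambda>z. 1 * f z + (-1) * f z)"
        by (rule floquet_lincomb[OF f f Hf G])
      from floquet_norm[OF A2_lincomb[OF f f] this] show ?thesis by simp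
    qed
  next
    assume z: "bochner_norm \<omega> (\<lambda>\<eta> z. H \<eta> z - G \<eta> z) = 0"
    have "norm (bochner_norm \<omega> (\<lambda>\<eta> z. floquet_sum f K \<eta> z - H \<eta> z)) \<le> bochner_norm \<omega> (\<lambda>\<eta> z. floquet_sum f K \<eta> z - G \<eta> z)"
      if K: "finite K" for K
      using bochner_norm_triangle_diff[OF floquet_sum_bochner_L2[OF f K] Gb H] z
        bochner_norm_minus_commute[of \<omega> H G] by simp
    then have "((\<lambda>K. bochner_norm \<omega> (\<lambda>\<eta> z. floquet_sum f K \<eta> z - H \<eta> z)) \<longlongrightarrow> 0) (finite_subsets_at_top UNIV)"
      by (intro Lim_null_comparison[OF eventually_finite_subsets_at_top_weakI limG])
    then show "H \<in> floquet \<omega> f" using H by (simp add: floquet_def)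
  qed
  then have "H \<in> floquet \<omega> f \<longleftrightarrow> H \<in> bochner_class \<omega> G" for H
    using bochner_norm_eq_0_iff[OF bochner_L2_diff[OF _ Gb], of H]
    by (auto simp: bochner_class_def floquet_def)
  then show ?thesis by blast
qed

text \<open>Bergman's inequality gives vanishing at every point of \<open>\<Omega>\<close>, and the
  encoding by zero outside gives equality of functions. Injectivity therefore holds for elements of
  \<open>A2\<close>, not merely up to null sets.\<close>

lemma A2_Omega_norm_zero:
  assumes f: "f \<in> A2 \<Omega>" and zero: "L2_norm \<Omega> f = 0"
  shows "f = (\<lambda>z. 0)"
proof
  fix z
  show "f z = 0"
  proof (cases "z \<in> \<Omega>")
    case True
    have sum0: "((\<lambda>m. (L2_norm \<omega> (\<lambda>z. f (z + of_int m)))\<^sup>2) has_sum 0) (UNIV::int set)"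
      using A2_Omega_shift(2)[OF f] zero by simp
    have n0: "(L2_norm \<omega> (\<lambda>z. f (z + of_int m)))\<^sup>2 = 0" for m :: int
    proof -
      have "(\<Sum>m\<in>{m}. (L2_norm \<omega> (\<lambda>z. f (z + of_int m)))\<^sup>2) \<le> 0"
        using finite_sum_le_has_sum[OF sum0, of "{m}"] by simp
      then show ?thesis by simp
    qed
    show ?thesis
    proof (rule Bergman_Omega[OF True])
      fix r C :: real and N :: nat
      assume *: "r > 0" "C > 0" "ball z r \<subseteq> \<Omega>"
        "\<And>f w. f holomorphic_on \<Omega> \<Longrightarrow> (\<And>m::int. (\<lambda>z. f (z + of_int m)) \<in> L2 \<omega>) \<Longrightarrow> w \<in> ball z r \<Longrightarrow>
          (norm (f w))\<^sup>2 \<le> C * (\<Sum>m\<in>{-int N..int N}. (L2_norm \<omega> (\<lambda>z. f (z + of_int m)))\<^sup>2)"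
      have "(norm (f z))\<^sup>2 \<le> C * (\<Sum>m\<in>{-int N..int N}. (L2_norm \<omega> (\<lambda>z. f (z + of_int m)))\<^sup>2)"
        by (rule *(4)[OF A2_holomorphic[OF f open_Omega] A2_Omega_shift(1)[OF f]]) (use *(1) in simp)
      then show "f z = 0" by (simp add: n0)
    qed
  next
    case False
    then show ?thesis using f by (simp add: A2_def)
  qed
qed

lemma inj_on_floquet: "inj_on (floquet \<omega>) (A2 \<Omega>)"
proof (rule inj_onI)
  fix f g assume f: "f \<in> A2 \<Omega>" and g: "g \<in> A2 \<Omega>" and eq: "floquet \<omega> f = floquet \<omega> g"
  obtain G where Gf: "G \<in> floquet \<omega> f" using floquet_A2_exists[OF f] by metis
  then have Gg: "G \<in> floquet \<omega> g" by (simp add: eq)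
  have "L2_norm \<Omega> (\<lambda>z. 1 * f z + (-1) * g z) = bochner_norm \<omega> (\<lambda>\<eta> z. 1 * G \<eta> z + (-1) * G \<eta> z)"
    by (rule floquet_norm[symmetric, OF A2_lincomb[OF f g] floquet_lincomb[OF f g Gf Gg]])
  also have "\<dots> = 0" by (simp add: bochner_norm_def)
  finally have "(\<lambda>z. 1 * f z + (-1) * g z) = (\<lambda>z. 0)" by (rule A2_Omega_norm_zero[OF A2_lincomb[OF f g]])
  then show "f = g" by (simp add: fun_eq_iff)
qed

end

section \<open>The inverse transform\<close>

text \<open>Sign and prefactor are opposite and equal, respectively, to those of
  \<open>trig_sum\<close>, so that the coefficients of a trigonometric sum are its own.\<close>

definition fourier_coeff :: "(real \<Rightarrow> complex) \<Rightarrow> int \<Rightarrow> complex" where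
  "fourier_coeff v m = 1 / of_real (sqrt (2 * pi)) * (\<integral>\<eta>. exp (\<i> * of_real \<eta> * of_int m) * v \<eta> \<partial>\<T>)"

section \<open>Scalar Fourier coefficients\<close>

lemma integrable_exp_mult:
  "integrable \<T> v \<Longrightarrow> integrable \<T> (\<lambda>\<eta>. exp (\<i> * of_real \<eta> * of_int m) * v \<eta>)"
  by (intro integrable_lebesgue_on_continuous_mult continuous_intros)

lemma integrable_trig_sum: "integrable \<T> (\<lambda>\<eta>. trig_sum p K \<eta> z)"
  unfolding trig_sum_def by (intro continuous_imp_integrable_real continuous_intros)

lemma fourier_coeff_diff:
  assumes "integrable \<T> v" "integrable \<T> w"
  shows "fourier_coeff (\<lambda>\<eta>. v \<eta> - w \<eta>) m = fourier_coeff v m - fourier_coeff w m"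
  using integrable_exp_mult[OF assms(1), of m] integrable_exp_mult[OF assms(2), of m]
  by (simp add: fourier_coeff_def right_diff_distrib)

lemma sqrt_two_pi_mult: "1 / complex_of_real (sqrt (2 * pi)) * (1 / of_real (sqrt (2 * pi)) * of_real (2 * pi)) = 1"
proof -
  have "complex_of_real (sqrt (2 * pi)) * of_real (sqrt (2 * pi)) = of_real (2 * pi)"
    by (simp flip: of_real_mult)
  then show ?thesis by (simp add: field_simps)
qed

lemma fourier_coeff_trig_sum:
  assumes K: "finite K"
  shows "fourier_coeff (\<lambda>\<eta>. trig_sum p K \<eta> z) m = (if m \<in> K then p m z else 0)"
proof -
  have inte: "integrable \<T> (\<lambda>\<eta>. exp (\<i> * of_real \<eta> * of_int k))" for k
    by (intro continuous_imp_integrable_real continuous_intros)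
  have "(\<integral>\<eta>. exp (\<i> * of_real \<eta> * of_int m) * trig_sum p K \<eta> z \<partial>\<T>) =
    (\<integral>\<eta>. (\<Sum>n\<in>K. (1 / of_real (sqrt (2 * pi)) * p n z) * exp (\<i> * of_real \<eta> * of_int (m - n))) \<partial>\<T>)"
  proof (intro Bochner_Integration.integral_cong refl)
    fix \<eta> :: real
    have e: "exp (\<i> * of_real \<eta> * of_int m) * exp (- \<i> * of_real \<eta> * of_int n) = exp (\<i> * of_real \<eta> * of_int (m - n))" for n
      by (simp add: exp_add[symmetric] algebra_simps)
    have "exp (\<i> * of_real \<eta> * of_int m) * trig_sum p K \<eta> z =
      (\<Sum>n\<in>K. (1 / of_real (sqrt (2 * pi)) * p n z) * (exp (\<i> * of_real \<eta> * of_int m) * exp (- \<i> * of_real \<eta> * of_int n)))"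
      unfolding trig_sum_def sum_distrib_left by (intro sum.cong refl) (simp only: mult_ac)
    then show "exp (\<i> * of_real \<eta> * of_int m) * trig_sum p K \<eta> z =
      (\<Sum>n\<in>K. (1 / of_real (sqrt (2 * pi)) * p n z) * exp (\<i> * of_real \<eta> * of_int (m - n)))"
      by (simp only: e)
  qed
  also have "\<dots> = (\<Sum>n\<in>K. (1 / of_real (sqrt (2 * pi)) * p n z) * (if m - n = 0 then of_real (2 * pi) else 0))"
    by (simp only: Bochner_Integration.integral_sum integrable_mult_right inte integral_mult_right_zero integral_exp_int)
  also have "\<dots> = (\<Sum>n\<in>K. if n = m then 1 / of_real (sqrt (2 * pi)) * p m z * of_real (2 * pi) else 0)"
    by (intro sum.cong refl) auto
  also have "\<dots> = (if m \<in> K then 1 / of_real (sqrt (2 * pi)) * p m z * of_real (2 * pi) else 0)"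
    using K by (simp add: sum.delta)
  finally have "fourier_coeff (\<lambda>\<eta>. trig_sum p K \<eta> z) m =
     (if m \<in> K then (1 / of_real (sqrt (2 * pi)) * (1 / of_real (sqrt (2 * pi)) * of_real (2 * pi))) * p m z else 0)"
    by (simp add: fourier_coeff_def mult_ac)
  then show ?thesis by (simp only: sqrt_two_pi_mult mult_1)
qed

lemma integrable_of_square:
  fixes v :: "real \<Rightarrow> 'a::{banach, second_countable_topology}"
  assumes "v \<in> borel_measurable (lebesgue_on {a..b})" "integrable (lebesgue_on {a..b}) (\<lambda>x. (norm (v x))\<^sup>2)"
  shows "integrable (lebesgue_on {a..b}) v"
proof (rule Bochner_Integration.integrable_bound)
  show "integrable (lebesgue_on {a..b}) (\<lambda>x. 1 + (norm (v x))\<^sup>2)"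
    using assms(2) by (intro Bochner_Integration.integrable_add) auto
  have "norm (v x) \<le> norm (1 + (norm (v x))\<^sup>2)" for x
  proof -
    have "2 * norm (v x) \<le> 1 + (norm (v x))\<^sup>2" using sum_squares_bound[of 1 "norm (v x)"] by simp
    then have "norm (v x) \<le> 1 + (norm (v x))\<^sup>2" using norm_ge_zero[of "v x"] by linarith
    then show ?thesis by simp
  qed
  then show "AE x in lebesgue_on {a..b}. norm (v x) \<le> norm (1 + (norm (v x))\<^sup>2)" by simp
qed (rule assms(1))

text \<open>The square distance of \<open>v\<close> to its orthogonal projection on the exponentials
  in \<open>K\<close> is nonnegative, and it equals the square norm of \<open>v\<close> minus the
  sum of squared coefficients.\<close>

lemma Bessel:
  assumes v: "v \<in> borel_measurable \<T>" "integrable \<T> (\<lambda>\<eta>. (norm (v \<eta>))\<^sup>2)"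
    and K: "finite K"
  shows "(\<Sum>m\<in>K. (norm (fourier_coeff v m))\<^sup>2) \<le> (\<integral>\<eta>. (norm (v \<eta>))\<^sup>2 \<partial>\<T>)"
proof -
  have vi: "integrable \<T> v" by (rule integrable_of_square[OF v])
  define c where "c = fourier_coeff v"
  \<comment> \<open>The projection as a trigonometric sum with constant coefficients; the point 0 is
    a dummy argument.\<close>
  define s where "s \<eta> = trig_sum (\<lambda>m z. c m) K \<eta> 0" for \<eta>
  define A where "A = (\<Sum>m\<in>K. (norm (c m))\<^sup>2)"
  have s: "cnj (s \<eta>) = (\<Sum>m\<in>K. (1 / of_real (sqrt (2 * pi)) * cnj (c m)) * exp (\<i> * of_real \<eta> * of_int m))" for \<eta>
    by (simp add: s_def trig_sum_def exp_cnj sum_distrib_left mult_ac)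
  have pair: "integrable \<T> (\<lambda>\<eta>. w \<eta> * cnj (s \<eta>))"
    "(\<integral>\<eta>. w \<eta> * cnj (s \<eta>) \<partial>\<T>) = (\<Sum>m\<in>K. cnj (c m) * fourier_coeff w m)"
    if w: "integrable \<T> w" for w
  proof -
    have eq: "w \<eta> * cnj (s \<eta>) = (\<Sum>m\<in>K. (1 / of_real (sqrt (2 * pi)) * cnj (c m)) * (exp (\<i> * of_real \<eta> * of_int m) * w \<eta>))" for \<eta>
      unfolding s sum_distrib_left by (intro sum.cong refl) (simp only: mult_ac)
    show "integrable \<T> (\<lambda>\<eta>. w \<eta> * cnj (s \<eta>))"
      unfolding eq by (intro Bochner_Integration.integrable_sum integrable_mult_right integrable_exp_mult w)
    show "(\<integral>\<eta>. w \<eta> * cnj (s \<eta>) \<partial>\<T>) = (\<Sum>m\<in>K. cnj (c m) * fourier_coeff w m)"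
    proof -
      have "(\<integral>\<eta>. w \<eta> * cnj (s \<eta>) \<partial>\<T>) =
        (\<Sum>m\<in>K. (1 / of_real (sqrt (2 * pi)) * cnj (c m)) * (\<integral>\<eta>. exp (\<i> * of_real \<eta> * of_int m) * w \<eta> \<partial>\<T>))"
        unfolding eq by (simp only: Bochner_Integration.integral_sum integrable_mult_right integrable_exp_mult[OF w] integral_mult_right_zero)
      also have "\<dots> = (\<Sum>m\<in>K. cnj (c m) * fourier_coeff w m)"
        unfolding fourier_coeff_def by (intro sum.cong refl) (simp only: mult_ac)
      finally show ?thesis .
    qed
  qed
  have cc: "(\<Sum>m\<in>K. cnj (c m) * c m) = of_real A"
    unfolding A_def of_real_sum complex_norm_square by (simp only: mult.commute)
  have vs: "(\<integral>\<eta>. v \<eta> * cnj (s \<eta>) \<partial>\<T>) = of_real A"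
    using pair(2)[OF vi] cc by (simp add: c_def)
  have si: "integrable \<T> s" unfolding s_def by (rule integrable_trig_sum)
  have ss: "(\<integral>\<eta>. s \<eta> * cnj (s \<eta>) \<partial>\<T>) = of_real A"
  proof -
    have "fourier_coeff s m = c m" if "m \<in> K" for m
      using fourier_coeff_trig_sum[OF K, of "\<lambda>m z. c m" 0 m] that by (simp add: s_def[abs_def])
    then show ?thesis using pair(2)[OF si] cc by simp
  qed
  have vv: "integrable \<T> (\<lambda>\<eta>. complex_of_real ((norm (v \<eta>))\<^sup>2))"
    using v(2) by (rule integrable_of_real)
  have cs: "integrable \<T> (\<lambda>\<eta>. cnj (v \<eta> * cnj (s \<eta>)))"
    by (intro integrable_cnj pair vi)
  have cv: "(\<integral>\<eta>. cnj (v \<eta> * cnj (s \<eta>)) \<partial>\<T>) = cnj (of_real A)"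
    using integral_bounded_linear[OF bounded_linear_cnj pair(1)[OF vi]] by (simp only: vs)
  have pt: "complex_of_real ((norm (v \<eta> - s \<eta>))\<^sup>2) = of_real ((norm (v \<eta>))\<^sup>2) - v \<eta> * cnj (s \<eta>) - cnj (v \<eta> * cnj (s \<eta>)) + s \<eta> * cnj (s \<eta>)" for \<eta>
    unfolding complex_norm_square by (simp add: algebra_simps)
  have "complex_of_real (\<integral>\<eta>. (norm (v \<eta> - s \<eta>))\<^sup>2 \<partial>\<T>) =
    (\<integral>\<eta>. of_real ((norm (v \<eta>))\<^sup>2) - v \<eta> * cnj (s \<eta>) - cnj (v \<eta> * cnj (s \<eta>)) + s \<eta> * cnj (s \<eta>) \<partial>\<T>)"
    unfolding integral_complex_of_real[symmetric] pt ..
  also have "\<dots> = (\<integral>\<eta>. of_real ((norm (v \<eta>))\<^sup>2) \<partial>\<T>) - of_real A - cnj (of_real A) + of_real A"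
    using vv pair(1)[OF vi] cs pair(1)[OF si]
    by (simp only: Bochner_Integration.integral_add Bochner_Integration.integral_diff
       Bochner_Integration.integrable_diff vs ss cv)
  also have "\<dots> = of_real ((\<integral>\<eta>. (norm (v \<eta>))\<^sup>2 \<partial>\<T>) - A)"
    by (simp only: integral_complex_of_real of_real_diff complex_cnj_complex_of_real) simp
  finally have "(\<integral>\<eta>. (norm (v \<eta> - s \<eta>))\<^sup>2 \<partial>\<T>) = (\<integral>\<eta>. (norm (v \<eta>))\<^sup>2 \<partial>\<T>) - A"
    by (simp only: of_real_eq_iff)
  moreover have "(\<integral>\<eta>. (norm (v \<eta> - s \<eta>))\<^sup>2 \<partial>\<T>) \<ge> 0" by simp
  ultimately show ?thesis by (simp add: A_def c_def)
qed

context floquet_cell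
begin

section \<open>Point values of Bochner functions\<close>

lemma bochner_A2_approx:
  assumes G: "G \<in> bochner_L2 \<omega> (A2 \<omega>)"
  obtains T where "\<And>n. simple_function \<T> (T n)" "\<And>n \<eta>. \<eta> \<in> {-pi..pi} \<Longrightarrow> T n \<eta> \<in> A2 \<omega>"
    "AE \<eta> in \<T>. \<forall>z\<in>\<omega>. (\<lambda>n. T n \<eta> z) \<longlonglongrightarrow> G \<eta> z"
proof -
  obtain T :: "nat \<Rightarrow> real \<Rightarrow> complex \<Rightarrow> complex"
    where T: "\<And>n. simple_function \<T> (T n)" "\<And>n \<eta>. \<eta> \<in> {-pi..pi} \<Longrightarrow> T n \<eta> \<in> A2 \<omega>"
    and lim: "AE \<eta> in \<T>. (\<lambda>n. L2_norm \<omega> (\<lambda>z. T n \<eta> z - G \<eta> z)) \<longlonglongrightarrow> 0"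
    using G unfolding bochner_L2_def strongly_measurable_def by blast
  have "AE \<eta> in \<T>. \<forall>z\<in>\<omega>. (\<lambda>n. T n \<eta> z) \<longlonglongrightarrow> G \<eta> z"
    using lim AE_space
  proof eventually_elim
    case (elim \<eta>)
    have eta: "\<eta> \<in> {-pi..pi}" using elim(2) by simp
    have GA: "G \<eta> \<in> A2 \<omega>" using G eta by (simp add: bochner_L2_def)
    have L2: "f \<in> L2 \<omega>" if "f \<in> A2 \<omega>" for f using that by (simp add: A2_def)
    show ?case
    proof
      fix z assume "z \<in> \<omega>"
      then show "(\<lambda>n. T n \<eta> z) \<longlonglongrightarrow> G \<eta> z"
        by (rule L2_limit_pointwise[where g = "\<lambda>n. T n \<eta>" and g' = "G \<eta>", OF A2_holomorphic[OF T(2)[OF eta] open_cell]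
            A2_holomorphic[OF GA open_cell] L2[OF T(2)[OF eta]] L2[OF GA] elim(1)])
    qed
  qed
  with T show thesis by (rule that)
qed

lemma bochner_A2_measurable:
  assumes G: "G \<in> bochner_L2 \<omega> (A2 \<omega>)" and z: "z \<in> \<omega>"
  shows "(\<lambda>\<eta>. G \<eta> z) \<in> borel_measurable \<T>"
proof (rule bochner_A2_approx[OF G])
  fix T :: "nat \<Rightarrow> real \<Rightarrow> complex \<Rightarrow> complex"
  assume T: "\<And>n. simple_function \<T> (T n)"
    and lim: "AE \<eta> in \<T>. \<forall>z\<in>\<omega>. (\<lambda>n. T n \<eta> z) \<longlonglongrightarrow> G \<eta> z"
  show ?thesis
  proof (rule borel_measurable_lebesgue_on_AE_limit)
    show "(\<lambda>\<eta>. T n \<eta> z) \<in> borel_measurable \<T>" for n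
      using simple_function_compose[OF T, of "\<lambda>g. g z" n] by (simp add: o_def borel_measurable_simple_function)
    show "AE \<eta> in \<T>. (\<lambda>n. T n \<eta> z) \<longlonglongrightarrow> G \<eta> z"
      using lim by eventually_elim (use z in blast)
  qed auto
qed

text \<open>Tonelli's theorem needs measurability in both variables jointly, whereas strong
  measurability speaks of functions of \<open>\<eta>\<close> alone. It is recovered from the
  approximating simple functions, which converge at every point of the cell outside a null set of
  \<open>\<eta>\<close>.\<close>

lemma nn_integral_bochner_A2_swap:
  assumes G: "G \<in> bochner_L2 \<omega> (A2 \<omega>)"
  shows "(\<integral>\<^sup>+z. indicator \<omega> z * (\<integral>\<^sup>+\<eta>. ennreal ((norm (G \<eta> z))\<^sup>2) \<partial>\<T>) \<partial>lborel)
    = (\<integral>\<^sup>+\<eta>. ennreal ((L2_norm \<omega> (G \<eta>))\<^sup>2) \<partial>\<T>)"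
proof (rule bochner_A2_approx[OF G])
  fix T :: "nat \<Rightarrow> real \<Rightarrow> complex \<Rightarrow> complex"
  assume T: "\<And>n. simple_function \<T> (T n)" "\<And>n \<eta>. \<eta> \<in> {-pi..pi} \<Longrightarrow> T n \<eta> \<in> A2 \<omega>"
    and lim: "AE \<eta> in \<T>. \<forall>z\<in>\<omega>. (\<lambda>n. T n \<eta> z) \<longlonglongrightarrow> G \<eta> z"
  define I where "I = \<T>"
  interpret I: finite_measure I unfolding I_def by (rule finite_measure_lebesgue_on) auto
  interpret P: pair_sigma_finite I "lborel :: complex measure" ..
  have spI: "space I = {-pi..pi}" by (simp add: I_def)
  obtain N where N: "{\<eta> \<in> space I. \<not> (\<forall>z\<in>\<omega>. (\<lambda>n. T n \<eta> z) \<longlonglongrightarrow> G \<eta> z)} \<subseteq> N" "N \<in> null_sets I"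
    using lim unfolding eventually_ae_filter I_def by blast
  have AEN: "AE \<eta> in I. \<eta> \<notin> N" using N(2) by (rule AE_not_in)
  define Q where "Q g z = indicator \<omega> z *\<^sub>R g z" for g :: "complex \<Rightarrow> complex" and z
  have Qm: "Q g \<in> borel_measurable lborel" if "g \<in> A2 \<omega>" for g
  proof -
    have "continuous_on \<omega> g" using A2_holomorphic[OF that open_cell] by (rule holomorphic_on_imp_continuous_on)
    then have "Q g \<in> borel_measurable borel"
      unfolding Q_def[abs_def] using open_cell by (intro borel_measurable_continuous_on_indicator) auto
    then show ?thesis by simp
  qed
  \<comment> \<open>A simple function takes finitely many values, each continuous on the cell, so
    \<open>W n\<close> is a finite sum of products of a function of \<open>\<eta>\<close> and a
    Borel function of \<open>z\<close>.\<close>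
  define W where "W n x = indicator (space I - N) (fst x) *\<^sub>R Q (T n (fst x)) (snd x)" for n and x :: "real \<times> complex"
  have Wm: "W n \<in> borel_measurable (I \<Otimes>\<^sub>M lborel)" for n
  proof -
    have sT: "simple_function I (T n)" using T(1) by (simp add: I_def)
    have fin: "finite (T n ` space I)" using sT by (rule simple_functionD(1))
    have "(\<lambda>x. \<Sum>g\<in>T n ` space I. indicator (T n -` {g} \<inter> space I - N) (fst x) *\<^sub>R Q g (snd x)) \<in> borel_measurable (I \<Otimes>\<^sub>M lborel)"
    proof (intro borel_measurable_sum borel_measurable_scaleR)
      fix g assume "g \<in> T n ` space I"
      then have g: "g \<in> A2 \<omega>" using T(2) spI by auto
      have "T n -` {g} \<inter> space I - N \<in> sets I"
        using simple_functionD(2)[OF sT] N(2) by (intro sets.Diff) auto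
      then show "(\<lambda>x. indicator (T n -` {g} \<inter> space I - N) (fst x) :: real) \<in> borel_measurable (I \<Otimes>\<^sub>M lborel)"
        by (intro measurable_compose[OF measurable_fst] borel_measurable_indicator)
      show "(\<lambda>x. Q g (snd x)) \<in> borel_measurable (I \<Otimes>\<^sub>M lborel)"
        by (rule measurable_compose[OF measurable_snd Qm[OF g]])
    qed
    moreover have "W n x = (\<Sum>g\<in>T n ` space I. indicator (T n -` {g} \<inter> space I - N) (fst x) *\<^sub>R Q g (snd x))"
      if "x \<in> space (I \<Otimes>\<^sub>M (lborel :: complex measure))" for x
    proof -
      have x: "fst x \<in> space I" using that by (auto simp: space_pair_measure)
      have "(\<Sum>g\<in>T n ` space I. indicator (T n -` {g} \<inter> space I - N) (fst x) *\<^sub>R Q g (snd x)) =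
        (\<Sum>g\<in>T n ` space I. if g = T n (fst x) then W n x else 0)"
        using x by (intro sum.cong refl) (auto simp: W_def indicator_def)
      also have "\<dots> = W n x" using fin x by simp
      finally show ?thesis by simp
    qed
    ultimately show ?thesis by (subst measurable_cong) auto
  qed
  define V where "V x = indicator (space I - N) (fst x) *\<^sub>R Q (G (fst x)) (snd x)" for x :: "real \<times> complex"
  have "V \<in> borel_measurable (I \<Otimes>\<^sub>M lborel)"
  proof (rule borel_measurable_LIMSEQ_metric[OF Wm])
    fix x assume "x \<in> space (I \<Otimes>\<^sub>M (lborel :: complex measure))"
    show "(\<lambda>n. W n x) \<longlonglongrightarrow> V x"
    proof (cases "fst x \<in> space I - N \<and> snd x \<in> \<omega>")
      case True
      then have "(\<lambda>n. T n (fst x) (snd x)) \<longlonglongrightarrow> G (fst x) (snd x)" using N(1) by blast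
      then show ?thesis using True by (simp add: W_def V_def Q_def)
    next
      case False
      then show ?thesis by (auto simp: W_def V_def Q_def)
    qed
  qed
  then have "(\<lambda>x. ennreal ((norm (V x))\<^sup>2)) \<in> borel_measurable (I \<Otimes>\<^sub>M lborel)" by measurable
  then have Vm: "(\<lambda>(\<eta>, z). ennreal ((norm (V (\<eta>, z)))\<^sup>2)) \<in> borel_measurable (I \<Otimes>\<^sub>M lborel)"
    by (simp add: case_prod_beta)
  have "(\<integral>\<^sup>+z. indicator \<omega> z * (\<integral>\<^sup>+\<eta>. ennreal ((norm (G \<eta> z))\<^sup>2) \<partial>I) \<partial>lborel)
    = (\<integral>\<^sup>+z. (\<integral>\<^sup>+\<eta>. ennreal ((norm (V (\<eta>, z)))\<^sup>2) \<partial>I) \<partial>lborel)"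
  proof (intro nn_integral_cong)
    fix z :: complex
    show "indicator \<omega> z * (\<integral>\<^sup>+\<eta>. ennreal ((norm (G \<eta> z))\<^sup>2) \<partial>I) = (\<integral>\<^sup>+\<eta>. ennreal ((norm (V (\<eta>, z)))\<^sup>2) \<partial>I)"
    proof (cases "z \<in> \<omega>")
      case True
      have "(\<integral>\<^sup>+\<eta>. ennreal ((norm (G \<eta> z))\<^sup>2) \<partial>I) = (\<integral>\<^sup>+\<eta>. ennreal ((norm (V (\<eta>, z)))\<^sup>2) \<partial>I)"
      proof (rule nn_integral_cong_AE)
        show "AE \<eta> in I. ennreal ((norm (G \<eta> z))\<^sup>2) = ennreal ((norm (V (\<eta>, z)))\<^sup>2)"
          using AEN AE_space by eventually_elim (use True in \<open>simp add: V_def Q_def\<close>)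
      qed
      then show ?thesis using True by simp
    next
      case False
      then show ?thesis by (simp add: V_def Q_def)
    qed
  qed
  also have "\<dots> = (\<integral>\<^sup>+\<eta>. (\<integral>\<^sup>+z. ennreal ((norm (V (\<eta>, z)))\<^sup>2) \<partial>lborel) \<partial>I)"
    using P.Fubini'[of "\<lambda>\<eta> z. ennreal ((norm (V (\<eta>, z)))\<^sup>2)", OF Vm] .
  also have "\<dots> = (\<integral>\<^sup>+\<eta>. ennreal ((L2_norm \<omega> (G \<eta>))\<^sup>2) \<partial>I)"
  proof (rule nn_integral_cong_AE)
    show "AE \<eta> in I. (\<integral>\<^sup>+z. ennreal ((norm (V (\<eta>, z)))\<^sup>2) \<partial>lborel) = ennreal ((L2_norm \<omega> (G \<eta>))\<^sup>2)"
      using AEN AE_space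
    proof eventually_elim
      case (elim \<eta>)
      have "G \<eta> \<in> A2 \<omega>" using G elim(2) spI by (simp add: bochner_L2_def)
      then have GL: "G \<eta> \<in> L2 \<omega>" "G \<eta> \<in> borel_measurable (lebesgue_on \<omega>)" by (auto simp: A2_def L2_def)
      have "(\<integral>\<^sup>+z. ennreal ((norm (V (\<eta>, z)))\<^sup>2) \<partial>lborel) = (\<integral>\<^sup>+z. indicator \<omega> z * ennreal ((norm (G \<eta> z))\<^sup>2) \<partial>lborel)"
        using elim by (intro nn_integral_cong) (auto simp: V_def Q_def indicator_def)
      also have "\<dots> = ennreal ((L2_norm \<omega> (G \<eta>))\<^sup>2)"
        by (rule L2_iff_nn_integral(2)[OF sets_cell GL(2,1), symmetric])
      finally show ?case .
    qed
  qed
  finally show ?thesis by (simp only: I_def)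
qed

lemma L2_A2_eta_quasi_ext:
  assumes G: "G \<in> L2_A2_eta a b \<omega>"
  obtains h where "AE \<eta> in \<T>. quasi_ext \<eta> (G \<eta>) (h \<eta>)"
proof -
  define h where "h \<eta> = (SOME H. quasi_ext \<eta> (G \<eta>) H)" for \<eta>
  have "AE \<eta> in \<T>. G \<eta> \<in> A2_eta a b \<omega> \<eta>"
    using G by (simp add: L2_A2_eta_def)
  then have "AE \<eta> in \<T>. quasi_ext \<eta> (G \<eta>) (h \<eta>)"
  proof eventually_elim
    case (elim \<eta>)
    from someI_ex[OF A2_eta_quasi_ext[OF elim]] show ?case by (simp add: h_def)
  qed
  then show thesis by (rule that)
qed

text \<open>The extensions \<open>h \<eta>\<close> may come from a choice for each
  \<open>\<eta>\<close>, so measurability has to be inherited from \<open>G\<close>. Off the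
  vertical lines the multiplier law expresses \<open>h\<close> by \<open>G\<close>; points on a line
  are limits of points to their right.\<close>

lemma quasi_ext_measurable:
  assumes G: "G \<in> bochner_L2 \<omega> (A2 \<omega>)" and h: "AE \<eta> in \<T>. quasi_ext \<eta> (G \<eta>) (h \<eta>)"
    and z: "z \<in> \<Omega>"
  shows "(\<lambda>\<eta>. h \<eta> z) \<in> borel_measurable \<T>"
proof -
  have inner: "(\<lambda>\<eta>. h \<eta> w) \<in> borel_measurable \<T>" if w: "w \<in> \<Omega>" "Re w \<notin> \<int>" for w
  proof -
    define m where "m = \<lfloor>Re w\<rfloor>"
    have wm: "w - of_int m \<in> \<omega>" unfolding m_def by (rule Omega_floor[OF w])
    have e: "(\<lambda>\<eta>. exp (\<i> * of_real \<eta> * of_int m)) \<in> borel_measurable \<T>"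
      by (intro continuous_imp_measurable_on_sets_lebesgue continuous_intros) auto
    show ?thesis
    proof (rule borel_measurable_lebesgue_on_AE_limit)
      show "(\<lambda>\<eta>. exp (\<i> * of_real \<eta> * of_int m) * G \<eta> (w - of_int m)) \<in> borel_measurable \<T>" for n :: nat
        by (rule borel_measurable_times[OF e bochner_A2_measurable[OF G wm]])
      show "AE \<eta> in \<T>. (\<lambda>n. exp (\<i> * of_real \<eta> * of_int m) * G \<eta> (w - of_int m)) \<longlonglongrightarrow> h \<eta> w"
        using h
      proof eventually_elim
        case (elim \<eta>)
        then have "h \<eta> (w - of_int m + of_int m) = exp (\<i> * of_real \<eta> * of_int m) * G \<eta> (w - of_int m)"
          using wm unfolding quasi_ext_def by blast
        then show ?case by simp
      qed
    qed auto
  qed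
  show ?thesis
  proof (cases "Re z \<in> \<int>")
    case True
    obtain e where e: "e > 0" "ball z e \<subseteq> \<Omega>" using z open_Omega open_contains_ball by blast
    \<comment> \<open>Steps shorter than 1 from an integer abscissa never reach another integer, and
      steps shorter than \<open>e\<close> stay in \<open>\<Omega>\<close>.\<close>
    define d where "d = min e 1 / 2"
    have d: "0 < d" "d < e" "d < 1" using e by (auto simp: d_def)
    define x where "x n = z + of_real (d / real (Suc n))" for n
    have dn: "0 < d / real (Suc n)" "d / real (Suc n) \<le> d" for n
    proof -
      show "0 < d / real (Suc n)" using d(1) by simp
      have "d / real (Suc n) \<le> d / 1" using d(1) by (intro divide_left_mono) auto
      then show "d / real (Suc n) \<le> d" by simp
    qed
    have xO: "x n \<in> \<Omega>" for n
    proof -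
      have "dist z (x n) = d / real (Suc n)" using dn(1)[of n] unfolding x_def dist_norm
        by (simp only: norm_minus_commute[of z] add_diff_cancel_left' norm_of_real abs_of_pos)
      then have "x n \<in> ball z e" using dn(2)[of n] d(2) by simp
      then show ?thesis using e(2) by blast
    qed
    have xI: "Re (x n) \<notin> \<int>" for n
    proof
      assume "Re (x n) \<in> \<int>"
      then have "Re (x n) - Re z \<in> \<int>" using True by (rule Ints_diff)
      then have i: "d / real (Suc n) \<in> \<int>" by (simp add: x_def del: of_nat_Suc)
      have "\<bar>d / real (Suc n)\<bar> < 1" using dn[of n] d(3) by linarith
      with i have "d / real (Suc n) = 0" using Ints_nonzero_abs_less1 by blast
      then show False using dn(1)[of n] by simp
    qed
    have "(\<lambda>n. z + of_real (d * inverse (real (Suc n)))) \<longlonglongrightarrow> z + of_real (d * 0)"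
      by (intro tendsto_intros LIMSEQ_inverse_real_of_nat)
    then have xlim: "x \<longlonglongrightarrow> z" by (simp add: x_def[abs_def] divide_inverse del: of_nat_Suc)
    show ?thesis
    proof (rule borel_measurable_lebesgue_on_AE_limit)
      show "(\<lambda>\<eta>. h \<eta> (x n)) \<in> borel_measurable \<T>" for n
        by (rule inner[OF xO xI])
      show "AE \<eta> in \<T>. (\<lambda>n. h \<eta> (x n)) \<longlonglongrightarrow> h \<eta> z"
        using h
      proof eventually_elim
        case (elim \<eta>)
        then have "continuous_on \<Omega> (h \<eta>)"
          unfolding quasi_ext_def using holomorphic_on_imp_continuous_on by blast
        then have "isCont (h \<eta>) z" using z continuous_on_eq_continuous_at[OF open_Omega] by blast
        then show ?case using xlim by (rule isCont_tendsto_compose)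
      qed
    qed auto
  qed (rule inner[OF z])
qed

lemma bochner_A2_square_integrable:
  assumes G: "G \<in> bochner_L2 \<omega> (A2 \<omega>)" and z: "z \<in> \<omega>"
  shows "integrable \<T> (\<lambda>\<eta>. (norm (G \<eta> z))\<^sup>2)" "integrable \<T> (\<lambda>\<eta>. G \<eta> z)"
proof -
  have m: "(\<lambda>\<eta>. G \<eta> z) \<in> borel_measurable \<T>" by (rule bochner_A2_measurable[OF G z])
  have sq: "integrable \<T> (\<lambda>\<eta>. (L2_norm \<omega> (G \<eta>))\<^sup>2)" using G by (simp add: bochner_L2_def)
  show 1: "integrable \<T> (\<lambda>\<eta>. (norm (G \<eta> z))\<^sup>2)"
  proof (rule Bergman_cell[OF z])
    fix r C :: real
    assume *: "r > 0" "C > 0" "ball z r \<subseteq> \<omega>"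
      "\<And>f w. f holomorphic_on \<omega> \<Longrightarrow> f \<in> L2 \<omega> \<Longrightarrow> w \<in> ball z r \<Longrightarrow> (norm (f w))\<^sup>2 \<le> C * (L2_norm \<omega> f)\<^sup>2"
    show ?thesis
    proof (rule Bochner_Integration.integrable_bound)
      show "integrable \<T> (\<lambda>\<eta>. C * (L2_norm \<omega> (G \<eta>))\<^sup>2)" using sq by simp
      show "(\<lambda>\<eta>. (norm (G \<eta> z))\<^sup>2) \<in> borel_measurable \<T>" using m by measurable
      show "AE \<eta> in \<T>. norm ((norm (G \<eta> z))\<^sup>2) \<le> norm (C * (L2_norm \<omega> (G \<eta>))\<^sup>2)"
      proof (rule AE_I2)
        fix \<eta> assume "\<eta> \<in> space \<T>"
        then have GA: "G \<eta> \<in> A2 \<omega>" using G by (simp add: bochner_L2_def)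
        then have GL: "G \<eta> \<in> L2 \<omega>" by (simp add: A2_def)
        have "(norm (G \<eta> z))\<^sup>2 \<le> C * (L2_norm \<omega> (G \<eta>))\<^sup>2"
          by (rule *(4)[OF A2_holomorphic[OF GA open_cell] GL]) (use *(1) in simp)
        then show "norm ((norm (G \<eta> z))\<^sup>2) \<le> norm (C * (L2_norm \<omega> (G \<eta>))\<^sup>2)" by simp
      qed
    qed
  qed
  show "integrable \<T> (\<lambda>\<eta>. G \<eta> z)" by (rule integrable_of_square[OF m 1])
qed

text \<open>Analyticity across the lines comes from integrating the extensions rather than
  \<open>G\<close>; the norm bound comes from Bessel's inequality at each point of the cell. The
  conclusion is phrased by Fourier coefficients on the cell, where the choice of extensions is no
  longer visible.\<close>

lemma inverse_floquet_exists:
  assumes G: "G \<in> L2_A2_eta a b \<omega>"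
  obtains f where "f \<in> A2 \<Omega>" "\<And>z m. z \<in> \<omega> \<Longrightarrow> f (z + of_int m) = fourier_coeff (\<lambda>\<eta>. G \<eta> z) m"
proof -
  have GA: "G \<in> bochner_L2 \<omega> (A2 \<omega>)" using G by (simp add: L2_A2_eta_def)
  have GbL: "G \<in> bochner_L2 \<omega> (L2 \<omega>)" using GA unfolding bochner_L2_def strongly_measurable_def A2_def by blast
  note Gm = bochner_L2_memD[OF GbL]
  obtain h where h: "AE \<eta> in \<T>. quasi_ext \<eta> (G \<eta>) (h \<eta>)"
    using L2_A2_eta_quasi_ext[OF G] .
  have Nint: "integrable \<T> (\<lambda>\<eta>. L2_norm \<omega> (G \<eta>))"
    by (rule integrable_of_square[OF Gm(4)]) (use Gm(3) in simp)
  have hol: "AE \<eta> in \<T>. h \<eta> holomorphic_on \<Omega>"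
    using h by eventually_elim (simp add: quasi_ext_def)
  have dom: "\<exists>r>0. \<exists>B. ball z r \<subseteq> \<Omega> \<and> integrable \<T> B \<and> (AE \<eta> in \<T>. \<forall>w\<in>ball z r. norm (h \<eta> w) \<le> B \<eta>)"
    if z: "z \<in> \<Omega>" for z
  proof (rule quasi_ext_bound[OF z])
    fix r C :: real
    assume *: "r > 0" "C \<ge> 0" "ball z r \<subseteq> \<Omega>"
      "\<And>\<eta> g h w. g \<in> L2 \<omega> \<Longrightarrow> quasi_ext \<eta> g h \<Longrightarrow> w \<in> ball z r \<Longrightarrow> norm (h w) \<le> C * L2_norm \<omega> g"
    have "AE \<eta> in \<T>. \<forall>w\<in>ball z r. norm (h \<eta> w) \<le> C * L2_norm \<omega> (G \<eta>)"
      using h AE_space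
    proof eventually_elim
      case (elim \<eta>)
      have "G \<eta> \<in> L2 \<omega>" using elim(2) by (intro Gm(1)) simp
      then show ?case using *(4) elim(1) by blast
    qed
    moreover have "integrable \<T> (\<lambda>\<eta>. C * L2_norm \<omega> (G \<eta>))" using Nint by simp
    ultimately show ?thesis using *(1,3) by blast
  qed
  note param = holomorphic_on_parameter_integral[OF open_Omega hol quasi_ext_measurable[OF GA h] dom]
  define f where "f z = (if z \<in> \<Omega> then 1 / of_real (sqrt (2 * pi)) * (\<integral>\<eta>. h \<eta> z \<partial>\<T>) else 0)" for z
  have "(\<lambda>z. 1 / of_real (sqrt (2 * pi)) * (\<integral>\<eta>. h \<eta> z \<partial>\<T>)) holomorphic_on \<Omega>"
    by (intro holomorphic_on_mult holomorphic_on_const param(1))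
  then have fhol: "f holomorphic_on \<Omega>" by (simp add: f_def cong: holomorphic_cong)
  have fcoeff: "f (z + of_int m) = fourier_coeff (\<lambda>\<eta>. G \<eta> z) m" if z: "z \<in> \<omega>" for z m
  proof -
    have e: "(\<lambda>\<eta>. exp (\<i> * of_real \<eta> * of_int m)) \<in> borel_measurable \<T>"
      by (intro continuous_imp_measurable_on_sets_lebesgue continuous_intros) auto
    have "(\<integral>\<eta>. h \<eta> (z + of_int m) \<partial>\<T>) = (\<integral>\<eta>. exp (\<i> * of_real \<eta> * of_int m) * G \<eta> z \<partial>\<T>)"
    proof (rule integral_cong_AE)
      show "(\<lambda>\<eta>. h \<eta> (z + of_int m)) \<in> borel_measurable \<T>"
        by (rule quasi_ext_measurable[OF GA h cell_shift[OF z]])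
      show "(\<lambda>\<eta>. exp (\<i> * of_real \<eta> * of_int m) * G \<eta> z) \<in> borel_measurable \<T>"
        by (rule borel_measurable_times[OF e bochner_A2_measurable[OF GA z]])
      show "AE \<eta> in \<T>. h \<eta> (z + of_int m) = exp (\<i> * of_real \<eta> * of_int m) * G \<eta> z"
        using h by eventually_elim (use z in \<open>simp add: quasi_ext_def\<close>)
    qed
    then show ?thesis using cell_shift[OF z] by (simp only: f_def fourier_coeff_def if_True)
  qed
  have meas: "(\<lambda>z. f (z + of_int m)) \<in> borel_measurable (lebesgue_on \<omega>)" for m by (rule measurable_cell_shift[OF fhol])
  define B where "B = (\<integral>\<eta>. (L2_norm \<omega> (G \<eta>))\<^sup>2 \<partial>\<T>)"
  \<comment> \<open>Bessel's inequality is applied for fixed \<open>z\<close>, then integrated over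
    the cell; exchanging the integrals yields the Bochner norm of \<open>G\<close>, independently of
    \<open>K\<close>.\<close>
  have bound: "(\<integral>\<^sup>+z. (\<Sum>m\<in>K. indicator \<omega> z * ennreal ((norm (f (z + of_int m)))\<^sup>2)) \<partial>lborel) \<le> ennreal B" if K: "finite K" for K
  proof -
    have "(\<integral>\<^sup>+z. (\<Sum>m\<in>K. indicator \<omega> z * ennreal ((norm (f (z + of_int m)))\<^sup>2)) \<partial>lborel) \<le>
      (\<integral>\<^sup>+z. indicator \<omega> z * (\<integral>\<^sup>+\<eta>. ennreal ((norm (G \<eta> z))\<^sup>2) \<partial>\<T>) \<partial>lborel)"
    proof (rule nn_integral_mono)
      fix z :: complex
      show "(\<Sum>m\<in>K. indicator \<omega> z * ennreal ((norm (f (z + of_int m)))\<^sup>2)) \<le>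
        indicator \<omega> z * (\<integral>\<^sup>+\<eta>. ennreal ((norm (G \<eta> z))\<^sup>2) \<partial>\<T>)"
      proof (cases "z \<in> \<omega>")
        case True
        have "(\<Sum>m\<in>K. ennreal ((norm (f (z + of_int m)))\<^sup>2)) = ennreal (\<Sum>m\<in>K. (norm (fourier_coeff (\<lambda>\<eta>. G \<eta> z) m))\<^sup>2)"
          by (simp add: fcoeff[OF True] sum_ennreal)
        also have "\<dots> \<le> ennreal (\<integral>\<eta>. (norm (G \<eta> z))\<^sup>2 \<partial>\<T>)"
          by (intro ennreal_leI Bessel bochner_A2_measurable[OF GA True] bochner_A2_square_integrable(1)[OF GA True] K)
        also have "\<dots> = (\<integral>\<^sup>+\<eta>. ennreal ((norm (G \<eta> z))\<^sup>2) \<partial>\<T>)"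
          by (rule nn_integral_eq_integral[symmetric]) (use bochner_A2_square_integrable(1)[OF GA True] in auto)
        finally show ?thesis using True by simp
      qed simp
    qed
    also have "\<dots> = (\<integral>\<^sup>+\<eta>. ennreal ((L2_norm \<omega> (G \<eta>))\<^sup>2) \<partial>\<T>)"
      by (rule nn_integral_bochner_A2_swap[OF GA])
    also have "\<dots> = ennreal B" unfolding B_def by (rule nn_integral_eq_integral) (use Gm(3) in auto)
    finally show ?thesis .
  qed
  have L2: "(\<lambda>z. f (z + of_int m)) \<in> L2 \<omega>" for m
  proof -
    have "(\<integral>\<^sup>+z. indicator \<omega> z * ennreal ((norm (f (z + of_int m)))\<^sup>2) \<partial>lborel) \<le> ennreal B"
      using bound[of "{m}"] by (simp only: finite.intros sum.insert sum.empty empty_iff not_False_eq_True add_0_right simp_thms)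
    also have "\<dots> < \<infinity>" by simp
    finally show ?thesis unfolding L2_iff_nn_integral(1)[OF sets_cell meas] .
  qed
  have fin: "(\<Sum>m\<in>K. (L2_norm \<omega> (\<lambda>z. f (z + of_int m)))\<^sup>2) \<le> B" if K: "finite K" for K
  proof -
    have "ennreal (\<Sum>m\<in>K. (L2_norm \<omega> (\<lambda>z. f (z + of_int m)))\<^sup>2) = (\<Sum>m\<in>K. ennreal ((L2_norm \<omega> (\<lambda>z. f (z + of_int m)))\<^sup>2))"
      by (simp add: sum_ennreal)
    also have "\<dots> = (\<Sum>m\<in>K. \<integral>\<^sup>+z. indicator \<omega> z * ennreal ((norm (f (z + of_int m)))\<^sup>2) \<partial>lborel)"
      by (intro sum.cong refl L2_iff_nn_integral(2)[OF sets_cell meas L2])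
    also have "\<dots> = (\<integral>\<^sup>+z. (\<Sum>m\<in>K. indicator \<omega> z * ennreal ((norm (f (z + of_int m)))\<^sup>2)) \<partial>lborel)"
    proof (rule nn_integral_sum[symmetric])
      fix m
      have "(\<lambda>z. indicator \<omega> z * ennreal ((norm (f (z + of_int m)))\<^sup>2)) \<in> borel_measurable borel"
        by (intro borel_measurable_indicator_norm_square open_cell continuous_on_cell_shift holomorphic_on_imp_continuous_on fhol)
      then show "(\<lambda>z. indicator \<omega> z * ennreal ((norm (f (z + of_int m)))\<^sup>2)) \<in> borel_measurable lborel" by simp
    qed
    also have "\<dots> \<le> ennreal B" by (rule bound[OF K])
    finally show ?thesis by (subst (asm) ennreal_le_iff) (auto simp: B_def)
  qed
  have "(\<lambda>m. (L2_norm \<omega> (\<lambda>z. f (z + of_int m)))\<^sup>2) summable_on (UNIV::int set)"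
    by (rule nonneg_bdd_above_summable_on) (use fin in \<open>auto simp: bdd_above_def\<close>)
  then have "f \<in> A2 \<Omega>" by (intro A2_Omega_I fhol L2) (simp_all add: f_def)
  then show thesis using fcoeff by (rule that)
qed

text \<open>For any finite window containing \<open>m\<close>, the coefficient of the partial sum is
  already \<open>f (z + of_int m)\<close>. The error is controlled by the one-term case of Bessel's
  inequality at \<open>z\<close> together with Bergman's inequality, and it vanishes as the window
  grows.\<close>

lemma floquet_fourier_coeff:
  assumes f: "f \<in> A2 \<Omega>" and F: "F \<in> floquet \<omega> f" and FA: "F \<in> bochner_L2 \<omega> (A2 \<omega>)" and z: "z \<in> \<omega>"
  shows "fourier_coeff (\<lambda>\<eta>. F \<eta> z) m = f (z + of_int m)"
proof -
  define p where "p m z = (if z \<in> \<omega> then f (z + of_int m) else 0)" for m :: int and z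
  have p: "p m \<in> A2 \<omega>" for m unfolding p_def by (rule A2_cell_piece[OF f])
  have pL: "p m \<in> L2 \<omega>" for m using p by (simp add: A2_def)
  have FbL: "F \<in> bochner_L2 \<omega> (L2 \<omega>)" using F by (simp add: floquet_def)
  have eq: "trig_sum p K \<eta> z = floquet_sum f K \<eta> z" if "z \<in> \<omega>" for K \<eta> z
    using that by (simp add: trig_sum_def floquet_sum_def p_def)
  have "bochner_norm \<omega> (\<lambda>\<eta> z. trig_sum p K \<eta> z - F \<eta> z) = bochner_norm \<omega> (\<lambda>\<eta> z. floquet_sum f K \<eta> z - F \<eta> z)" for K
    by (rule bochner_norm_cong) (simp add: eq)
  then have lim: "((\<lambda>K. bochner_norm \<omega> (\<lambda>\<eta> z. trig_sum p K \<eta> z - F \<eta> z)) \<longlongrightarrow> 0) (finite_subsets_at_top UNIV)"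
    using F by (simp add: floquet_def)
  show ?thesis
  proof (rule Bergman_cell[OF z])
    fix r C :: real
    assume *: "r > 0" "C > 0" "ball z r \<subseteq> \<omega>"
      "\<And>f w. f holomorphic_on \<omega> \<Longrightarrow> f \<in> L2 \<omega> \<Longrightarrow> w \<in> ball z r \<Longrightarrow> (norm (f w))\<^sup>2 \<le> C * (L2_norm \<omega> f)\<^sup>2"
    have Fi: "integrable \<T> (\<lambda>\<eta>. F \<eta> z)" by (rule bochner_A2_square_integrable(2)[OF FA z])
    have le: "(norm (f (z + of_int m) - fourier_coeff (\<lambda>\<eta>. F \<eta> z) m))\<^sup>2 \<le> C * (bochner_norm \<omega> (\<lambda>\<eta> z. trig_sum p K \<eta> z - F \<eta> z))\<^sup>2"
      if K: "finite K" "m \<in> K" for K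
    proof -
      define v where "v \<eta> = trig_sum p K \<eta> z - F \<eta> z" for \<eta>
      have D: "(\<lambda>\<eta> z. trig_sum p K \<eta> z - F \<eta> z) \<in> bochner_L2 \<omega> (L2 \<omega>)"
        by (rule bochner_L2_diff[OF trig_sum_bochner_L2[OF pL K(1)] FbL])
      note D' = bochner_L2_memD[OF D]
      have vm: "v \<in> borel_measurable \<T>"
        unfolding v_def by (intro borel_measurable_diff borel_measurable_integrable integrable_trig_sum Fi)
      have vle: "(norm (v \<eta>))\<^sup>2 \<le> C * (L2_norm \<omega> (\<lambda>z. trig_sum p K \<eta> z - F \<eta> z))\<^sup>2" if "\<eta> \<in> {-pi..pi}" for \<eta>
      proof -
        have FA': "F \<eta> \<in> A2 \<omega>" using FA that by (simp add: bochner_L2_def)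
        have "(\<lambda>z. trig_sum p K \<eta> z - F \<eta> z) holomorphic_on \<omega>"
          by (rule holomorphic_on_diff[OF A2_holomorphic[OF trig_sum_A2[of p, OF p] open_cell] A2_holomorphic[OF FA' open_cell]])
        from *(4)[OF this D'(1)[OF that], of z] show ?thesis using *(1) by (simp add: v_def)
      qed
      have Ci: "integrable \<T> (\<lambda>\<eta>. C * (L2_norm \<omega> (\<lambda>z. trig_sum p K \<eta> z - F \<eta> z))\<^sup>2)"
        using D'(3) by simp
      have vi: "integrable \<T> (\<lambda>\<eta>. (norm (v \<eta>))\<^sup>2)"
      proof (rule Bochner_Integration.integrable_bound[OF Ci])
        show "(\<lambda>\<eta>. (norm (v \<eta>))\<^sup>2) \<in> borel_measurable \<T>" using vm by measurable
        show "AE \<eta> in \<T>. norm ((norm (v \<eta>))\<^sup>2) \<le> norm (C * (L2_norm \<omega> (\<lambda>z. trig_sum p K \<eta> z - F \<eta> z))\<^sup>2)"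
          using *(2) vle by (intro AE_I2) simp
      qed
      have "fourier_coeff v m = p m z - fourier_coeff (\<lambda>\<eta>. F \<eta> z) m"
        unfolding v_def fourier_coeff_diff[OF integrable_trig_sum Fi] fourier_coeff_trig_sum[OF K(1)] using K(2) by simp
      then have "(norm (f (z + of_int m) - fourier_coeff (\<lambda>\<eta>. F \<eta> z) m))\<^sup>2 = (\<Sum>m\<in>{m}. (norm (fourier_coeff v m))\<^sup>2)"
        using z by (simp add: p_def)
      also have "\<dots> \<le> (\<integral>\<eta>. (norm (v \<eta>))\<^sup>2 \<partial>\<T>)"
        by (rule Bessel[OF vm vi]) simp
      also have "\<dots> \<le> (\<integral>\<eta>. C * (L2_norm \<omega> (\<lambda>z. trig_sum p K \<eta> z - F \<eta> z))\<^sup>2 \<partial>\<T>)"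
        by (rule integral_mono[OF vi Ci]) (use vle in simp)
      also have "\<dots> = C * (bochner_norm \<omega> (\<lambda>\<eta> z. trig_sum p K \<eta> z - F \<eta> z))\<^sup>2"
        by (simp add: bochner_norm_square)
      finally show ?thesis .
    qed
    have "((\<lambda>K. C * (bochner_norm \<omega> (\<lambda>\<eta> z. trig_sum p K \<eta> z - F \<eta> z))\<^sup>2) \<longlongrightarrow> C * 0\<^sup>2) (finite_subsets_at_top UNIV)"
      by (intro tendsto_mult_left tendsto_power lim)
    moreover have "\<forall>\<^sub>F K in finite_subsets_at_top UNIV. (norm (f (z + of_int m) - fourier_coeff (\<lambda>\<eta>. F \<eta> z) m))\<^sup>2 \<le> C * (bochner_norm \<omega> (\<lambda>\<eta> z. trig_sum p K \<eta> z - F \<eta> z))\<^sup>2"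
      unfolding eventually_finite_subsets_at_top using le by (intro exI[of _ "{m}"]) auto
    ultimately have "(norm (f (z + of_int m) - fourier_coeff (\<lambda>\<eta>. F \<eta> z) m))\<^sup>2 \<le> C * 0\<^sup>2"
      by (rule tendsto_lowerbound) (rule finite_subsets_at_top_neq_bot)
    then show ?thesis by simp
  qed
qed

text \<open>A countable dense subset of the cell suffices to compare analytic values, so the
  exceptional null set can be chosen independently of the point.\<close>

lemma bochner_A2_eq_of_fourier_coeff:
  assumes F: "F \<in> bochner_L2 \<omega> (A2 \<omega>)" and G: "G \<in> bochner_L2 \<omega> (A2 \<omega>)"
    and coeff: "\<And>z m. z \<in> \<omega> \<Longrightarrow> fourier_coeff (\<lambda>\<eta>. F \<eta> z) m = fourier_coeff (\<lambda>\<eta>. G \<eta> z) m"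
  shows "AE \<eta> in \<T>. \<forall>z\<in>\<omega>. F \<eta> z = G \<eta> z"
proof -
  obtain D where D: "countable D" "D \<subseteq> \<omega>" "\<omega> \<subseteq> closure D"
    using separable[of \<omega>] by metis
  have pt: "AE \<eta> in \<T>. F \<eta> z = G \<eta> z" if "z \<in> D" for z
  proof -
    have z: "z \<in> \<omega>" using that D(2) by blast
    have Fi: "integrable \<T> (\<lambda>\<eta>. F \<eta> z)" and Gi: "integrable \<T> (\<lambda>\<eta>. G \<eta> z)"
      by (rule bochner_A2_square_integrable(2)[OF F z], rule bochner_A2_square_integrable(2)[OF G z])
    have "fourier_coeff (\<lambda>\<eta>. F \<eta> z - G \<eta> z) m = 0" for m
      using coeff[OF z, of m] by (simp add: fourier_coeff_diff[OF Fi Gi])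
    then have "fourier_null (\<lambda>\<eta>. F \<eta> z - G \<eta> z)"
      unfolding fourier_null_def fourier_coeff_def using Fi Gi by simp
    from fourier_null_AE[OF this] show ?thesis by eventually_elim simp
  qed
  have "AE \<eta> in \<T>. \<forall>z\<in>D. F \<eta> z = G \<eta> z"
    using D(1) pt by (subst AE_ball_countable) auto
  then show ?thesis using AE_space
  proof eventually_elim
    case (elim \<eta>)
    have "F \<eta> \<in> A2 \<omega>" "G \<eta> \<in> A2 \<omega>" using F G elim(2) by (simp_all add: bochner_L2_def)
    then have cont: "continuous_on \<omega> (F \<eta>)" "continuous_on \<omega> (G \<eta>)"
      using A2_holomorphic open_cell holomorphic_on_imp_continuous_on by blast+
    show ?case
    proof
      fix z assume z: "z \<in> \<omega>"
      then have "z \<in> closure D" using D(3) by blast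
      then obtain x where x: "\<And>n. x n \<in> D" "x \<longlonglongrightarrow> z" by (auto simp: closure_sequential)
      have "isCont (F \<eta>) z" "isCont (G \<eta>) z"
        using cont z continuous_on_eq_continuous_at[OF open_cell] by blast+
      then have "(\<lambda>n. F \<eta> (x n)) \<longlonglongrightarrow> F \<eta> z" "(\<lambda>n. G \<eta> (x n)) \<longlonglongrightarrow> G \<eta> z"
        using x(2) isCont_tendsto_compose by blast+
      moreover have "(\<lambda>n. F \<eta> (x n)) = (\<lambda>n. G \<eta> (x n))" using elim(1) x(1) by simp
      ultimately show "F \<eta> z = G \<eta> z" using LIMSEQ_unique by metis
    qed
  qed
qed

text \<open>Let \<open>F\<close> be a transform of the candidate \<open>f\<close>. Then
  \<open>F\<close> and \<open>G\<close> have the same Fourier coefficients at every point of the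
  cell, hence agree almost everywhere by uniqueness, and \<open>G\<close> represents the transform
  of \<open>f\<close>.\<close>

lemma inverse_floquet:
  assumes G: "G \<in> L2_A2_eta a b \<omega>"
  obtains f where "f \<in> A2 \<Omega>" "floquet \<omega> f = bochner_class \<omega> G"
    "\<And>z m. z \<in> \<omega> \<Longrightarrow> f (z + of_int m) = fourier_coeff (\<lambda>\<eta>. G \<eta> z) m"
proof -
  have GA: "G \<in> bochner_L2 \<omega> (A2 \<omega>)" using G by (simp add: L2_A2_eta_def)
  have GbL: "G \<in> bochner_L2 \<omega> (L2 \<omega>)" using GA unfolding bochner_L2_def strongly_measurable_def A2_def by blast
  obtain f where f: "f \<in> A2 \<Omega>" and fG: "\<And>z m. z \<in> \<omega> \<Longrightarrow> f (z + of_int m) = fourier_coeff (\<lambda>\<eta>. G \<eta> z) m"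
    using inverse_floquet_exists[OF G] by metis
  obtain F where F: "F \<in> L2_A2_eta a b \<omega>" "F \<in> floquet \<omega> f" using floquet_A2_exists[OF f] by metis
  have FA: "F \<in> bochner_L2 \<omega> (A2 \<omega>)" using F(1) by (simp add: L2_A2_eta_def)
  have "AE \<eta> in \<T>. \<forall>z\<in>\<omega>. G \<eta> z = F \<eta> z"
    by (rule bochner_A2_eq_of_fourier_coeff[OF GA FA])
       (simp add: floquet_fourier_coeff[OF f F(2) FA] fG[symmetric])
  then have "AE \<eta> in \<T>. AE z in lebesgue_on \<omega>. G \<eta> z = F \<eta> z"
    by eventually_elim (auto intro: AE_I2)
  then have "G \<in> bochner_class \<omega> F" using GbL by (simp add: bochner_class_def)
  then have "G \<in> floquet \<omega> f" by (simp add: floquet_eq_bochner_class[OF f F(2)])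
  then show thesis using f fG by (intro that[of f] floquet_eq_bochner_class)
qed

section \<open>The inversion formula almost everywhere\<close>

lemma AE_Omega_cell: "AE z in lebesgue_on \<Omega>. z - of_int \<lfloor>Re z\<rfloor> \<in> \<omega>"
proof -
  have "AE z in lebesgue. Re z \<notin> \<int>" using AE_lborel_Re_not_Ints by (rule AE_completion)
  then have "AE z in lebesgue_on \<Omega>. Re z \<notin> \<int>"
    using sets_Omega by (subst AE_restrict_space_iff) auto
  then show ?thesis using AE_space by eventually_elim (rule Omega_floor, simp_all)
qed

end

text \<open>The transform acts from functions to classes of representatives, so the inverse is
  \<open>inv_into\<close> applied to \<open>bochner_class \<omega> G\<close>. Integrability
  accompanies the formula because the integral of a non-integrable function is 0 by convention.
  Linearity is stated on representatives, and the inner product for any choice of them.\<close>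

theorem theorem3p6:
  fixes M a b :: real and \<omega> :: "complex set"
  assumes "periodic_cell M a b \<omega>"
  shows "floquet \<omega> ` A2 (periodic_domain \<omega>) = bochner_class \<omega> ` L2_A2_eta a b \<omega>
    \<and> inj_on (floquet \<omega>) (A2 (periodic_domain \<omega>))
    \<and> (\<forall>G\<in>L2_A2_eta a b \<omega>. AE z in lebesgue_on (periodic_domain \<omega>).
        integrable (lebesgue_on {-pi..pi})
          (\<lambda>\<eta>. exp (\<i> * of_int \<lfloor>Re z\<rfloor> * of_real \<eta>) * G \<eta> (z - of_int \<lfloor>Re z\<rfloor>))
        \<and> inv_into (A2 (periodic_domain \<omega>)) (floquet \<omega>) (bochner_class \<omega> G) z =
            1 / of_real (sqrt (2 * pi)) *
            integral\<^sup>L (lebesgue_on {-pi..pi})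
              (\<lambda>\<eta>. exp (\<i> * of_int \<lfloor>Re z\<rfloor> * of_real \<eta>) * G \<eta> (z - of_int \<lfloor>Re z\<rfloor>)))
    \<and> (\<forall>f\<in>A2 (periodic_domain \<omega>). \<forall>g\<in>A2 (periodic_domain \<omega>).
        \<forall>F\<in>floquet \<omega> f. \<forall>G\<in>floquet \<omega> g.
          (\<forall>c d. (\<lambda>\<eta> z. c * F \<eta> z + d * G \<eta> z) \<in> floquet \<omega> (\<lambda>z. c * f z + d * g z))
        \<and> bochner_inner \<omega> F G = L2_inner (periodic_domain \<omega>) f g)"
proof -
  interpret floquet_cell M a b \<omega> by unfold_locales (rule assms)
  have onto: "floquet \<omega> ` A2 \<Omega> = bochner_class \<omega> ` L2_A2_eta a b \<omega>"
  proof
    show "floquet \<omega> ` A2 \<Omega> \<subseteq> bochner_class \<omega> ` L2_A2_eta a b \<omega>"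
    proof
      fix X assume "X \<in> floquet \<omega> ` A2 \<Omega>"
      then obtain f where f: "f \<in> A2 \<Omega>" "X = floquet \<omega> f" by blast
      obtain G where "G \<in> L2_A2_eta a b \<omega>" "G \<in> floquet \<omega> f" using floquet_A2_exists[OF f(1)] by metis
      then show "X \<in> bochner_class \<omega> ` L2_A2_eta a b \<omega>" using f floquet_eq_bochner_class by blast
    qed
    show "bochner_class \<omega> ` L2_A2_eta a b \<omega> \<subseteq> floquet \<omega> ` A2 \<Omega>"
    proof
      fix X assume "X \<in> bochner_class \<omega> ` L2_A2_eta a b \<omega>"
      then obtain G where G: "G \<in> L2_A2_eta a b \<omega>" "X = bochner_class \<omega> G" by blast
      obtain f where "f \<in> A2 \<Omega>" "floquet \<omega> f = bochner_class \<omega> G" using inverse_floquet[OF G(1)] by metis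
      then show "X \<in> floquet \<omega> ` A2 \<Omega>" using G(2) by blast
    qed
  qed
  have formula: "AE z in lebesgue_on \<Omega>.
        integrable \<T>
          (\<lambda>\<eta>. exp (\<i> * of_int \<lfloor>Re z\<rfloor> * of_real \<eta>) * G \<eta> (z - of_int \<lfloor>Re z\<rfloor>))
        \<and> inv_into (A2 \<Omega>) (floquet \<omega>) (bochner_class \<omega> G) z =
            1 / of_real (sqrt (2 * pi)) *
            integral\<^sup>L \<T>
              (\<lambda>\<eta>. exp (\<i> * of_int \<lfloor>Re z\<rfloor> * of_real \<eta>) * G \<eta> (z - of_int \<lfloor>Re z\<rfloor>))"
    if G: "G \<in> L2_A2_eta a b \<omega>" for G
  proof (rule inverse_floquet[OF G])
    fix f assume f: "f \<in> A2 \<Omega>" "floquet \<omega> f = bochner_class \<omega> G"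
      and fG: "\<And>z m. z \<in> \<omega> \<Longrightarrow> f (z + of_int m) = fourier_coeff (\<lambda>\<eta>. G \<eta> z) m"
    have GA: "G \<in> bochner_L2 \<omega> (A2 \<omega>)" using G by (simp add: L2_A2_eta_def)
    have inv: "inv_into (A2 \<Omega>) (floquet \<omega>) (bochner_class \<omega> G) = f"
      using inv_into_f_f[OF inj_on_floquet f(1)] f(2) by simp
    have comm: "exp (\<i> * of_int m * of_real \<eta>) = exp (\<i> * of_real \<eta> * of_int m)" for m \<eta>
      by (simp only: mult_ac)
    show ?thesis
      using AE_Omega_cell
    proof eventually_elim
      case (elim z)
      show ?case
        unfolding inv comm
        using integrable_exp_mult[OF bochner_A2_square_integrable(2)[OF GA elim], of "\<lfloor>Re z\<rfloor>"]
          fG[OF elim, of "\<lfloor>Re z\<rfloor>"] by (simp add: fourier_coeff_def)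
    qed
  qed
  show ?thesis
    by (intro conjI ballI allI onto inj_on_floquet formula floquet_lincomb floquet_inner)
qed

end
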